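(* Let $m\ge 2$ and let $\Gamma\le \operatorname{Aut}(T_m)$ be an automaton group of degree $2$, where $T_m$ is the rooted infinite $m$-ary tree. Then there is a ray (end) $\xi$ of $T_m$ such that the Schreier graph of the action of $\Gamma$ on the orbit of $\xi$ is recurrent. Equivalently, the Schreier graph of the natural action of $\Gamma$ on the set of ends of $T_m$ has a recurrent connected component.
   Context: $T_m$ is the rooted infinite $m$-ary tree, whose vertices are the finite words over $\{0,\dots,m-1\}$, and $\operatorname{Aut}(T_m)$ is the group of its automorphisms as a rooted tree. Rays (ends) of $T_m$ are the infinite rays starting at the root; $\operatorname{Aut}(T_m)$ acts naturally on them. For a vertex $v$ and $g\in\operatorname{Aut}(T_m)$, $g$ maps the subtree above $v$ isomorphically onto the subtree above the image of $v$; identifying both subtrees canonically with $T_m$, this gives an automorphism $g_v\in\operatorname{Aut}(T_m)$, called the section of $g$ at $v$. An automaton group is a subgroup of $\operatorname{Aut}(T_m)$ generated by a finite set $S$ such that every section $g_v$ of every $g\in S$ again belongs to $S$. The activity of $g$ at level $n$, denoted $a_n(g)$, is the number of vertices $v$ at level $n$ such that $g_v$ is not the identity. An automaton group $\Gamma$ has degree $d$ if $a_n(g)=O(n^d)$ as $n\to\infty$ for every $g\in\Gamma$ (so degree $2$ includes degree at most $2$). The Schreier graph for the (right) action of a group $G$ with finite generating set $S$ on a set $A$ is the (undirected) graph with vertex set $A$ and an edge $(x,x\sigma)$ for every $x\in A$ and $\sigma\in S$. Its connected components are the orbits. A connected locally finite graph is recurrent if simple random walk on it is recurrent (finite graphs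 are recurrent). *)

theory Defs
  imports
    "HOL-Probability.Probability"
    "HOL-Algebra.Bij"
    "HOL-Algebra.Generated_Groups"
    "HOL-Library.Landau_Symbols"
begin

section \<open>The rooted m-ary tree and its automorphism group\<close>

definition words :: "nat \<Rightarrow> nat list set" where
  "words m = lists {..<m}"

definition tree_adj :: "nat \<Rightarrow> nat list \<Rightarrow> nat list \<Rightarrow> bool" where
  "tree_adj m u v \<longleftrightarrow> u \<in> words m \<and> v \<in> words m \<and> (\<exists>x<m. v = u @ [x] \<or> u = v @ [x])"

text \<open>
  As in \<^const>\<open>BijGroup\<close>, automorphisms are extensional functions (undefined outside
  \<^term>\<open>words m\<close>), so that equality of automorphisms is equality of functions. The product is
  composition of maps. Using the opposite product, as one would for right actions, changes
  neither which subgroup a set generates nor the Schreier graphs.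
\<close>

definition Aut_tree :: "nat \<Rightarrow> (nat list \<Rightarrow> nat list) monoid" where
  "Aut_tree m = (BijGroup (words m))
     \<lparr>carrier := {g \<in> Bij (words m). g [] = [] \<and>
        (\<forall>u\<in>words m. \<forall>v\<in>words m. tree_adj m (g u) (g v) \<longleftrightarrow> tree_adj m u v)}\<rparr>"

text \<open>
  The subtree above \<open>v\<close> consists of the words \<open>v @ w\<close>, and \<open>w\<close> is the vertex of the full tree
  identified with \<open>v @ w\<close>.
\<close>

definition tree_section :: "nat \<Rightarrow> (nat list \<Rightarrow> nat list) \<Rightarrow> nat list \<Rightarrow> nat list \<Rightarrow> nat list" where
  "tree_section m g v = (\<lambda>w\<in>words m. drop (length (g v)) (g (v @ w)))"

definition activity :: "nat \<Rightarrow> (nat list \<Rightarrow> nat list) \<Rightarrow> nat \<Rightarrow> nat" where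
  "activity m g n =
     card {v \<in> words m. length v = n \<and> tree_section m g v \<noteq> \<one>\<^bsub>Aut_tree m\<^esub>}"

definition automaton_group :: "nat \<Rightarrow> (nat list \<Rightarrow> nat list) set \<Rightarrow> bool" where
  "automaton_group m \<Gamma> \<longleftrightarrow>
     (\<exists>S. finite S \<and> S \<subseteq> carrier (Aut_tree m) \<and>
          (\<forall>g\<in>S. \<forall>v\<in>words m. tree_section m g v \<in> S) \<and>
          \<Gamma> = generate (Aut_tree m) S)"

definition has_degree :: "nat \<Rightarrow> nat \<Rightarrow> (nat list \<Rightarrow> nat list) set \<Rightarrow> bool" where
  "has_degree m d \<Gamma> \<longleftrightarrow> (\<forall>g\<in>\<Gamma>. (\<lambda>n. real (activity m g n)) \<in> O(\<lambda>n. real n ^ d))"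

text \<open>A ray is given by the sequence of its vertices.\<close>

definition rays :: "nat \<Rightarrow> (nat \<Rightarrow> nat list) set" where
  "rays m = {\<xi>. \<xi> 0 = [] \<and> (\<forall>n. \<exists>x<m. \<xi> (Suc n) = \<xi> n @ [x])}"

definition ray_act :: "(nat \<Rightarrow> nat list) \<Rightarrow> (nat list \<Rightarrow> nat list) \<Rightarrow> (nat \<Rightarrow> nat list)" where
  "ray_act \<xi> g = (\<lambda>n. g (\<xi> n))"

definition ray_orbit :: "(nat list \<Rightarrow> nat list) set \<Rightarrow> (nat \<Rightarrow> nat list) \<Rightarrow> (nat \<Rightarrow> nat list) set" where
  "ray_orbit \<Gamma> \<xi> = {ray_act \<xi> g | g. g \<in> \<Gamma>}"


section \<open>Undirected multigraphs and Schreier graphs\<close>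

text \<open>
  Loops and parallel edges are allowed. The two ends of an edge are named only for
  bookkeeping; every notion below is symmetric in them.
\<close>

record ('v, 'e) multigraph =
  verts :: "'v set"
  edges :: "'e set"
  end1 :: "'e \<Rightarrow> 'v"
  end2 :: "'e \<Rightarrow> 'v"

definition adj :: "('v, 'e) multigraph \<Rightarrow> 'v \<Rightarrow> 'v \<Rightarrow> bool" where
  "adj G x y \<longleftrightarrow>
     (\<exists>e\<in>edges G. (end1 G e = x \<and> end2 G e = y) \<or> (end1 G e = y \<and> end2 G e = x))"

definition connected_graph :: "('v, 'e) multigraph \<Rightarrow> bool" where
  "connected_graph G \<longleftrightarrow> (\<forall>x\<in>verts G. \<forall>y\<in>verts G. (adj G)\<^sup>*\<^sup>* x y)"

definition components :: "('v, 'e) multigraph \<Rightarrow> 'v set set" where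
  "components G = {{y \<in> verts G. (adj G)\<^sup>*\<^sup>* x y} | x. x \<in> verts G}"

definition induced :: "('v, 'e) multigraph \<Rightarrow> 'v set \<Rightarrow> ('v, 'e) multigraph" where
  "induced G C =
     G\<lparr>verts := C, edges := {e \<in> edges G. end1 G e \<in> C \<and> end2 G e \<in> C}\<rparr>"

text \<open>The half-edges at \<open>x\<close>: a loop at \<open>x\<close> contributes two of them.\<close>

definition half_edges :: "('v, 'e) multigraph \<Rightarrow> 'v \<Rightarrow> ('e + 'e) set" where
  "half_edges G x = {e \<in> edges G. end1 G e = x} <+> {e \<in> edges G. end2 G e = x}"

definition locally_finite :: "('v, 'e) multigraph \<Rightarrow> bool" where
  "locally_finite G \<longleftrightarrow> (\<forall>x\<in>verts G. finite (half_edges G x))"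

definition schreier_graph ::
    "('v \<Rightarrow> 'g \<Rightarrow> 'v) \<Rightarrow> 'g set \<Rightarrow> 'v set \<Rightarrow> ('v, 'v \<times> 'g) multigraph" where
  "schreier_graph act S A =
     \<lparr>verts = A, edges = A \<times> S, end1 = fst, end2 = (\<lambda>(x, \<sigma>). act x \<sigma>)\<rparr>"


section \<open>Simple random walk and recurrence\<close>

text \<open>One step: cross a uniformly chosen half-edge. The walk stays put at an isolated vertex.\<close>

definition srw_step :: "('v, 'e) multigraph \<Rightarrow> 'v \<Rightarrow> 'v pmf" where
  "srw_step G x =
     (if half_edges G x = {} then return_pmf x
      else map_pmf (case_sum (end2 G) (end1 G)) (pmf_of_set (half_edges G x)))"

definition srw_kernel :: "('v, 'e) multigraph \<Rightarrow> 'v \<Rightarrow> nat \<Rightarrow> (nat \<Rightarrow> 'v) \<Rightarrow> 'v measure" where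
  "srw_kernel G x n \<omega> =
     measure_pmf (case n of 0 \<Rightarrow> return_pmf x | Suc k \<Rightarrow> srw_step G (\<omega> k))"

lemma Ionescu_Tulcea_srw_kernel:
  "Ionescu_Tulcea (srw_kernel G x) (\<lambda>_. count_space UNIV)"
proof (rule Ionescu_Tulcea.intro)
  fix i :: nat
  show "srw_kernel G x i \<in>
      measurable (PiM {0..<i} (\<lambda>_. count_space UNIV)) (subprob_algebra (count_space UNIV))"
  proof (cases i)
    case 0
    then show ?thesis
      by (simp add: srw_kernel_def[abs_def] measure_pmf_in_subprob_algebra)
  next
    case (Suc k)
    have "(\<lambda>\<omega>. \<omega> k) \<in>
        measurable (PiM {0..<i} (\<lambda>_. count_space UNIV)) (count_space (UNIV :: 'a set))"
      using Suc by (intro measurable_component_singleton) auto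
    moreover have "(\<lambda>y. measure_pmf (srw_step G y)) \<in>
        measurable (count_space UNIV) (subprob_algebra (count_space UNIV))"
      by (auto simp: measure_pmf_in_subprob_algebra)
    ultimately show ?thesis
      using Suc by (simp add: srw_kernel_def[abs_def] measurable_compose)
  qed
next
  fix i \<omega>
  show "prob_space (srw_kernel G x i \<omega>)"
    unfolding srw_kernel_def by (rule prob_space_measure_pmf)
qed

text \<open>
  The law of the whole trajectory of simple random walk started at \<open>x\<close>, obtained from the
  Ionescu-Tulcea theorem.
\<close>

definition srw :: "('v, 'e) multigraph \<Rightarrow> 'v \<Rightarrow> (nat \<Rightarrow> 'v) measure" where
  "srw G x = projective_family.lim UNIV
     (Ionescu_Tulcea.CI (srw_kernel G x) (\<lambda>_. count_space UNIV)) (\<lambda>_. count_space UNIV)"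

lemma prob_space_srw: "prob_space (srw G x)"
proof -
  interpret Ionescu_Tulcea "srw_kernel G x" "\<lambda>_. count_space UNIV"
    by (rule Ionescu_Tulcea_srw_kernel)
  have "emeasure PF.lim (PF.emb UNIV {} {\<lambda>_. undefined}) = emeasure (CI {}) {\<lambda>_. undefined}"
    by (rule lim) (auto simp: sets_PiM_empty)
  also have "\<dots> = 1"
    using prob_space.emeasure_space_1[OF PF.prob_space_P[of "{}"]]
    by (simp add: PF.space_P space_PiM_empty)
  also have "PF.emb UNIV {} {\<lambda>_. undefined} = space PF.lim"
    by (auto simp: prod_emb_def space_PiM)
  finally have "emeasure PF.lim (space PF.lim) = 1" .
  then show ?thesis
    unfolding srw_def by (intro prob_spaceI)
qed

definition recurrent :: "('v, 'e) multigraph \<Rightarrow> bool" where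
  "recurrent G \<longleftrightarrow> connected_graph G \<and> locally_finite G \<and>
     (\<forall>x\<in>verts G. AE \<omega> in srw G x. \<exists>n>0. \<omega> n = x)"

end

theory Submission
  imports Defs
begin

text \<open>
  Let \<open>S\<close> be a finite automaton generating \<open>\<Gamma>\<close> and let \<open>r\<close> be a common multiple of the lengths of its
  cycles. A nontrivial section \<open>g\<^bsub>v\<^esub>\<close> is either wide (of unbounded activity), and then quadratic activity
  leaves only \<open>O(n)\<close> choices of \<open>v\<close> at level \<open>n\<close>, or else \<open>g\<close> follows from \<open>v\<close> on a single cycle until
  the first position where the letter differs from the one \<open>r\<close> places later, and shortly after it
  becomes trivial. Marking by a bit the blocks of a fixed length which contain such a position, \<open>g\<close>
  acts on the bits after \<open>v\<close> as a Gray code does: it may only change the bit which follows the first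
  nonzero bit.

  So let \<open>F\<^bsub>n\<^esub>(w)\<close> be \<open>1\<close> if \<open>w\<close> has a bit at or after position \<open>n\<close>, and otherwise a
  weighted Gray code of its first \<open>n\<close> bits. Were all bits before the first nonzero one after \<open>v\<close> equal
  to zero, the code would not change at all; in general \<open>F\<^bsub>n\<^esub>\<close> changes by at most a constant times
  the weight of the bits after \<open>v\<close>, and the squares of these weights, summed over the extensions of
  \<open>v\<close>, decay geometrically. Hence the function
  \<open>\<Sum>\<^bsub>n \<le> N\<^esub> F\<^bsub>n\<^esub> / (n + 1)\<close>, which vanishes at a constant ray and equals the
  \<open>N\<close>-th harmonic number off a finite set, has Dirichlet energy
  \<open>O(\<Sum>\<^bsub>n \<le> N\<^esub> n / n\<^sup>2) = O(log N)\<close>. After division by the harmonic number the energy tends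
  to \<open>0\<close>, and the orbit of the constant ray is recurrent.
\<close>

section \<open>Tree automorphisms acting on words and rays\<close>

text \<open>The maps that build the code, x to \<open>(1 - q) * x\<close> and x to
  \<open>1 - q * x\<close>, are the inverse branches of a skew tent map: their images fill
  [0, 1 - q] and [1 - q, 1], and both send 1 to 1 - q. So a code equal to 1 hides the next bit, and
  the value 1 given to rays with later bits is glued on at that same code. A bare indicator of a bit
  at or after \<open>n\<close> would change by 1 behind the exits from wide states at every level i
  below \<open>n\<close>, of which there are O(i), and the count would only give O(n^2). The code
  discounts an exit at level i geometrically in n - i, which leaves O(n). Squares are essential. Let
  M be the number of words of one block and q = 1/M. At most one of the M continuations has bit 0,
  so the squared weights sum to at most M q^2 + (1 - q)^2 < 1, whereas the weights themselves can
  sum to 2 - 2q \<ge> 1. Finally, along one edge the change of F_n also decays geometrically in n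
  past the last bit, so superposing the cutoffs creates no large cross terms.\<close>

definition level :: "nat \<Rightarrow> nat \<Rightarrow> nat list set" where
  "level m n = {v \<in> words m. length v = n}"

lemma Nil_in_words [simp]: "[] \<in> words m"
  by (simp add: words_def)

lemma append_in_words [simp]: "u @ v \<in> words m \<longleftrightarrow> u \<in> words m \<and> v \<in> words m"
  by (auto simp: words_def)

lemma Cons_in_words [simp]: "x # v \<in> words m \<longleftrightarrow> x < m \<and> v \<in> words m"
  by (auto simp: words_def)

lemma take_in_words: "v \<in> words m \<Longrightarrow> take n v \<in> words m"
  by (metis append_in_words append_take_drop_id)

lemma drop_in_words: "v \<in> words m \<Longrightarrow> drop n v \<in> words m"
  by (metis append_in_words append_take_drop_id)

lemma level_eq: "level m n = {v. set v \<subseteq> {..<m} \<and> length v = n}"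
  by (auto simp: level_def words_def in_lists_conv_set)

lemma finite_level [simp]: "finite (level m n)"
  by (simp add: level_eq finite_lists_length_eq)

lemma card_level: "card (level m n) = m ^ n"
  by (simp add: level_eq card_lists_length_eq)

lemma Aut_tree_one: "\<one>\<^bsub>Aut_tree m\<^esub> = (\<lambda>w\<in>words m. w)"
  by (simp add: Aut_tree_def BijGroup_def)

lemma Aut_tree_carrier:
  "g \<in> carrier (Aut_tree m) \<longleftrightarrow> g \<in> Bij (words m) \<and> g [] = [] \<and>
     (\<forall>u\<in>words m. \<forall>v\<in>words m. tree_adj m (g u) (g v) \<longleftrightarrow> tree_adj m u v)"
  by (simp add: Aut_tree_def)

lemma Aut_tree_bij: "g \<in> carrier (Aut_tree m) \<Longrightarrow> bij_betw g (words m) (words m)"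
  by (simp add: Aut_tree_carrier Bij_def)

lemma Aut_tree_inj: "g \<in> carrier (Aut_tree m) \<Longrightarrow> inj_on g (words m)"
  by (metis Aut_tree_bij bij_betw_def)

lemma Aut_tree_mult:
  assumes "g \<in> carrier (Aut_tree m)" "h \<in> carrier (Aut_tree m)"
  shows "g \<otimes>\<^bsub>Aut_tree m\<^esub> h = compose (words m) g h"
  using assms by (auto simp: Aut_tree_def BijGroup_def)

text \<open>Only the carrier of \<open>BijGroup\<close> was replaced, so it suffices that the new
  carrier is a subgroup.\<close>

lemma group_Aut_tree: "group (Aut_tree m)"
proof -
  let ?B = "BijGroup (words m)"
  let ?H = "{g \<in> Bij (words m). g [] = [] \<and>
        (\<forall>u\<in>words m. \<forall>v\<in>words m. tree_adj m (g u) (g v) \<longleftrightarrow> tree_adj m u v)}"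
  interpret B: group ?B by (rule group_BijGroup)
  have "subgroup ?H ?B"
  proof (rule B.subgroupI)
    show "?H \<subseteq> carrier ?B" by (auto simp: BijGroup_def)
    have "(\<lambda>x\<in>words m. x) \<in> ?H"
      using id_Bij[of "words m"] by simp
    then show "?H \<noteq> {}" by blast
  next
    fix g assume g: "g \<in> ?H"
    then have bij: "bij_betw g (words m) (words m)" and gB: "g \<in> Bij (words m)"
      by (auto simp: Bij_def)
    have inv_eq: "inv\<^bsub>?B\<^esub> g = (\<lambda>x\<in>words m. inv_into (words m) g x)"
      using gB by (rule inv_BijGroup)
    have iB: "inv\<^bsub>?B\<^esub> g \<in> Bij (words m)"
      unfolding inv_eq using gB by (rule restrict_inv_into_Bij)
    have gi: "g (inv_into (words m) g u) = u" "inv_into (words m) g u \<in> words m"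
      if "u \<in> words m" for u
      using bij that by (auto simp: bij_betw_def f_inv_into_f inv_into_into)
    have "inv_into (words m) g [] = []"
      using g bij_betw_inv_into_left[OF bij Nil_in_words] by simp
    moreover have "tree_adj m (inv_into (words m) g u) (inv_into (words m) g v) \<longleftrightarrow> tree_adj m u v"
      if "u \<in> words m" "v \<in> words m" for u v
    proof -
      have "tree_adj m (g (inv_into (words m) g u)) (g (inv_into (words m) g v))
          \<longleftrightarrow> tree_adj m (inv_into (words m) g u) (inv_into (words m) g v)"
        using g gi that by blast
      then show ?thesis using gi that by simp
    qed
    ultimately show "inv\<^bsub>?B\<^esub> g \<in> ?H"
      using iB by (simp add: inv_eq)
  next
    fix g h assume g: "g \<in> ?H" and h: "h \<in> ?H"
    have e: "g \<otimes>\<^bsub>?B\<^esub> h = compose (words m) g h"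
      using g h by (simp add: BijGroup_def)
    have "h u \<in> words m" if "u \<in> words m" for u
      using h that by (auto simp: Bij_def dest: bij_betwE)
    then show "g \<otimes>\<^bsub>?B\<^esub> h \<in> ?H"
      using g h by (simp add: e compose_Bij) (simp add: compose_def)
  qed
  then show ?thesis
    unfolding Aut_tree_def by (rule subgroup.subgroup_is_group) (rule B.is_group)
qed

section \<open>Automorphisms, prefixes and sections\<close>

text \<open>The image of a child is adjacent to the image of its parent, hence a child or the parent
  of that vertex. The parent is by induction already the image of the grandparent, which injectivity
  excludes.\<close>

lemma Aut_tree_snoc:
  assumes g: "g \<in> carrier (Aut_tree m)" and "u @ [x] \<in> words m"
  shows "\<exists>y<m. g (u @ [x]) = g u @ [y]"
  using assms(2)
proof (induction u arbitrary: x rule: rev_induct)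
  case Nil
  have "tree_adj m [x] []"
    using Nil by (auto simp: tree_adj_def)
  moreover have "[x] \<in> words m" using Nil by simp
  ultimately have "tree_adj m (g [x]) (g [])"
    using g Nil_in_words unfolding Aut_tree_carrier by blast
  then have "tree_adj m (g [x]) []"
    using g by (simp add: Aut_tree_carrier)
  then show ?case
    using g by (auto simp: Aut_tree_carrier tree_adj_def)
next
  case (snoc z u)
  have uz: "u @ [z] \<in> words m" and u: "u \<in> words m" using snoc.prems by auto
  obtain y where y: "y < m" "g (u @ [z]) = g u @ [y]" using snoc.IH[OF uz] by blast
  have "tree_adj m (u @ [z]) ((u @ [z]) @ [x])"
    using snoc.prems by (auto simp: tree_adj_def)
  then have "tree_adj m (g (u @ [z])) (g ((u @ [z]) @ [x]))"
    using g snoc.prems uz unfolding Aut_tree_carrier by blast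
  then consider v where "v < m" "g ((u @ [z]) @ [x]) = g (u @ [z]) @ [v]"
    | v where "g (u @ [z]) = g ((u @ [z]) @ [x]) @ [v]"
    by (auto simp: tree_adj_def)
  then show ?case
  proof cases
    case 1 then show ?thesis by blast
  next
    case 2
    then have "g ((u @ [z]) @ [x]) = g u" using y by simp
    then have "(u @ [z]) @ [x] = u"
      using Aut_tree_inj[OF g] snoc.prems u by (meson inj_onD)
    then show ?thesis by simp
  qed
qed

lemma Aut_tree_length:
  assumes g: "g \<in> carrier (Aut_tree m)" and "u \<in> words m"
  shows "length (g u) = length u"
  using assms(2)
proof (induction u rule: rev_induct)
  case Nil then show ?case using g by (simp add: Aut_tree_carrier)
next
  case (snoc x u)
  then show ?case using Aut_tree_snoc[OF g snoc.prems] by auto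
qed

lemma Aut_tree_append:
  assumes g: "g \<in> carrier (Aut_tree m)" and "u \<in> words m" "v \<in> words m"
  shows "g (u @ v) = g u @ tree_section m g u v"
proof -
  have "\<exists>v'. g (u @ v) = g u @ v'"
    using assms(3)
  proof (induction v rule: rev_induct)
    case (snoc x v)
    then show ?case
      using Aut_tree_snoc[OF g, of "u @ v" x] assms(2) by auto
  qed auto
  then show ?thesis
    using assms by (auto simp: tree_section_def)
qed

lemma tree_section_Nil: "g \<in> carrier (Aut_tree m) \<Longrightarrow> tree_section m g [] = g"
  by (rule ext) (auto simp: tree_section_def Aut_tree_carrier Bij_def extensional_def)

lemma tree_section_append:
  assumes g: "g \<in> carrier (Aut_tree m)" and u: "u \<in> words m" and v: "v \<in> words m"
  shows "tree_section m g (u @ v) = tree_section m (tree_section m g u) v"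
proof
  fix w
  show "tree_section m g (u @ v) w = tree_section m (tree_section m g u) v w"
  proof (cases "w \<in> words m")
    case True
    have "g (u @ v @ w) = g u @ tree_section m g u (v @ w)"
      using Aut_tree_append[OF g, of u "v @ w"] u v True by simp
    moreover have "length (g (u @ v)) = length (g u) + length (tree_section m g u v)"
      using Aut_tree_append[OF g u v] by simp
    ultimately show ?thesis
      using True by (simp add: tree_section_def[of m g "u @ v"]
          tree_section_def[of m "tree_section m g u" v])
  qed (simp add: tree_section_def)
qed

lemma tree_section_one: "v \<in> words m \<Longrightarrow> tree_section m \<one>\<^bsub>Aut_tree m\<^esub> v = \<one>\<^bsub>Aut_tree m\<^esub>"
  by (rule ext) (auto simp: tree_section_def Aut_tree_one)

subsection \<open>Rays\<close>

definition letter :: "(nat \<Rightarrow> nat list) \<Rightarrow> nat \<Rightarrow> nat" where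
  "letter \<xi> i = \<xi> (Suc i) ! i"

lemma ray_length: "\<xi> \<in> rays m \<Longrightarrow> length (\<xi> n) = n"
proof (induction n)
  case (Suc n)
  then obtain x where "\<xi> (Suc n) = \<xi> n @ [x]" by (auto simp: rays_def)
  then show ?case using Suc by simp
qed (simp add: rays_def)

lemma ray_words: "\<xi> \<in> rays m \<Longrightarrow> \<xi> n \<in> words m"
proof (induction n)
  case (Suc n)
  then obtain x where "x < m" "\<xi> (Suc n) = \<xi> n @ [x]" by (auto simp: rays_def)
  then show ?case using Suc by simp
qed (auto simp: rays_def)

lemma ray_Suc: "\<xi> \<in> rays m \<Longrightarrow> \<xi> (Suc n) = \<xi> n @ [letter \<xi> n]"
proof -
  assume \<xi>: "\<xi> \<in> rays m"
  then obtain x where x: "\<xi> (Suc n) = \<xi> n @ [x]" by (auto simp: rays_def)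
  moreover have "(\<xi> n @ [x]) ! n = x"
    using ray_length[OF \<xi>, of n] by (metis nth_append_length)
  ultimately show ?thesis by (simp add: letter_def)
qed

lemma ray_eq_map:
  assumes "\<xi> \<in> rays m"
  shows "\<xi> n = map (letter \<xi>) [0..<n]"
proof (induction n)
  case 0
  then show ?case using assms by (simp add: rays_def)
next
  case (Suc n)
  then show ?case using ray_Suc[OF assms, of n] by simp
qed

lemma ray_eqI:
  assumes "\<xi> \<in> rays m" "\<eta> \<in> rays m" "\<And>i. letter \<xi> i = letter \<eta> i"
  shows "\<xi> = \<eta>"
proof
  have "letter \<xi> = letter \<eta>" using assms(3) by blast
  then show "\<xi> n = \<eta> n" for n
    using ray_eq_map[OF assms(1), of n] ray_eq_map[OF assms(2), of n] by metis
qed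

lemma ray_nth: "\<xi> \<in> rays m \<Longrightarrow> i < n \<Longrightarrow> \<xi> n ! i = letter \<xi> i"
  using ray_eq_map[of \<xi> m n] by simp

lemma ray_append: "\<xi> \<in> rays m \<Longrightarrow> \<xi> (n + k) = \<xi> n @ map (letter \<xi>) [n..<n + k]"
  using ray_eq_map[of \<xi> m "n + k"] ray_eq_map[of \<xi> m n] upt_add_eq_append[of 0 n k] by simp

lemma letter_less: "\<xi> \<in> rays m \<Longrightarrow> letter \<xi> i < m"
  using ray_words[of \<xi> m "Suc i"] ray_Suc[of \<xi> m i] by auto

lemma ray_segment: "\<xi> \<in> rays m \<Longrightarrow> map (letter \<xi>) [n..<n + k] \<in> level m k"
  using letter_less[of \<xi> m] by (auto simp: level_eq)

lemma ray_take: "\<xi> \<in> rays m \<Longrightarrow> n \<le> k \<Longrightarrow> take n (\<xi> k) = \<xi> n"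
  using ray_append[of \<xi> m n "k - n"] ray_length[of \<xi> m n] by simp

lemma ray_act_in_rays:
  assumes g: "g \<in> carrier (Aut_tree m)" and \<xi>: "\<xi> \<in> rays m"
  shows "ray_act \<xi> g \<in> rays m"
proof -
  have "\<exists>x<m. g (\<xi> (Suc n)) = g (\<xi> n) @ [x]" for n
    using Aut_tree_snoc[OF g, of "\<xi> n" "letter \<xi> n"] ray_Suc[OF \<xi>, of n] ray_words[OF \<xi>, of "Suc n"]
    by simp
  then show ?thesis
    using g \<xi> by (auto simp: rays_def ray_act_def Aut_tree_carrier)
qed

lemma ray_act_mult:
  assumes "g \<in> carrier (Aut_tree m)" "h \<in> carrier (Aut_tree m)" "\<xi> \<in> rays m"
  shows "ray_act \<xi> (g \<otimes>\<^bsub>Aut_tree m\<^esub> h) = ray_act (ray_act \<xi> h) g"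
  using ray_words[OF assms(3)]
  unfolding ray_act_def Aut_tree_mult[OF assms(1,2)] by (simp add: compose_def)

lemma ray_act_one: "\<xi> \<in> rays m \<Longrightarrow> ray_act \<xi> \<one>\<^bsub>Aut_tree m\<^esub> = \<xi>"
  unfolding ray_act_def Aut_tree_one by (rule ext) (metis ray_words restrict_apply')

lemma ray_act_inv:
  assumes g: "g \<in> carrier (Aut_tree m)" and \<xi>: "\<xi> \<in> rays m"
  shows "ray_act (ray_act \<xi> g) (inv\<^bsub>Aut_tree m\<^esub> g) = \<xi>"
    "ray_act (ray_act \<xi> (inv\<^bsub>Aut_tree m\<^esub> g)) g = \<xi>"
proof -
  interpret group "Aut_tree m" by (rule group_Aut_tree)
  have "ray_act (ray_act \<xi> g) (inv\<^bsub>Aut_tree m\<^esub> g)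
      = ray_act \<xi> (inv\<^bsub>Aut_tree m\<^esub> g \<otimes>\<^bsub>Aut_tree m\<^esub> g)"
    by (rule ray_act_mult[OF inv_closed[OF g] g \<xi>, symmetric])
  then show "ray_act (ray_act \<xi> g) (inv\<^bsub>Aut_tree m\<^esub> g) = \<xi>"
    unfolding l_inv[OF g] ray_act_one[OF \<xi>] .
  have "ray_act (ray_act \<xi> (inv\<^bsub>Aut_tree m\<^esub> g)) g
      = ray_act \<xi> (g \<otimes>\<^bsub>Aut_tree m\<^esub> inv\<^bsub>Aut_tree m\<^esub> g)"
    by (rule ray_act_mult[OF g inv_closed[OF g] \<xi>, symmetric])
  then show "ray_act (ray_act \<xi> (inv\<^bsub>Aut_tree m\<^esub> g)) g = \<xi>"
    unfolding r_inv[OF g] ray_act_one[OF \<xi>] .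
qed

lemma ray_act_inj:
  "g \<in> carrier (Aut_tree m) \<Longrightarrow> inj_on (\<lambda>\<xi>. ray_act \<xi> g) (rays m)"
  by (rule inj_on_inverseI[where g = "\<lambda>\<xi>. ray_act \<xi> (inv\<^bsub>Aut_tree m\<^esub> g)"]) (rule ray_act_inv(1))

section \<open>Automata of quadratic activity\<close>

text \<open>The summand 1 leaves room for the finitely many initial indices and for zeros of
  \<open>g\<close>, so that the bound holds at every \<open>n\<close>.\<close>

lemma bigo_nat_bound:
  fixes f g :: "nat \<Rightarrow> real"
  assumes "f \<in> O(g)" "\<And>n. g n \<ge> 0"
  shows "\<exists>C\<ge>0. \<forall>n. f n \<le> C * (g n + 1)"
proof -
  obtain c where c: "c > 0" "eventually (\<lambda>n. norm (f n) \<le> c * norm (g n)) sequentially"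
    using landau_o.bigE[OF assms(1)] by blast
  then obtain N where N: "\<And>n. n \<ge> N \<Longrightarrow> norm (f n) \<le> c * norm (g n)"
    by (auto simp: eventually_sequentially)
  define C where "C = c + (\<Sum>k<N. \<bar>f k\<bar>)"
  have s0: "(\<Sum>k<N. \<bar>f k\<bar>) \<ge> 0" by (simp add: sum_nonneg)
  have "f n \<le> C * (g n + 1)" for n
  proof (cases "n < N")
    case True
    then have "\<bar>f n\<bar> \<le> (\<Sum>k<N. \<bar>f k\<bar>)"
      by (intro member_le_sum) auto
    then have "f n \<le> C" using c(1) by (simp add: C_def)
    also have "C * 1 \<le> C * (g n + 1)"
      using assms(2)[of n] c(1) s0 by (intro mult_left_mono) (auto simp: C_def)
    finally show ?thesis by simp
  next
    case False
    then have "f n \<le> c * g n" using N[of n] assms(2)[of n] by simp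
    also have "\<dots> \<le> C * (g n + 1)"
      using assms(2)[of n] c(1) s0 by (intro mult_mono) (auto simp: C_def)
    finally show ?thesis .
  qed
  moreover have "C \<ge> 0" using c(1) s0 by (simp add: C_def)
  ultimately show ?thesis by blast
qed

locale quadratic_automaton =
  fixes m :: nat and S :: "(nat list \<Rightarrow> nat list) set"
  assumes m2: "m \<ge> 2"
    and finS: "finite S"
    and S_carrier: "S \<subseteq> carrier (Aut_tree m)"
    and S_closed: "g \<in> S \<Longrightarrow> v \<in> words m \<Longrightarrow> tree_section m g v \<in> S"
    and quadratic: "g \<in> S \<Longrightarrow> (\<lambda>n. real (activity m g n)) \<in> O(\<lambda>n. real n ^ 2)"
begin

abbreviation sec :: "(nat list \<Rightarrow> nat list) \<Rightarrow> nat list \<Rightarrow> nat list \<Rightarrow> nat list" where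
  "sec \<equiv> tree_section m"

abbreviation e :: "nat list \<Rightarrow> nat list" where
  "e \<equiv> \<one>\<^bsub>Aut_tree m\<^esub>"

lemma S_Aut: "g \<in> S \<Longrightarrow> g \<in> carrier (Aut_tree m)"
  using S_carrier by blast

lemma sec_append: "g \<in> S \<Longrightarrow> u \<in> words m \<Longrightarrow> v \<in> words m \<Longrightarrow> sec g (u @ v) = sec (sec g u) v"
  by (simp add: tree_section_append S_Aut)

lemma level_words: "v \<in> level m n \<Longrightarrow> v \<in> words m"
  by (simp add: level_def)

lemma level_length: "v \<in> level m n \<Longrightarrow> length v = n"
  by (simp add: level_def)

lemma append_level: "u \<in> level m k \<Longrightarrow> v \<in> level m n \<Longrightarrow> u @ v \<in> level m (k + n)"
  by (simp add: level_def)

lemma activity_level: "activity m g n = card {v \<in> level m n. sec g v \<noteq> e}"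
  by (simp add: activity_def level_def conj_assoc)

text \<open>Splitting a vertex after \<open>k\<close> letters makes the activity a sum over
  prefixes; keeping only some of the prefixes gives the lower bounds on activity used below.\<close>

lemma activity_add:
  assumes g: "g \<in> S"
  shows "activity m g (k + n) = (\<Sum>v\<in>level m k. activity m (sec g v) n)"
proof -
  let ?B = "\<lambda>v. {w \<in> level m n. sec (sec g v) w \<noteq> e}"
  have "{v \<in> level m (k + n). sec g v \<noteq> e} = (\<lambda>(v, w). v @ w) ` (SIGMA v:level m k. ?B v)"
  proof (intro equalityI subsetI)
    fix v assume v: "v \<in> {v \<in> level m (k + n). sec g v \<noteq> e}"
    then have "take k v \<in> level m k" "drop k v \<in> level m n"
      by (auto simp: level_def take_in_words drop_in_words)
    moreover have "sec (sec g (take k v)) (drop k v) \<noteq> e"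
      using v sec_append[OF g, of "take k v" "drop k v"] by (auto simp: level_def take_in_words drop_in_words)
    ultimately show "v \<in> (\<lambda>(v, w). v @ w) ` (SIGMA v:level m k. ?B v)"
      by (intro image_eqI[of _ _ "(take k v, drop k v)"]) auto
  next
    fix v assume "v \<in> (\<lambda>(v, w). v @ w) ` (SIGMA v:level m k. ?B v)"
    then show "v \<in> {v \<in> level m (k + n). sec g v \<noteq> e}"
      using sec_append[OF g] by (auto simp: append_level level_words)
  qed
  moreover have "inj_on (\<lambda>(v, w). v @ w) (SIGMA v:level m k. ?B v)"
    by (auto simp: inj_on_def level_def)
  ultimately have "activity m g (k + n) = card (SIGMA v:level m k. ?B v)"
    by (simp add: activity_level card_image)
  also have "\<dots> = (\<Sum>v\<in>level m k. activity m (sec g v) n)"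
    by (simp add: activity_level)
  finally show ?thesis .
qed

lemma activity_ge_section:
  assumes "g \<in> S" "v \<in> level m k"
  shows "activity m (sec g v) n \<le> activity m g (k + n)"
  unfolding activity_add[OF assms(1)] using assms(2) by (intro member_le_sum) auto

lemma activity_ge_sections:
  assumes "g \<in> S" "X \<subseteq> level m k"
  shows "(\<Sum>v\<in>X. activity m (sec g v) n) \<le> activity m g (k + n)"
  unfolding activity_add[OF assms(1)] using assms(2) by (intro sum_mono2) auto

lemma activity_bound: "g \<in> S \<Longrightarrow> \<exists>C\<ge>0. \<forall>n. real (activity m g n) \<le> C * (real n ^ 2 + 1)"
  using bigo_nat_bound[OF quadratic] by simp

text \<open>Two distinct return words of the same length generate a free monoid of return words, which
  forces exponential activity.\<close>

lemma return_word_unique: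
  assumes t: "t \<in> S" "t \<noteq> e" and u: "u \<in> level m L" "sec t u = t" and v: "v \<in> level m L" "sec t v = t"
  shows "u = v"
proof (rule ccontr)
  assume uv: "u \<noteq> v"
  have pow: "2 ^ k \<le> activity m t (k * L)" for k
  proof (induction k)
    case 0
    have "{v \<in> level m 0. sec t v \<noteq> e} = {[]}"
      using t tree_section_Nil[OF S_Aut[OF t(1)]] by (auto simp: level_def)
    then show ?case by (simp add: activity_level)
  next
    case (Suc k)
    have "(\<Sum>x\<in>{u, v}. activity m (sec t x) (k * L)) \<le> activity m t (L + k * L)"
      using u v by (intro activity_ge_sections t) auto
    then show ?case using uv u v Suc by simp
  qed
  obtain C where C: "\<And>n. real (activity m t n) \<le> C * (real n ^ 2 + 1)" "C \<ge> 0"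
    using activity_bound[OF t(1)] by blast
  have "(\<lambda>k::nat. C * ((real k * real L) ^ 2 + 1) / 2 ^ k) \<longlonglongrightarrow> 0"
  proof -
    have "(\<lambda>k::nat. real k ^ 2 / 2 ^ k) \<longlonglongrightarrow> 0" "(\<lambda>k::nat. 1 / 2 ^ k :: real) \<longlonglongrightarrow> 0"
      by real_asymp+
    then have "(\<lambda>k::nat. (C * real L ^ 2) * (real k ^ 2 / 2 ^ k) + C * (1 / 2 ^ k)) \<longlonglongrightarrow> 
        (C * real L ^ 2) * 0 + C * 0"
      by (intro tendsto_intros)
    moreover have "(C * real L ^ 2) * (real k ^ 2 / 2 ^ k) + C * (1 / 2 ^ k)
        = C * ((real k * real L) ^ 2 + 1) / 2 ^ k" for k :: nat
      by (simp add: field_simps)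
    ultimately show ?thesis by simp
  qed
  then have "eventually (\<lambda>k::nat. C * ((real k * real L) ^ 2 + 1) / 2 ^ k < 1) sequentially"
    by (rule order_tendstoD) simp
  then obtain k :: nat where "C * ((real k * real L) ^ 2 + 1) / 2 ^ k < 1"
    by (auto simp: eventually_sequentially)
  then have "C * ((real k * real L) ^ 2 + 1) < 2 ^ k" by (simp add: field_simps)
  moreover have "(2::real) ^ k \<le> real (activity m t (k * L))"
    using of_nat_mono[OF pow[of k], where 'a = real] by simp
  ultimately show False using C(1)[of "k * L"] unfolding of_nat_mult by linarith
qed

section \<open>Loops of the automaton and their common period\<close>

definition returning :: "(nat list \<Rightarrow> nat list) set" where
  "returning = {t \<in> S. t \<noteq> e \<and> (\<exists>u\<in>words m. u \<noteq> [] \<and> sec t u = t)}"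

definition return_length :: "(nat list \<Rightarrow> nat list) \<Rightarrow> nat" where
  "return_length t = (SOME k. k > 0 \<and> (\<exists>u\<in>level m k. sec t u = t))"

definition period :: nat where
  "period = (\<Prod>t\<in>returning. return_length t)"

lemma return_length:
  assumes "t \<in> returning"
  shows "return_length t > 0 \<and> (\<exists>u\<in>level m (return_length t). sec t u = t)"
proof -
  obtain u where "u \<in> words m" "u \<noteq> []" "sec t u = t"
    using assms by (auto simp: returning_def)
  then have "length u > 0 \<and> (\<exists>u\<in>level m (length u). sec t u = t)"
    by (auto simp: level_def)
  then show ?thesis unfolding return_length_def by (rule someI)
qed

lemma period_pos: "period > 0"
  unfolding period_def using return_length by (intro prod_pos) blast

lemma sec_replicate:
  assumes t: "t \<in> S" and u: "u \<in> level m k" "sec t u = t"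
  shows "concat (replicate j u) \<in> level m (j * k) \<and> sec t (concat (replicate j u)) = t"
proof (induction j)
  case 0
  then show ?case using t by (simp add: level_def tree_section_Nil S_Aut)
next
  case (Suc j)
  then have "u @ concat (replicate j u) \<in> level m (k + j * k)"
    using u by (intro append_level) auto
  moreover have "sec t (u @ concat (replicate j u)) = t"
    using Suc u sec_append[OF t level_words[OF u(1)] level_words, of "concat (replicate j u)"] by auto
  ultimately show ?case by simp
qed

text \<open>A repeated return word is again a return word, so every nontrivial state on a loop
  returns after exactly \<open>period\<close> letters, and by \<open>return_word_unique\<close> in
  one way only. From here on all loops are treated as having this length.\<close>

lemma return_period:
  assumes "t \<in> returning"
  shows "\<exists>u\<in>level m period. sec t u = t"
proof -
  have "finite returning" using finS by (simp add: returning_def)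
  then have "return_length t dvd period"
    unfolding period_def using assms by (intro dvd_prodI)
  then obtain j where "period = j * return_length t" by (metis dvd_def mult.commute)
  moreover obtain u where "u \<in> level m (return_length t)" "sec t u = t"
    using return_length[OF assms] by blast
  ultimately show ?thesis
    using sec_replicate[of t u "return_length t" j] assms by (auto simp: returning_def)
qed

section \<open>Infinitary and wide states\<close>

definition infinitary :: "(nat list \<Rightarrow> nat list) \<Rightarrow> bool" where
  "infinitary s \<longleftrightarrow> (\<forall>n. \<exists>y\<in>level m n. sec s y \<noteq> e)"

lemma infinitary_activity: "infinitary s \<Longrightarrow> activity m s n \<ge> 1"
proof -
  assume "infinitary s"
  then have "{v \<in> level m n. sec s v \<noteq> e} \<noteq> {}"
    unfolding infinitary_def by auto
  then show ?thesis
    unfolding activity_level by (simp add: Suc_le_eq card_gt_0_iff)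
qed

lemma sec_trivial_append:
  assumes "s \<in> S" "u \<in> words m" "v \<in> words m" "sec s u = e"
  shows "sec s (u @ v) = e"
  using assms by (simp add: sec_append tree_section_one)

text \<open>Sections of a trivial section are trivial, so one trivial level suffices; finiteness of
  \<open>S\<close> makes the depth uniform.\<close>

lemma ex_finitary_depth:
  "\<exists>D. \<forall>s\<in>S. \<not> infinitary s \<longrightarrow> (\<forall>y\<in>words m. length y \<ge> D \<longrightarrow> sec s y = e)"
proof -
  have "\<exists>n. \<forall>y\<in>words m. length y \<ge> n \<longrightarrow> sec s y = e" if "s \<in> S" "\<not> infinitary s" for s
  proof -
    obtain n where n: "\<And>y. y \<in> level m n \<Longrightarrow> sec s y = e"
      using \<open>\<not> infinitary s\<close> by (auto simp: infinitary_def)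
    have "sec s y = e" if "y \<in> words m" "length y \<ge> n" for y
    proof -
      have "take n y \<in> level m n" using that by (simp add: level_def take_in_words)
      then show ?thesis
        using sec_trivial_append[of s "take n y" "drop n y"] n that \<open>s \<in> S\<close>
        by (simp add: take_in_words drop_in_words)
    qed
    then show ?thesis by blast
  qed
  then obtain d where d: "\<And>s y. s \<in> S \<Longrightarrow> \<not> infinitary s \<Longrightarrow> y \<in> words m \<Longrightarrow> length y \<ge> d s \<Longrightarrow> sec s y = e"
    by metis
  have "d s \<le> (\<Sum>s\<in>S. d s)" if "s \<in> S" for s
    using that finS by (intro member_le_sum) auto
  then show ?thesis using d by (intro exI[of _ "\<Sum>s\<in>S. d s"]) (blast intro: le_trans)
qed

definition finitary_depth :: nat where
  "finitary_depth = (SOME D. \<forall>s\<in>S. \<not> infinitary s \<longrightarrow> (\<forall>y\<in>words m. length y \<ge> D \<longrightarrow> sec s y = e))"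

lemma finitary_depth:
  "s \<in> S \<Longrightarrow> \<not> infinitary s \<Longrightarrow> y \<in> words m \<Longrightarrow> length y \<ge> finitary_depth \<Longrightarrow> sec s y = e"
  using someI_ex[OF ex_finitary_depth] unfolding finitary_depth_def[symmetric] by blast

text \<open>The wide states are those of unbounded activity: from them one reaches a loop which can be
  left in an infinitary state.\<close>

definition wide :: "(nat list \<Rightarrow> nat list) \<Rightarrow> bool" where
  "wide s \<longleftrightarrow> (\<exists>x\<in>words m. sec s x \<noteq> e \<and> (\<exists>u\<in>level m period. sec (sec s x) u = sec s x \<and>
     (\<exists>v\<in>level m period. v \<noteq> u \<and> infinitary (sec (sec s x) v))))"

text \<open>Each turn around the loop \<open>u\<close> passes the exit \<open>v\<close> once more,
  and each exit, being infinitary, contributes a nontrivial vertex at every depth.\<close>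

lemma wide_activity:
  assumes s: "s \<in> S" "wide s"
  shows "\<exists>l. \<forall>n. n \<le> activity m s (l + n * period)"
proof -
  obtain x u v where x: "x \<in> words m" "sec s x \<noteq> e" and u: "u \<in> level m period" "sec (sec s x) u = sec s x"
    and v: "v \<in> level m period" "v \<noteq> u" "infinitary (sec (sec s x) v)"
    using s(2) unfolding wide_def by blast
  define t where "t = sec s x"
  have t: "t \<in> S" using s x by (simp add: t_def S_closed)
  have "n \<le> activity m t (n * period)" for n
  proof (induction n)
    case (Suc n)
    have "(\<Sum>x\<in>{u, v}. activity m (sec t x) (n * period)) \<le> activity m t (period + n * period)"
      using u v by (intro activity_ge_sections t) auto
    moreover have "activity m (sec t v) (n * period) \<ge> 1"
      using v by (intro infinitary_activity) (simp add: t_def)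
    ultimately show ?case using v u Suc by (simp add: t_def)
  qed simp
  moreover have "activity m t n \<le> activity m s (length x + n)" for n
    unfolding t_def using x by (intro activity_ge_section s) (simp add: level_def)
  ultimately have "n \<le> activity m s (length x + n * period)" for n
    using le_trans by blast
  then show ?thesis by blast
qed

text \<open>Every \<open>v\<close> with section \<open>s\<close> contributes at least linearly to
  the activity of \<open>g\<close> further down. As the total is at most quadratic, the number of
  these \<open>v\<close> is at most linear.\<close>

lemma wide_count_state:
  assumes g: "g \<in> S" and s: "s \<in> S" "wide s"
  shows "\<exists>C\<ge>0. \<forall>k. real (card {v \<in> level m k. sec g v = s}) \<le> C * (real k + 1)"
proof -
  obtain l where l: "\<And>n. n \<le> activity m s (l + n * period)"
    using wide_activity[OF s] by blast
  obtain C where C: "C \<ge> 0" "\<And>n. real (activity m g n) \<le> C * (real n ^ 2 + 1)"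
    using activity_bound[OF g] by blast
  define B where "B = real (1 + l + period) ^ 2 + 1"
  have "real (card {v \<in> level m k. sec g v = s}) \<le> C * B * (real k + 1)" for k
  proof -
    let ?X = "{v \<in> level m k. sec g v = s}"
    \<comment> \<open>\<open>k + 1\<close> turns of the loop give each section activity at least
      \<open>k + 1\<close>, while the depth \<open>k + ?n\<close> stays linear in
      \<open>k\<close>.\<close>
    let ?n = "l + (k + 1) * period"
    have "card ?X * (k + 1) \<le> (\<Sum>v\<in>?X. activity m (sec g v) ?n)"
    proof -
      have "(\<Sum>v\<in>?X. activity m (sec g v) ?n) = card ?X * activity m s ?n"
        by simp
      moreover have "card ?X * (k + 1) \<le> card ?X * activity m s ?n"
        by (rule mult_le_mono2[OF l])
      ultimately show ?thesis by linarith
    qed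
    also have "\<dots> \<le> activity m g (k + ?n)"
      by (intro activity_ge_sections g) auto
    finally have "real (card ?X * (k + 1)) \<le> real (activity m g (k + ?n))"
      by (simp only: of_nat_le_iff)
    then have "real (card ?X) * (real k + 1) \<le> real (activity m g (k + ?n))"
      unfolding of_nat_mult of_nat_add of_nat_1 .
    also have "\<dots> \<le> C * (real (k + ?n) ^ 2 + 1)" by (rule C)
    also have "\<dots> \<le> C * (B * (real k + 1) ^ 2)"
    proof (intro mult_left_mono C)
      have "k + ?n \<le> (1 + l + period) * (k + 1)" by (simp add: algebra_simps)
      then have "real (k + ?n) \<le> real ((1 + l + period) * (k + 1))"
        by (simp only: of_nat_le_iff)
      then have "real (k + ?n) \<le> real (1 + l + period) * (real k + 1)"
        unfolding of_nat_mult of_nat_add[of k 1] of_nat_1 .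
      then have "real (k + ?n) ^ 2 \<le> (real (1 + l + period) * (real k + 1)) ^ 2"
        by (intro power_mono) auto
      moreover have "1 \<le> (real k + 1) ^ 2" by simp
      ultimately show "real (k + ?n) ^ 2 + 1 \<le> B * (real k + 1) ^ 2"
        unfolding B_def power_mult_distrib distrib_right by linarith
    qed
    finally have "real (card ?X) * (real k + 1) \<le> (C * B * (real k + 1)) * (real k + 1)"
      by (simp add: power2_eq_square mult_ac)
    then show ?thesis by (rule mult_right_le_imp_le) simp
  qed
  moreover have "C * B \<ge> 0" using C(1) by (simp add: B_def)
  ultimately show ?thesis by blast
qed

lemma wide_count:
  assumes g: "g \<in> S"
  shows "\<exists>C\<ge>0. \<forall>k. real (card {v \<in> level m k. wide (sec g v)}) \<le> C * (real k + 1)"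
proof -
  let ?W = "{s \<in> S. wide s}"
  obtain C where C: "\<And>s. s \<in> ?W \<Longrightarrow> C s \<ge> 0"
    "\<And>s k. s \<in> ?W \<Longrightarrow> real (card {v \<in> level m k. sec g v = s}) \<le> C s * (real k + 1)"
  proof -
    have "\<forall>s\<in>?W. \<exists>C\<ge>0. \<forall>k. real (card {v \<in> level m k. sec g v = s}) \<le> C * (real k + 1)"
      using wide_count_state[OF g] by blast
    from bchoice[OF this] show ?thesis using that by blast
  qed
  have fW: "finite ?W" using finS by simp
  have "real (card {v \<in> level m k. wide (sec g v)}) \<le> (\<Sum>s\<in>?W. C s) * (real k + 1)" for k
  proof -
    have "{v \<in> level m k. wide (sec g v)} \<subseteq> (\<Union>s\<in>?W. {v \<in> level m k. sec g v = s})"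
      using S_closed[OF g] by (auto simp: level_def)
    then have "card {v \<in> level m k. wide (sec g v)} \<le> card (\<Union>s\<in>?W. {v \<in> level m k. sec g v = s})"
      using fW by (intro card_mono) auto
    also have "\<dots> \<le> (\<Sum>s\<in>?W. card {v \<in> level m k. sec g v = s})"
      by (rule card_UN_le[OF fW])
    finally have "real (card {v \<in> level m k. wide (sec g v)}) \<le> (\<Sum>s\<in>?W. real (card {v \<in> level m k. sec g v = s}))"
      unfolding of_nat_sum[symmetric] by (simp only: of_nat_le_iff)
    also have "\<dots> \<le> (\<Sum>s\<in>?W. C s * (real k + 1))" by (intro sum_mono C)
    finally show ?thesis by (simp add: sum_distrib_right)
  qed
  then show ?thesis using C(1) by (intro exI[of _ "\<Sum>s\<in>?W. C s"]) (auto intro: sum_nonneg)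
qed

end

section \<open>Positions where the period of a ray breaks\<close>

context quadratic_automaton
begin

definition out :: "(nat list \<Rightarrow> nat list) \<Rightarrow> nat \<Rightarrow> nat" where
  "out s y = hd (s [y])"

lemma out_word:
  assumes s: "s \<in> S" and y: "y < m"
  shows "s [y] = [out s y]"
proof -
  have "length (s [y]) = 1"
    using Aut_tree_length[OF S_Aut[OF s], of "[y]"] y by simp
  then show ?thesis by (cases "s [y]") (auto simp: out_def)
qed

lemma out_inj:
  assumes "s \<in> S" "x < m" "y < m"
  shows "out s x = out s y \<longleftrightarrow> x = y"
proof
  assume "out s x = out s y"
  then have "s [x] = s [y]" using assms by (simp add: out_word)
  then have "[x] = [y]"
    using Aut_tree_inj[OF S_Aut[OF assms(1)]] assms by (meson Cons_in_words Nil_in_words inj_onD)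
  then show "x = y" by simp
qed simp

lemma out_trivial: "y < m \<Longrightarrow> out e y = y"
  by (simp add: out_def Aut_tree_one)

section \<open>The states visited along a ray\<close>

context
  fixes g w
  assumes g: "g \<in> S" and w: "w \<in> rays m"
begin

definition state :: "nat \<Rightarrow> nat list \<Rightarrow> nat list" where
  "state x = sec g (w x)"

lemma state_S: "state x \<in> S"
  unfolding state_def by (rule S_closed[OF g ray_words[OF w]])

definition block :: "nat \<Rightarrow> nat \<Rightarrow> nat list" where
  "block x k = map (letter w) [x..<x + k]"

lemma block_level: "block x k \<in> level m k"
  unfolding block_def by (rule ray_segment[OF w])

lemma block_add: "block x (k + l) = block x k @ block (x + k) l"
  unfolding block_def using upt_add_eq_append[of x "x + k" l] by (simp add: add.assoc)

lemma state_add: "state (x + k) = sec (state x) (block x k)"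
proof -
  have "w (x + k) = w x @ block x k"
    unfolding block_def by (rule ray_append[OF w])
  then show ?thesis
    unfolding state_def using sec_append[OF g ray_words[OF w] level_words[OF block_level]] by simp
qed

lemma w_act: "ray_act w g \<in> rays m"
  by (rule ray_act_in_rays[OF S_Aut[OF g] w])

lemma state_block: "state x (block x k) = map (letter (ray_act w g)) [x..<x + k]"
proof -
  have "ray_act w g (x + k) = ray_act w g x @ map (letter (ray_act w g)) [x..<x + k]"
    by (rule ray_append[OF w_act])
  moreover have "w (x + k) = w x @ block x k"
    unfolding block_def by (rule ray_append[OF w])
  moreover have "g (w x @ block x k) = g (w x) @ state x (block x k)"
    unfolding state_def
    by (rule Aut_tree_append[OF S_Aut[OF g] ray_words[OF w] level_words[OF block_level]])
  ultimately show ?thesis by (simp add: ray_act_def)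
qed

lemma letter_act: "letter (ray_act w g) x = out (state x) (letter w x)"
  using state_block[of x 1] by (simp add: out_def block_def)

lemma trivial_after:
  assumes "state x = e" "x \<le> y"
  shows "state y = e" "letter (ray_act w g) y = letter w y"
proof -
  have "state y = sec (state x) (block x (y - x))"
    using state_add[of x "y - x"] assms(2) by simp
  also have "\<dots> = e"
    unfolding assms(1) by (rule tree_section_one[OF level_words[OF block_level]])
  finally show *: "state y = e" .
  show "letter (ray_act w g) y = letter w y"
    unfolding letter_act * by (rule out_trivial[OF letter_less[OF w]])
qed

end

text \<open>Having no jump from \<open>x\<close> on means that the ray is periodic from
  \<open>x\<close> on with the common period.\<close>

definition jump :: "(nat \<Rightarrow> nat list) \<Rightarrow> nat \<Rightarrow> bool" where
  "jump w x \<longleftrightarrow> letter w x \<noteq> letter w (x + period)"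

text \<open>Equal states permute the letters alike, and a permutation preserves both equality and
  inequality of letters.\<close>

lemma jump_act:
  assumes g: "g \<in> S" and w: "w \<in> rays m"
    and eq: "state g w (x + period) = state g w x"
  shows "jump (ray_act w g) x \<longleftrightarrow> jump w x"
  unfolding jump_def letter_act[OF g w] eq
  by (simp add: out_inj state_S[OF g w] letter_less[OF w])

text \<open>Equal states reading equal letters pass to equal states; only a jump can end
  this.\<close>

lemma state_periodic:
  assumes g: "g \<in> S" and w: "w \<in> rays m"
    and eq: "state g w (x + period) = state g w x"
    and nj: "\<forall>y\<in>{x..<z}. \<not> jump w y" and "x \<le> y" "y \<le> z"
  shows "state g w (y + period) = state g w y"
  using \<open>x \<le> y\<close> \<open>y \<le> z\<close>
proof (induction y rule: dec_induct)
  case base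
  show ?case by (rule eq)
next
  case (step y)
  have "letter w (y + period) = letter w y"
    using nj step by (simp add: jump_def)
  then have "block w (y + period) 1 = block w y 1"
    unfolding block_def[OF g w] by simp
  then show ?case
    using state_add[OF g w, of "y + period" 1] state_add[OF g w, of y 1] step by simp
qed

lemma no_jump_act:
  assumes g: "g \<in> S" and w: "w \<in> rays m"
    and eq: "state g w (x + period) = state g w x"
    and nj: "\<forall>y\<in>{x..<z}. \<not> jump w y" and "x \<le> y" "y \<le> z"
  shows "jump (ray_act w g) y \<longleftrightarrow> jump w y"
  by (rule jump_act[OF g w state_periodic[OF g w eq nj assms(5,6)]])

text \<open>A walk in a finite automaton whose next block is a function of the current state soon
  repeats a state, and then uniqueness of return words makes it stay there.\<close>

lemma walk_stabilizes:
  assumes g: "g \<in> S" and w: "w \<in> rays m"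
    and det: "\<And>i j. state g w (x + i * period) = state g w (x + j * period) \<Longrightarrow>
        block w (x + i * period) period = block w (x + j * period) period"
  shows "\<exists>i\<le>card S. \<forall>k. state g w (x + (i + k) * period) = state g w (x + i * period) \<and>
        block w (x + (i + k) * period) period = block w (x + i * period) period"
proof -
  let ?st = "\<lambda>i. state g w (x + i * period)"
  let ?b = "\<lambda>i. block w (x + i * period) period"
  have stS: "?st i \<in> S" for i by (rule state_S[OF g w])
  have step: "?st (Suc i) = sec (?st i) (?b i)" for i
    using state_add[OF g w, of "x + i * period" period] by (simp add: algebra_simps)
  have "\<not> inj_on ?st {..card S}"
  proof
    assume "inj_on ?st {..card S}"
    then have "card {..card S} \<le> card S"
      using stS finS by (intro card_inj_on_le[of ?st]) auto
    then show False by simp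
  qed
  then obtain i j where ij: "i < j" "j \<le> card S" "?st i = ?st j"
    unfolding inj_on_def by (metis atMost_iff linorder_neqE_nat)
  define t where "t = ?st i"
  have tS: "t \<in> S" unfolding t_def by (rule stS)
  \<comment> \<open>Reading the current block keeps the state at \<open>t\<close>. For nontrivial
    \<open>t\<close>, the segment from \<open>i\<close> to \<open>j\<close> and the repeated return
    word of length \<open>period\<close> are return words of equal length, hence equal, and the
    current block is that return word.\<close>
  obtain z where z: "?b i = z" "sec t z = t"
  proof (cases "t = e")
    case True
    have "sec t (?b i) = t"
      unfolding True by (rule tree_section_one[OF level_words[OF block_level[OF g w]]])
    then show ?thesis using that by blast
  next
    case False
    have seg: "block w (x + i * period) ((j - i) * period) \<in> level m ((j - i) * period)"
      by (rule block_level[OF g w])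
    have eq: "x + j * period = (x + i * period) + (j - i) * period"
      using ij(1) by (simp add: diff_mult_distrib)
    have "?st j = sec t (block w (x + i * period) ((j - i) * period))"
      unfolding eq t_def by (rule state_add[OF g w])
    then have ret: "sec t (block w (x + i * period) ((j - i) * period)) = t"
      using ij(3) by (simp only: t_def)
    have "block w (x + i * period) ((j - i) * period) \<noteq> []"
      using level_length[OF seg] ij(1) period_pos by auto
    then have "t \<in> returning"
      unfolding returning_def using tS False ret level_words[OF seg] by blast
    then obtain z where z: "z \<in> level m period" "sec t z = t"
      using return_period by blast
    have "block w (x + i * period) ((j - i) * period) = concat (replicate (j - i) z)"
      using sec_replicate[OF tS z, of "j - i"] seg ret
      by (intro return_word_unique[OF tS False seg ret]) auto
    then have "take period (block w (x + i * period) ((j - i) * period)) = take period (concat (replicate (j - i) z))"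
      by simp
    moreover obtain n where n: "j - i = Suc n" using ij(1) by (metis Suc_diff_Suc)
    moreover have "take period (block w (x + i * period) (period + n * period)) = ?b i"
      using level_length[OF block_level[OF g w, of "x + i * period" period]]
      unfolding block_add[OF g w] by simp
    ultimately have "?b i = z" using level_length[OF z(1)] by simp
    then show ?thesis using that z(2) by blast
  qed
  have "?st (i + k) = t" for k
  proof (induction k)
    case (Suc k)
    then have "?b (i + k) = ?b i" using det[of "i + k" i] by (simp add: t_def)
    then show ?case using step[of "i + k"] Suc z by simp
  qed (simp add: t_def)
  then have "?st (i + k) = ?st i" for k unfolding t_def .
  then have "\<forall>k. ?st (i + k) = ?st i \<and> ?b (i + k) = ?b i"
    using det by blast
  then show ?thesis using ij by (intro exI[of _ i]) auto
qed

lemma letters_equal_mod: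
  assumes "\<And>y. y \<ge> x \<Longrightarrow> \<not> jump w y" "y \<ge> x"
  shows "letter w (y + i * period) = letter w y"
proof (induction i)
  case (Suc i)
  have "\<not> jump w (y + i * period)" using assms by simp
  then show ?case using Suc by (simp add: jump_def algebra_simps)
qed simp

text \<open>Whichever of the two rays is periodic from \<open>x\<close> on, the state determines the
  next block of \<open>w\<close>: if it is the image, then equal states have produced equal output
  blocks, and injectivity recovers equal inputs. So within \<open>card S\<close> periods the walk
  repeats one state and one block forever, and both rays are periodic from there. This limits how
  far the last jump can move.\<close>

lemma no_jump_transfer:
  assumes g: "g \<in> S" and w: "w \<in> rays m"
    and nj: "(\<forall>y\<ge>x. \<not> jump w y) \<or> (\<forall>y\<ge>x. \<not> jump (ray_act w g) y)"
    and y: "y \<ge> x + card S * period"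
  shows "\<not> jump w y" "\<not> jump (ray_act w g) y"
proof -
  have det: "block w (x + i * period) period = block w (x + j * period) period"
    if st: "state g w (x + i * period) = state g w (x + j * period)" for i j
    using nj
  proof
    assume "\<forall>y\<ge>x. \<not> jump w y"
    then have "letter w ((x + k) + i * period) = letter w ((x + k) + j * period)" for k
      using letters_equal_mod[of x w "x + k"] by simp
    then show ?thesis
      unfolding block_def[OF g w] by (intro nth_equalityI) (auto simp: algebra_simps)
  next
    let ?w = "ray_act w g"
    assume "\<forall>y\<ge>x. \<not> jump ?w y"
    then have "letter ?w ((x + k) + i * period) = letter ?w ((x + k) + j * period)" for k
      using letters_equal_mod[of x ?w "x + k"] by simp
    then have "map (letter ?w) [x + i * period..<x + i * period + period]
        = map (letter ?w) [x + j * period..<x + j * period + period]"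
      by (intro nth_equalityI) (auto simp: algebra_simps)
    then have "state g w (x + i * period) (block w (x + i * period) period)
        = state g w (x + i * period) (block w (x + j * period) period)"
      using state_block[OF g w, of "x + i * period" period] state_block[OF g w, of "x + j * period" period]
        st by simp
    then show ?thesis
      using Aut_tree_inj[OF S_Aut[OF state_S[OF g w]]] level_words[OF block_level[OF g w]]
      by (meson inj_onD)
  qed
  obtain i where i: "i \<le> card S"
    "\<And>k. state g w (x + (i + k) * period) = state g w (x + i * period)"
    "\<And>k. block w (x + (i + k) * period) period = block w (x + i * period) period"
    using walk_stabilizes[OF g w det] by blast
  let ?x = "x + i * period"
  have xy: "?x \<le> y"
    using y mult_le_mono1[OF i(1), of period] by linarith
  have wj: "\<not> jump w z" if "?x \<le> z" for z
  proof -
    define k where "k = (z - ?x) div period"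
    define o' where "o' = (z - ?x) mod period"
    have o': "o' < period" unfolding o'_def using period_pos by simp
    have z: "z = x + (i + k) * period + o'" "z + period = x + (i + Suc k) * period + o'"
      using that div_mult_mod_eq[of "z - ?x" period]
      by (auto simp: k_def o'_def algebra_simps)
    have "block w (x + (i + k) * period) period ! o' = block w (x + (i + Suc k) * period) period ! o'"
      using i(3)[of k] i(3)[of "Suc k"] by simp
    then show ?thesis
      unfolding jump_def z(2) unfolding z(1) using o' by (simp add: block_def[OF g w])
  qed
  then show "\<not> jump w y" using xy by blast
  have "state g w (?x + period) = state g w ?x"
    using i(2)[of 1] by (simp add: algebra_simps)
  from no_jump_act[OF g w this, of y y] wj xy show "\<not> jump (ray_act w g) y" by simp
qed

text \<open>Within \<open>card S\<close> letters a state which is not wide becomes trivial or lies on a loop. The loop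
  is left at the first jump of the ray, which is also a jump of its image because states are
  injective on letters.\<close>

lemma narrow_cases:
  assumes g: "g \<in> S" and w: "w \<in> rays m" and narrow: "\<not> wide (state g w x)"
  obtains
    (same) "\<And>y. y \<ge> x + card S + period + finitary_depth \<Longrightarrow> letter (ray_act w g) y = letter w y"
  | (periodic) "\<And>y. y \<ge> x + card S \<Longrightarrow> \<not> jump w y \<and> \<not> jump (ray_act w g) y"
  | (jump) p where "p \<ge> x" "jump w p" "jump (ray_act w g) p"
      "\<And>y. x + card S \<le> y \<Longrightarrow> y < p \<Longrightarrow> \<not> jump w y \<and> \<not> jump (ray_act w g) y"
      "\<And>y. y \<ge> p + 2 * period + finitary_depth \<Longrightarrow> letter (ray_act w g) y = letter w y"
proof -
  let ?st = "state g w"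
  let ?D = finitary_depth
  have stS: "?st i \<in> S" for i by (rule state_S[OF g w])
  have "\<not> inj_on (\<lambda>i. ?st (x + i)) {..card S}"
  proof
    assume "inj_on (\<lambda>i. ?st (x + i)) {..card S}"
    then have "card {..card S} \<le> card S"
      using stS finS by (intro card_inj_on_le[of "\<lambda>i. ?st (x + i)"]) auto
    then show False by simp
  qed
  then obtain i0 j0 where ij0: "i0 < j0" "j0 \<le> card S" "?st (x + i0) = ?st (x + j0)"
    unfolding inj_on_def by (metis atMost_iff linorder_neqE_nat)
  define i where "i = x + i0"
  define t where "t = ?st i"
  have tS: "t \<in> S" unfolding t_def by (rule stS)
  have xi: "x \<le> i" "i \<le> x + card S" using ij0 by (auto simp: i_def)
  show thesis
  proof (cases "t = e")
    case True
    then have "letter (ray_act w g) y = letter w y" if "y \<ge> x + card S + period + ?D" for y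
      using trivial_after(2)[OF g w, of i y] xi that by (simp add: t_def)
    then show thesis by (rule same)
  next
    case False
    have "sec t (block w i (j0 - i0)) = t"
      using state_add[OF g w, of i "j0 - i0"] ij0 by (simp add: i_def t_def)
    moreover have bl: "block w i (j0 - i0) \<in> level m (j0 - i0)" by (rule block_level[OF g w])
    moreover have "block w i (j0 - i0) \<noteq> []" using level_length[OF bl] ij0 by auto
    ultimately have "t \<in> returning"
      unfolding returning_def using tS False level_words[OF bl] by blast
    then obtain u where u: "u \<in> level m period" "sec t u = t"
      using return_period by blast
    have tx: "t = sec (?st x) (block w x i0)"
      using state_add[OF g w, of x i0] by (simp add: t_def i_def)
    \<comment> \<open>The loop \<open>u\<close> with an infinitary exit, reached from
      \<open>?st x\<close> by the letters in between, is precisely what \<open>wide\<close> asks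
      for.\<close>
    have fin_off: "\<not> infinitary (sec t v)" if v: "v \<in> level m period" "v \<noteq> u" for v
    proof
      assume "infinitary (sec t v)"
      then have "wide (?st x)"
        unfolding wide_def using False u v tx level_words[OF block_level[OF g w, of x i0]] by blast
      then show False using narrow by simp
    qed
    \<comment> \<open>The block at \<open>z\<close> leads from the loop into a finitary state, which
      is trivial after \<open>?D\<close> more letters.\<close>
    have leave: "letter (ray_act w g) y = letter w y"
      if z: "?st z = t" "block w z period \<noteq> u" "y \<ge> z + period + ?D" for y z
    proof -
      have "sec (sec t (block w z period)) (block w (z + period) ?D) = e"
        using fin_off[OF block_level[OF g w] z(2)] block_level[OF g w, of "z + period" ?D]
          S_closed[OF tS level_words[OF block_level[OF g w, of z period]]]
        by (intro finitary_depth) (auto simp: level_def)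
      then have "?st (z + period + ?D) = e"
        using z(1) state_add[OF g w, of z period] state_add[OF g w, of "z + period" ?D] by simp
      then show ?thesis using trivial_after(2)[OF g w] z(3) by blast
    qed
    show thesis
    proof (cases "block w i period = u")
      case False
      then have "letter (ray_act w g) y = letter w y" if "y \<ge> x + card S + period + ?D" for y
        using leave[of i y] xi that by (simp add: t_def)
      then show thesis by (rule same)
    next
      case True
      have eq: "?st (i + period) = ?st i"
        using state_add[OF g w, of i period] True u by (simp add: t_def)
      show thesis
      proof (cases "\<exists>y\<ge>i. jump w y")
        case False
        then have "\<not> jump w y \<and> \<not> jump (ray_act w g) y" if "y \<ge> x + card S" for y
          using no_jump_act[OF g w eq, of y y] xi that by simp
        then show thesis by (rule periodic)
      next
        case True
        define p where "p = (LEAST y. y \<ge> i \<and> jump w y)"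
        have p: "p \<ge> i" "jump w p"
          unfolding p_def using LeastI_ex[of "\<lambda>y. y \<ge> i \<and> jump w y"] True by auto
        have before: "\<not> jump w y" if "i \<le> y" "y < p" for y
          using not_less_Least[of y "\<lambda>y. y \<ge> i \<and> jump w y"] that by (auto simp: p_def)
        then have before': "\<forall>y\<in>{i..<p}. \<not> jump w y" by simp
        have per: "?st (y + period) = ?st y" if "i \<le> y" "y \<le> p" for y
          using state_periodic[OF g w eq before' that] .
        \<comment> \<open>\<open>k\<close> counts the full turns before the one containing
          \<open>p\<close>. That turn still reads \<open>u\<close>, as the states recur up to
          \<open>p\<close>. The jump at \<open>p\<close> compares it with the next turn, so it is
          the next one that departs from \<open>u\<close>.\<close>
        define k where "k = (p - i) div period"
        have k: "i + k * period \<le> p" "p < i + Suc k * period"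
          using p(1) div_mult_mod_eq[of "p - i" period] mod_less_divisor[OF period_pos, of "p - i"]
          by (auto simp: k_def)
        have stk: "?st (i + j * period) = t" if "j \<le> Suc k" for j
          using that
        proof (induction j)
          case (Suc j)
          then have "j * period \<le> k * period" by simp
          then have "i + j * period \<le> p" using k(1) by linarith
          then show ?case using per[of "i + j * period"] Suc by (simp add: algebra_simps)
        qed (simp add: t_def)
        let ?z = "i + k * period"
        have st1: "?st ?z = t" "?st (?z + period) = t"
          using stk[of k] stk[of "Suc k"] by (simp_all add: algebra_simps)
        have b1: "block w ?z period = u"
          using return_word_unique[OF tS \<open>t \<noteq> e\<close> block_level[OF g w] _ u, of ?z]
            state_add[OF g w, of ?z period] st1 by simp
        have b2: "block w (?z + period) period \<noteq> u"
        proof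
          assume "block w (?z + period) period = u"
          then have "block w ?z period ! (p - ?z) = block w (?z + period) period ! (p - ?z)"
            using b1 by simp
          moreover have "p - ?z < period" using k by simp
          ultimately have "\<not> jump w p"
            using k(1) by (simp add: block_def[OF g w] jump_def algebra_simps)
          then show False using p(2) by simp
        qed
        \<comment> \<open>The departing turn starts at \<open>?z + period\<close>, at most
          \<open>p + period\<close>, and takes one more period.\<close>
        have after: "letter (ray_act w g) y = letter w y" if "y \<ge> p + 2 * period + ?D" for y
          using leave[OF st1(2) b2] k(1) that by simp
        have act: "jump (ray_act w g) y \<longleftrightarrow> jump w y" if "i \<le> y" "y \<le> p" for y
          by (rule no_jump_act[OF g w eq before' that])
        show thesis
          using p xi before act after by (intro jump[of p]) auto
      qed
    qed
  qed
qed

end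

section \<open>A potential on bit sequences\<close>

text \<open>\<open>gray q b n\<close> is a weighted Gray code of the bits below \<open>n\<close>, the highest bit being the most
  significant one. The word \<open>0 \<dots> 0 1\<close> has code \<open>1\<close>, so that changing the bit which follows it does
  not change the code.\<close>

primrec gray :: "real \<Rightarrow> (nat \<Rightarrow> bool) \<Rightarrow> nat \<Rightarrow> real" where
  "gray q b 0 = 0"
| "gray q b (Suc n) = (if b n then 1 - q * gray q b n else (1 - q) * gray q b n)"

text \<open>The product of the contraction factors of the steps of \<open>gray\<close> from
  \<open>k\<close> to \<open>n - 1\<close>: the damping at \<open>n\<close> of a difference of codes
  at \<open>k\<close>.\<close>

definition weight :: "real \<Rightarrow> (nat \<Rightarrow> bool) \<Rightarrow> nat \<Rightarrow> nat \<Rightarrow> real" where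
  "weight q b k n = (\<Prod>j\<in>{k..<n}. if b j then q else 1 - q)"

text \<open>The default 1 is also the code of a word \<open>0 ... 0 1\<close>. A change of the bit
  at \<open>n\<close> right behind such a word is therefore not seen, although it switches between
  the two cases.\<close>

definition cutoff :: "real \<Rightarrow> (nat \<Rightarrow> bool) \<Rightarrow> nat \<Rightarrow> real" where
  "cutoff q b n = (if \<exists>j\<ge>n. b j then 1 else gray q b n)"

lemma weight_refl [simp]: "weight q b k k = 1"
  by (simp add: weight_def)

lemma weight_Suc: "k \<le> n \<Longrightarrow> weight q b k (Suc n) = weight q b k n * (if b n then q else 1 - q)"
  by (simp add: weight_def)

lemma weight_split: "k \<le> l \<Longrightarrow> l \<le> n \<Longrightarrow> weight q b k n = weight q b k l * weight q b l n"
  unfolding weight_def by (rule prod.atLeastLessThan_concat[symmetric])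

lemma weight_zero:
  assumes "\<And>j. k \<le> j \<Longrightarrow> j < n \<Longrightarrow> \<not> b j"
  shows "weight q b k n = (1 - q) ^ (n - k)"
proof -
  have "weight q b k n = (\<Prod>j\<in>{k..<n}. 1 - q)"
    unfolding weight_def using assms by (intro prod.cong) auto
  then show ?thesis by simp
qed

lemma gray_diff:
  assumes "k \<le> n" "\<And>j. k \<le> j \<Longrightarrow> j < n \<Longrightarrow> b j = b' j" "0 \<le> q" "q \<le> 1"
  shows "\<bar>gray q b n - gray q b' n\<bar> = weight q b k n * \<bar>gray q b k - gray q b' k\<bar>"
  using assms(1,2)
proof (induction n rule: dec_induct)
  case (step n)
  have IH: "\<bar>gray q b n - gray q b' n\<bar> = weight q b k n * \<bar>gray q b k - gray q b' k\<bar>"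
    using step by auto
  have "b' n = b n" using step by auto
  moreover have "\<bar>(1 - q * x) - (1 - q * y)\<bar> = q * \<bar>x - y\<bar>" "\<bar>(1 - q) * x - (1 - q) * y\<bar> = (1 - q) * \<bar>x - y\<bar>" for x y
    using assms(3,4) by (simp_all add: abs_mult flip: right_diff_distrib) (simp add: abs_minus_commute)
  ultimately show ?case
    using IH step(1) by (simp add: weight_Suc)
qed simp

lemma gray_decay:
  assumes "k \<le> n" "\<And>j. k \<le> j \<Longrightarrow> j < n \<Longrightarrow> \<not> b j"
  shows "gray q b n = (1 - q) ^ (n - k) * gray q b k"
  using assms by (induction n rule: dec_induct) (simp_all add: Suc_diff_le)

text \<open>The effect on bits when block \<open>K\<close> starts in a state that is not wide. Part
  of block \<open>K\<close> may be spent on entering a loop. Block \<open>J\<close> contains the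
  first jump, and the departure it causes is over before block \<open>J + 2\<close>; a jump still
  inside block \<open>K\<close> falls under the first alternative, whence
  \<open>K + 2\<close>.\<close>

definition narrow_change :: "nat \<Rightarrow> (nat \<Rightarrow> bool) \<Rightarrow> (nat \<Rightarrow> bool) \<Rightarrow> bool" where
  "narrow_change K b b' \<longleftrightarrow> (\<forall>j\<ge>K+2. b j = b' j) \<or>
     (\<exists>J\<ge>K+1. (\<forall>j. K+1 \<le> j \<and> j < J \<longrightarrow> \<not> b j \<and> \<not> b' j) \<and> b J \<and> b' J \<and> (\<forall>j\<ge>J+2. b j = b' j))"

text \<open>\<open>l\<close> is the least bound on the positions of the bits of \<open>b\<close>.\<close>

definition controlled :: "nat \<Rightarrow> nat \<Rightarrow> (nat \<Rightarrow> bool) \<Rightarrow> (nat \<Rightarrow> bool) \<Rightarrow> bool" where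
  "controlled k l b b' \<longleftrightarrow> (\<forall>j\<ge>l. \<not> b j) \<and> (l > 0 \<longrightarrow> b (l - 1)) \<and> (\<forall>j\<ge>l+1. \<not> b' j) \<and>
     (\<forall>n. (\<forall>i\<ge>n. \<not> b' i) \<longrightarrow> (\<forall>j\<ge>n+1. \<not> b j)) \<and>
     (k = l \<or> (\<exists>K. k = K + 1 \<and> k < l \<and> narrow_change K b b'))"

definition potential :: "real \<Rightarrow> nat \<Rightarrow> (nat \<Rightarrow> bool) \<Rightarrow> real" where
  "potential q N b = (\<Sum>n\<le>N. cutoff q b n / (real n + 1))"

section \<open>Estimates for a single cutoff\<close>

context
  fixes q :: real
  assumes q: "0 < q" "q \<le> 1 / 2"
begin

lemma gray_bounds: "0 \<le> gray q b n" "gray q b n \<le> 1"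
proof -
  have "0 \<le> gray q b n \<and> gray q b n \<le> 1"
  proof (induction n)
    case (Suc n)
    have "q * gray q b n \<le> 1 * 1" "(1 - q) * gray q b n \<le> 1 * 1"
      using Suc q by (intro mult_mono; simp)+
    then show ?case using Suc q by simp
  qed simp
  then show "0 \<le> gray q b n" "gray q b n \<le> 1" by auto
qed

lemma cutoff_bounds: "0 \<le> cutoff q b n" "cutoff q b n \<le> 1"
  by (auto simp: cutoff_def gray_bounds)

lemma cutoff_diff_le_1: "\<bar>cutoff q b n - cutoff q b' n\<bar> \<le> 1"
  using cutoff_bounds[of b n] cutoff_bounds[of b' n] by linarith

lemma weight_pos: "0 < weight q b k n"
  unfolding weight_def using q by (intro prod_pos) auto

lemma gray_diff_le:
  assumes "k \<le> n" "\<And>j. k \<le> j \<Longrightarrow> j < n \<Longrightarrow> b j = b' j"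
  shows "\<bar>gray q b n - gray q b' n\<bar> \<le> weight q b k n"
proof -
  have "weight q b k n * \<bar>gray q b k - gray q b' k\<bar> \<le> weight q b k n * 1"
    using gray_bounds[of b k] gray_bounds[of b' k] weight_pos[of b k n]
    by (intro mult_left_mono) auto
  then show ?thesis using gray_diff[OF assms] q by simp
qed

text \<open>As \<open>q \<le> 1 / 2\<close>, the smaller of the two possible factors is
  \<open>q\<close>.\<close>

lemma weight_drop_first:
  assumes "k < n"
  shows "q * weight q b (Suc k) n \<le> weight q b k n"
proof -
  have "weight q b k n = weight q b k (Suc k) * weight q b (Suc k) n"
    using assms by (intro weight_split) auto
  moreover have "weight q b k (Suc k) \<ge> q"
    using q by (simp add: weight_def)
  ultimately show ?thesis
    using weight_pos[of b "Suc k" n] by (simp add: mult_right_mono)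
qed

lemma gray_decay_le:
  assumes "k \<le> n" "\<And>j. k \<le> j \<Longrightarrow> j < n \<Longrightarrow> \<not> b j"
  shows "gray q b n \<le> (1 - q) ^ (n - k)"
proof -
  have "(1 - q) ^ (n - k) * gray q b k \<le> (1 - q) ^ (n - k) * 1"
    using q gray_bounds[of b k] by (intro mult_left_mono) auto
  then show ?thesis using gray_decay[where q = q, OF assms] by simp
qed

text \<open>The second alternative is the delicate one. Below \<open>J\<close> both codes are at
  most \<open>\<eta>\<close>, the weight of the zeros from \<open>K + 1\<close> on. So bit
  \<open>J\<close> brings both within \<open>q * \<eta>\<close> of 1, and bit \<open>J + 1\<close>,
  whatever its two values, within \<open>q * \<eta>\<close> of \<open>1 - q\<close>; later bits
  agree and contract. The factor \<open>q\<^sup>2\<close> pays for the weights of the positions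
  \<open>J\<close> and \<open>J + 1\<close>.\<close>

lemma cutoff_diff_narrow:
  assumes nc: "narrow_change K b b'" and n: "n \<ge> K + 2"
  shows "q\<^sup>2 * \<bar>cutoff q b n - cutoff q b' n\<bar> \<le> weight q b (K + 1) n"
  using nc unfolding narrow_change_def
proof
  assume eq: "\<forall>j\<ge>K+2. b j = b' j"
  show ?thesis
  proof (cases "\<exists>j\<ge>n. b j")
    case True
    moreover from this have "\<exists>j\<ge>n. b' j" using eq n by (meson order_trans)
    ultimately have "cutoff q b n = 1" "cutoff q b' n = 1" by (simp_all add: cutoff_def)
    then show ?thesis using weight_pos[of b "K + 1" n] by simp
  next
    case False
    moreover from this have "\<not> (\<exists>j\<ge>n. b' j)" using eq n by (meson order_trans)
    ultimately have c: "cutoff q b n = gray q b n" "cutoff q b' n = gray q b' n" by (auto simp: cutoff_def)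
    have "\<bar>cutoff q b n - cutoff q b' n\<bar> \<le> weight q b (K + 2) n"
      unfolding c using n eq by (intro gray_diff_le) auto
    then have "q * \<bar>cutoff q b n - cutoff q b' n\<bar> \<le> q * weight q b (K + 2) n"
      using q by (intro mult_left_mono) auto
    also have "\<dots> \<le> weight q b (K + 1) n"
      using weight_drop_first[of "K + 1" n b] n by simp
    finally have *: "q * \<bar>cutoff q b n - cutoff q b' n\<bar> \<le> weight q b (K + 1) n" .
    have "q\<^sup>2 * \<bar>cutoff q b n - cutoff q b' n\<bar> \<le> q * \<bar>cutoff q b n - cutoff q b' n\<bar>"
      using q by (intro mult_right_mono) (auto simp: power2_eq_square mult_left_le_one_le)
    then show ?thesis using * by linarith
  qed
next
  assume "\<exists>J\<ge>K+1. (\<forall>j. K+1 \<le> j \<and> j < J \<longrightarrow> \<not> b j \<and> \<not> b' j) \<and> b J \<and> b' J \<and> (\<forall>j\<ge>J+2. b j = b' j)"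
  then obtain J where J: "J \<ge> K + 1" "\<And>j. K + 1 \<le> j \<Longrightarrow> j < J \<Longrightarrow> \<not> b j"
    "\<And>j. K + 1 \<le> j \<Longrightarrow> j < J \<Longrightarrow> \<not> b' j" "b J" "b' J" and eq: "\<And>j. j \<ge> J + 2 \<Longrightarrow> b j = b' j"
    by blast
  define \<eta> where "\<eta> = (1 - q) ^ (J - (K + 1))"
  have \<eta>: "0 \<le> \<eta>" "\<eta> \<le> 1" using q by (auto simp: \<eta>_def power_le_one)
  have wJ: "weight q b (K + 1) J = \<eta>" unfolding \<eta>_def by (rule weight_zero) (use J in auto)
  have J1: "1 - q * \<eta> \<le> gray q c (Suc J)" "gray q c (Suc J) \<le> 1" if "c J" "gray q c J \<le> \<eta>" for c
    using that q gray_bounds[of c J] by (auto simp: mult_left_mono)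
  have cJ: "gray q b J \<le> \<eta>" "gray q b' J \<le> \<eta>"
    unfolding \<eta>_def using J by (auto intro!: gray_decay_le)
  note bJ = J1[OF J(4) cJ(1)] and b'J = J1[OF J(5) cJ(2)]
  have q\<eta>: "q * \<eta> \<le> \<eta>" using q \<eta> by (simp add: mult_left_le_one_le)
  consider "n \<le> J" | "n = J + 1" | "n \<ge> J + 2" by linarith
  then show ?thesis
  proof cases
    case 1
    then have "cutoff q b n = 1" "cutoff q b' n = 1" using J by (auto simp: cutoff_def)
    then show ?thesis using weight_pos[of b "K + 1" n] by simp
  next
    \<comment> \<open>At \<open>n = J + 1\<close> the later bits decide between the code and the
      default 1, and the code is already within \<open>q * \<eta>\<close> of 1.\<close>
    case 2
    then have "\<bar>cutoff q b n - cutoff q b' n\<bar> \<le> q * \<eta>"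
      using bJ b'J q \<eta> by (auto simp: cutoff_def simp del: gray.simps)
    then have "\<bar>cutoff q b n - cutoff q b' n\<bar> \<le> \<eta>" using q\<eta> by simp
    then have "q\<^sup>2 * \<bar>cutoff q b n - cutoff q b' n\<bar> \<le> q * \<eta>"
      using q \<eta> unfolding power2_eq_square by (intro mult_mono) (auto simp: mult_left_le_one_le)
    also have "\<dots> = weight q b (K + 1) n"
      using 2 J(1,4) wJ by (simp add: weight_Suc)
    finally show ?thesis .
  next
    case 3
    show ?thesis
    proof (cases "\<exists>j\<ge>n. b j")
      case True
      moreover from this have "\<exists>j\<ge>n. b' j" using eq 3 by (meson order_trans)
      ultimately have "cutoff q b n = 1" "cutoff q b' n = 1" by (simp_all add: cutoff_def)
      then show ?thesis using weight_pos[of b "K + 1" n] by simp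
    next
      case False
      moreover from this have "\<not> (\<exists>j\<ge>n. b' j)" using eq 3 by (meson order_trans)
      ultimately have c: "cutoff q b n = gray q b n" "cutoff q b' n = gray q b' n" by (auto simp: cutoff_def)
      have near: "\<bar>gray q c (Suc (Suc J)) - (1 - q)\<bar> \<le> q * \<eta>"
        if "1 - q * \<eta> \<le> gray q c (Suc J)" "gray q c (Suc J) \<le> 1" for c
      proof (cases "c (Suc J)")
        case True
        have "q * (1 - gray q c (Suc J)) \<le> 1 * (q * \<eta>)"
          using that q \<eta> by (intro mult_mono) auto
        moreover have "0 \<le> q * (1 - gray q c (Suc J))" using that q by simp
        ultimately show ?thesis using True by (simp add: algebra_simps del: gray.simps(2)) (simp add: algebra_simps)
      next
        case False
        have "(1 - q) * (1 - gray q c (Suc J)) \<le> 1 * (q * \<eta>)"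
          using that q \<eta> by (intro mult_mono) auto
        moreover have "0 \<le> (1 - q) * (1 - gray q c (Suc J))" using that q by simp
        moreover have "gray q c (Suc (Suc J)) = (1 - q) * gray q c (Suc J)"
          using False by simp
        ultimately show ?thesis by (simp only: right_diff_distrib mult_1_right mult_1_left)
      qed
      have "\<bar>gray q b (J + 2) - gray q b' (J + 2)\<bar> \<le> 2 * (q * \<eta>)"
        using near[OF bJ] near[OF b'J] by simp
      also have "\<dots> \<le> \<eta>" using mult_right_mono[OF q(2) \<eta>(1)] by simp
      finally have d: "\<bar>gray q b (J + 2) - gray q b' (J + 2)\<bar> \<le> \<eta>" .
      have wJ2: "weight q b (J + 2) n > 0" by (rule weight_pos)
      have "\<bar>cutoff q b n - cutoff q b' n\<bar> = weight q b (J + 2) n * \<bar>gray q b (J + 2) - gray q b' (J + 2)\<bar>"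
        unfolding c using 3 eq q by (intro gray_diff) auto
      also have "\<dots> \<le> weight q b (J + 2) n * \<eta>"
        using d wJ2 by (intro mult_left_mono) auto
      finally have "q\<^sup>2 * \<bar>cutoff q b n - cutoff q b' n\<bar> \<le> q\<^sup>2 * (weight q b (J + 2) n * \<eta>)"
        by (intro mult_left_mono) auto
      also have "\<dots> = (q * (q * weight q b (J + 2) n)) * \<eta>"
        by (simp add: power2_eq_square)
      also have "\<dots> \<le> weight q b J n * \<eta>"
      proof (intro mult_right_mono \<eta>)
        have "q * (q * weight q b (J + 2) n) \<le> q * weight q b (J + 1) n"
          using weight_drop_first[of "J + 1" n b] 3 q by (intro mult_left_mono) auto
        also have "\<dots> \<le> weight q b J n" using weight_drop_first[of J n b] 3 by simp
        finally show "q * (q * weight q b (J + 2) n) \<le> weight q b J n" .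
      qed
      also have "\<dots> = weight q b (K + 1) n"
        using weight_split[of "K + 1" J n q b] J(1) 3 wJ by simp
      finally show ?thesis .
    qed
  qed
qed

text \<open>If \<open>n + 1 < l\<close>, both sequences have a bit from \<open>n\<close> on:
  \<open>b\<close> at \<open>l - 1\<close>, and \<open>b'\<close> because otherwise \<open>b\<close>
  would have no bit after \<open>n\<close>. Past \<open>l\<close> only zeros remain, up to one bit
  of \<open>b'\<close>, and each position contracts by \<open>1 - q\<close>. At
  \<open>n = l - 1\<close> the truncated exponent is 0 and the last bit of \<open>b\<close> costs
  one more factor \<open>q\<close>, hence \<open>q ^ 3\<close>.\<close>

lemma cutoff_diff:
  assumes ctl: "controlled k l b b'"
  shows "n + 1 < l \<Longrightarrow> cutoff q b n = cutoff q b' n"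
    and "q ^ 3 * \<bar>cutoff q b n - cutoff q b' n\<bar> \<le> weight q b k l * (1 - q) ^ (n - l)"
proof -
  have last: "\<And>j. j \<ge> l \<Longrightarrow> \<not> b j" "l > 0 \<Longrightarrow> b (l - 1)"
    and transfer: "\<And>j. j \<ge> l + 1 \<Longrightarrow> \<not> b' j" "\<And>n j. (\<forall>i\<ge>n. \<not> b' i) \<Longrightarrow> j \<ge> n + 1 \<Longrightarrow> \<not> b j"
    and k: "k = l \<or> (\<exists>K. k = K + 1 \<and> k < l \<and> narrow_change K b b')"
    using ctl unfolding controlled_def by blast+
  show small: "cutoff q b n = cutoff q b' n" if "n + 1 < l" for n
  proof -
    have "b (l - 1)" using last that by simp
    then have "\<exists>j\<ge>n. b' j" using transfer(2)[of n "l - 1"] that by fastforce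
    moreover have "\<exists>j\<ge>n. b j" using \<open>b (l - 1)\<close> that by (intro exI[of _ "l - 1"]) auto
    ultimately show ?thesis by (simp add: cutoff_def)
  qed
  have q3: "q ^ 3 \<le> q" "q ^ 3 \<le> q ^ 2" "q ^ 3 \<le> 1 / 8"
    using q power_decreasing[of 1 3 q] power_decreasing[of 2 3 q] power_mono[of q "1/2" 3]
    by (simp_all add: power3_eq_cube)
  show "q ^ 3 * \<bar>cutoff q b n - cutoff q b' n\<bar> \<le> weight q b k l * (1 - q) ^ (n - l)"
  proof (cases "n + 1 < l")
    case True
    then show ?thesis using small[OF True] weight_pos[of b k l] q by simp
  next
    case False
    then have n: "n + 1 \<ge> l" by simp
    from k consider "k = l" | K where "k = K + 1" "k < l" "narrow_change K b b'" by blast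
    then show ?thesis
    proof cases
      case 1
      have "q ^ 3 * \<bar>cutoff q b n - cutoff q b' n\<bar> \<le> (1 - q) ^ (n - l)"
      proof (cases "n \<le> l")
        case True
        have "q ^ 3 * \<bar>cutoff q b n - cutoff q b' n\<bar> \<le> 1 * 1"
          using q3 q cutoff_diff_le_1[of b n b'] by (intro mult_mono) auto
        then show ?thesis using True by simp
      next
        case False
        let ?x = "(1 - q) ^ (n - (l + 1))"
        have x: "?x \<ge> 0" using q by simp
        have c: "cutoff q b n = gray q b n" "cutoff q b' n = gray q b' n"
          using last transfer(1) False by (auto simp: cutoff_def)
        have "gray q b n \<le> ?x" "gray q b' n \<le> ?x"
          using last transfer(1) False by (auto intro!: gray_decay_le)
        then have "\<bar>cutoff q b n - cutoff q b' n\<bar> \<le> ?x"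
          unfolding c using gray_bounds[of b n] gray_bounds[of b' n] by linarith
        then have "q ^ 3 * \<bar>cutoff q b n - cutoff q b' n\<bar> \<le> (1 - q) * ?x"
          using q3 q x by (intro mult_mono) auto
        also have "(1 - q) * ?x = (1 - q) ^ (n - l)"
          using False by (simp flip: power_Suc add: Suc_diff_Suc)
        finally show ?thesis .
      qed
      then show ?thesis using 1 by simp
    next
      case 2
      show ?thesis
      proof (cases "n \<ge> K + 2")
        case False
        then have l: "l = Suc k" "n = k" using n 2 by auto
        have "q ^ 3 * \<bar>cutoff q b n - cutoff q b' n\<bar> \<le> q * 1"
          using q3 q cutoff_diff_le_1[of b n b'] by (intro mult_mono) auto
        also have "q \<le> weight q b k l" unfolding l using q by (simp add: weight_def)
        finally show ?thesis using l by simp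
      next
        case True
        have nar: "q\<^sup>2 * \<bar>cutoff q b n - cutoff q b' n\<bar> \<le> weight q b k n"
          using cutoff_diff_narrow[OF 2(3) True] 2(1) by simp
        show ?thesis
        proof (cases "n \<ge> l")
          case True
          have "q ^ 3 * \<bar>cutoff q b n - cutoff q b' n\<bar> \<le> q\<^sup>2 * \<bar>cutoff q b n - cutoff q b' n\<bar>"
            using q3 by (intro mult_right_mono) auto
          also have "\<dots> \<le> weight q b k n" by (rule nar)
          also have "\<dots> = weight q b k l * (1 - q) ^ (n - l)"
            using weight_split[of k l n q b] weight_zero[of l n b q] 2 True last by simp
          finally show ?thesis .
        next
          case False
          then have l: "l = Suc n" using n by simp
          have "q ^ 3 * \<bar>cutoff q b n - cutoff q b' n\<bar> = q * (q\<^sup>2 * \<bar>cutoff q b n - cutoff q b' n\<bar>)"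
            by (simp add: power2_eq_square power3_eq_cube)
          also have "\<dots> \<le> q * weight q b k n" using nar q by (intro mult_left_mono) auto
          also have "\<dots> \<le> weight q b k l"
            unfolding l using q weight_pos[of b k n] 2 l by (subst weight_Suc) auto
          finally show ?thesis using l by simp
        qed
      qed
    qed
  qed
qed

section \<open>Superposition of the cutoffs\<close>

text \<open>The \<open>2\<close> covers the index \<open>n = l - 1\<close>, where
  \<open>1 / l \<le> 2 / (l + 1)\<close>; \<open>1 / q\<close> bounds the geometric series from
  \<open>l\<close> on.\<close>

lemma geometric_tail:
  "(\<Sum>n\<in>{n. n \<le> N \<and> l \<le> n + 1}. (1 - q) ^ (n - l) / (real n + 1)) \<le> (2 + 1 / q) / (real l + 1)"
proof -
  let ?f = "\<lambda>n. (1 - q) ^ (n - l) / (real n + 1)"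
  have nn: "?f n \<ge> 0" for n using q by simp
  have "sum ?f {n. n \<le> N \<and> l \<le> n + 1} \<le> sum ?f ({l - 1} \<union> {l..l + N})"
    using nn by (intro sum_mono2) auto
  also have "\<dots> \<le> ?f (l - 1) + sum ?f {l..l + N}"
    using sum_Un_nat nn by (cases "l - 1 \<in> {l..l+N}") (auto simp: insert_absorb)
  also have "?f (l - 1) \<le> 2 / (real l + 1)"
    by (cases l) (auto simp: field_simps)
  also have "sum ?f {l..l + N} \<le> (\<Sum>n\<in>{l..l + N}. (1 - q) ^ (n - l) / (real l + 1))"
    using q by (intro sum_mono divide_left_mono) auto
  also have "\<dots> = (\<Sum>i\<le>N. (1 - q) ^ i) / (real l + 1)"
    unfolding sum_divide_distrib
    by (rule sum.reindex_bij_witness[of _ "\<lambda>i. l + i" "\<lambda>n. n - l"]) auto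
  also have "\<dots> \<le> (1 / q) / (real l + 1)"
  proof (intro divide_right_mono)
    have "(\<Sum>i<Suc N. (1 - q) ^ i) = (1 - (1 - q) ^ Suc N) / q"
      using sum_gp_strict[of "1 - q" "Suc N"] q by simp
    also have "\<dots> \<le> 1 / q" using q by (intro divide_right_mono) auto
    finally show "(\<Sum>i\<le>N. (1 - q) ^ i) \<le> 1 / q" by (simp only: lessThan_Suc_atMost)
  qed simp
  finally show ?thesis by (simp add: add_divide_distrib)
qed

text \<open>The cutoffs are summed before squaring: by the decay beyond \<open>l\<close> the sum is
  bounded by a multiple of its first terms, which carry the factor
  \<open>1 / (l + 1)\<close>.\<close>

lemma potential_diff:
  assumes ctl: "controlled k l b b'"
  shows "N + 1 < l \<Longrightarrow> potential q N b = potential q N b'"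
    and "\<bar>potential q N b - potential q N b'\<bar> \<le> (2 + 1 / q) / q ^ 3 * weight q b k l / (real l + 1)"
proof -
  note cd = cutoff_diff[OF ctl]
  show "potential q N b = potential q N b'" if "N + 1 < l"
    unfolding potential_def using cd(1) that by (intro sum.cong) auto
  let ?I = "{n. n \<le> N \<and> l \<le> n + 1}"
  have "potential q N b - potential q N b' = (\<Sum>n\<le>N. (cutoff q b n - cutoff q b' n) / (real n + 1))"
    by (simp add: potential_def diff_divide_distrib sum_subtractf)
  also have "\<dots> = (\<Sum>n\<in>?I. (cutoff q b n - cutoff q b' n) / (real n + 1))"
  proof (intro sum.mono_neutral_right ballI)
    fix n assume "n \<in> {..N} - ?I"
    then have "cutoff q b n = cutoff q b' n" by (intro cd(1)) auto
    then show "(cutoff q b n - cutoff q b' n) / (real n + 1) = 0" by simp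
  qed auto
  finally have "\<bar>potential q N b - potential q N b'\<bar> \<le> (\<Sum>n\<in>?I. \<bar>(cutoff q b n - cutoff q b' n) / (real n + 1)\<bar>)"
    by (simp only: sum_abs)
  also have "\<dots> \<le> (\<Sum>n\<in>?I. weight q b k l / q ^ 3 * ((1 - q) ^ (n - l) / (real n + 1)))"
  proof (intro sum_mono)
    fix n
    have "\<bar>cutoff q b n - cutoff q b' n\<bar> \<le> weight q b k l / q ^ 3 * (1 - q) ^ (n - l)"
      using cd(2)[of n] q by (simp add: field_simps)
    then show "\<bar>(cutoff q b n - cutoff q b' n) / (real n + 1)\<bar> \<le> weight q b k l / q ^ 3 * ((1 - q) ^ (n - l) / (real n + 1))"
      unfolding abs_divide times_divide_eq_right by (intro divide_mono) auto
  qed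
  also have "\<dots> = weight q b k l / q ^ 3 * (\<Sum>n\<in>?I. (1 - q) ^ (n - l) / (real n + 1))"
    by (simp add: sum_distrib_left)
  also have "\<dots> \<le> weight q b k l / q ^ 3 * ((2 + 1 / q) / (real l + 1))"
    using q weight_pos[of b k l] by (intro mult_left_mono geometric_tail) auto
  finally show "\<bar>potential q N b - potential q N b'\<bar> \<le> (2 + 1 / q) / q ^ 3 * weight q b k l / (real l + 1)"
    by (simp add: mult_ac)
qed

end

section \<open>The energy of the potential\<close>

context quadratic_automaton
begin

text \<open>One block outlasts each of three delays: until a narrow state has become trivial or
  entered its loop, until the state has become trivial after a jump, and until periodicity of one
  ray has passed to the other.\<close>

definition width :: nat where
  "width = card S * period + card S + 2 * period + finitary_depth + 1"

text \<open>Stated for a sequence of letters, so as to apply to rays through \<open>letter\<close>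
  and to finite words through \<open>(!)\<close>. Bit \<open>j\<close> reads letters below
  \<open>Suc j * width + period\<close>, which is why prefixes carry \<open>period\<close> extra
  letters.\<close>

definition bits :: "(nat \<Rightarrow> nat) \<Rightarrow> nat \<Rightarrow> bool" where
  "bits c j \<longleftrightarrow> (\<exists>x\<in>{j * width..<Suc j * width}. c x \<noteq> c (x + period))"

lemma width_pos: "width > 0"
  by (simp add: width_def)

lemma width_ge: "card S + period + finitary_depth \<le> width" "2 * period + finitary_depth \<le> width"
    "card S * period \<le> width" "card S \<le> width"
  by (simp_all add: width_def)

lemma bits_jump: "bits (letter w) j \<longleftrightarrow> (\<exists>x\<in>{j * width..<Suc j * width}. jump w x)"
  by (simp add: bits_def jump_def)

lemma in_window: "x div width * width \<le> x" "x < Suc (x div width) * width"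
  using div_mult_mod_eq[of x width] mod_less_divisor[OF width_pos, of x] by simp_all

lemma no_bits_iff: "(\<forall>j\<ge>n. \<not> bits (letter w) j) \<longleftrightarrow> (\<forall>y\<ge>n * width. \<not> jump w y)"
proof (intro iffI allI impI)
  fix y assume b: "\<forall>j\<ge>n. \<not> bits (letter w) j" and y: "n * width \<le> y"
  have "n \<le> y div width"
    using y width_pos by (simp add: less_eq_div_iff_mult_less_eq)
  then have "\<not> bits (letter w) (y div width)" using b by blast
  then show "\<not> jump w y" unfolding bits_jump using in_window[of y] by simp
next
  fix j assume "\<forall>y\<ge>n * width. \<not> jump w y" "n \<le> j"
  then show "\<not> bits (letter w) j"
    unfolding bits_jump using mult_le_mono1[of n j width] by (meson atLeastLessThan_iff order_trans)
qed

text \<open>The delay \<open>card S * period\<close> fits into one block, so the end of the bits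
  moves by at most one.\<close>

lemma no_bits_transfer:
  assumes g: "g \<in> S" and w: "w \<in> rays m"
  shows "\<forall>j\<ge>n. \<not> bits (letter w) j \<Longrightarrow> \<forall>j\<ge>n+1. \<not> bits (letter (ray_act w g)) j"
    and "\<forall>j\<ge>n. \<not> bits (letter (ray_act w g)) j \<Longrightarrow> \<forall>j\<ge>n+1. \<not> bits (letter w) j"
proof -
  have "n * width + card S * period \<le> (n + 1) * width" using width_ge(3) by simp
  then have far: "y \<ge> n * width + card S * period" if "y \<ge> (n + 1) * width" for y
    using that by linarith
  show "\<forall>j\<ge>n. \<not> bits (letter w) j \<Longrightarrow> \<forall>j\<ge>n+1. \<not> bits (letter (ray_act w g)) j"
    unfolding no_bits_iff using no_jump_transfer(2)[OF g w _ far] by blast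
  show "\<forall>j\<ge>n. \<not> bits (letter (ray_act w g)) j \<Longrightarrow> \<forall>j\<ge>n+1. \<not> bits (letter w) j"
    unfolding no_bits_iff using no_jump_transfer(1)[OF g w _ far] by blast
qed

lemma bits_eq_letters:
  assumes "\<And>y. y \<ge> z \<Longrightarrow> c y = c' y" "z \<le> j * width"
  shows "bits c j = bits c' j"
  unfolding bits_def using assms by (intro bex_cong) auto

lemma narrow_bits:
  assumes g: "g \<in> S" and w: "w \<in> rays m" and narrow: "\<not> wide (state g w (K * width))"
  shows "narrow_change K (bits (letter w)) (bits (letter (ray_act w g)))"
  using g w narrow
proof (cases rule: narrow_cases)
  case same
  have "bits (letter w) j = bits (letter (ray_act w g)) j" if "j \<ge> K + 2" for j
  proof (rule bits_eq_letters[of "K * width + card S + period + finitary_depth"])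
    have "(K + 1) * width \<le> j * width" using that by (intro mult_le_mono1) simp
    moreover have "(K + 1) * width = K * width + width" by simp
    ultimately show "K * width + card S + period + finitary_depth \<le> j * width"
      using width_ge(1) by linarith
  qed (rule same[symmetric])
  then have "\<forall>j\<ge>K + 2. bits (letter w) j = bits (letter (ray_act w g)) j" by simp
  then show ?thesis unfolding narrow_change_def by (rule disjI1)
next
  case periodic
  have "\<not> bits (letter w) j \<and> \<not> bits (letter (ray_act w g)) j" if "j \<ge> K + 1" for j
  proof -
    have "(K + 1) * width \<le> j * width" using that by (intro mult_le_mono1)
    moreover have "(K + 1) * width = K * width + width" by simp
    ultimately have "K * width + card S \<le> j * width" using width_ge(4) by linarith
    then show ?thesis unfolding bits_jump using periodic by auto
  qed
  then have "\<forall>j\<ge>K + 2. bits (letter w) j = bits (letter (ray_act w g)) j" by simp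
  then show ?thesis unfolding narrow_change_def by (rule disjI1)
next
  case (jump p)
  let ?b = "bits (letter w)" and ?b' = "bits (letter (ray_act w g))"
  define J where "J = p div width"
  have J: "J * width \<le> p" "p < Suc J * width" unfolding J_def by (rule in_window)+
  have after: "?b j = ?b' j" if "j \<ge> J + 2" for j
  proof (rule bits_eq_letters[of "p + 2 * period + finitary_depth"])
    have "(J + 2) * width \<le> j * width" using that by (intro mult_le_mono1)
    moreover have "(J + 2) * width = Suc J * width + width" by simp
    ultimately show "p + 2 * period + finitary_depth \<le> j * width"
      using J(2) width_ge(2) by linarith
  qed (rule jump(5)[symmetric])
  show ?thesis
  proof (cases "J \<le> K")
    \<comment> \<open>The jump lies in block \<open>K\<close> itself, so \<open>J + 2\<close> is at
      most \<open>K + 2\<close> and the first alternative applies.\<close>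
    case True
    then show ?thesis unfolding narrow_change_def using after by simp
  next
    case False
    have "\<not> ?b j \<and> \<not> ?b' j" if j: "K + 1 \<le> j" "j < J" for j
    proof -
      have "(K + 1) * width \<le> j * width" "Suc j * width \<le> J * width"
        using j by (intro mult_le_mono1; simp)+
      moreover have "(K + 1) * width = K * width + width" by simp
      ultimately have "K * width + card S \<le> j * width" "Suc j * width \<le> p"
        using J(1) width_ge(4) by linarith+
      then show ?thesis unfolding bits_jump using jump(4) by auto
    qed
    moreover have "?b J" "?b' J" unfolding bits_jump using J jump(2,3) by auto
    ultimately show ?thesis
      unfolding narrow_change_def using False after by (intro disjI2 exI[of _ J]) auto
  qed
qed

subsection \<open>Counting words by their weights\<close>

text \<open>The inverse of the number of words of one block, so that one square
  \<open>q\<^sup>2\<close> for each such word adds up to \<open>q\<close>.\<close>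

definition q :: real where
  "q = 1 / real m ^ width"

text \<open>This is \<open>q + (1 - q)\<^sup>2\<close>: the first term bounds all continuations with
  bit 1, the second the single one with bit 0.\<close>

definition \<beta> :: real where
  "\<beta> = 1 - q + q\<^sup>2"

lemma q_bounds: "0 < q" "q \<le> 1 / 2"
proof -
  have "(2::real) ^ 1 \<le> 2 ^ width" using width_pos by (intro power_increasing) auto
  also have "\<dots> \<le> real m ^ width" using m2 by (intro power_mono) auto
  finally have M: "2 \<le> real m ^ width" by simp
  show "0 < q" using m2 by (simp add: q_def)
  have "1 / real m ^ width \<le> 1 / 2"
    using M m2 by (intro divide_left_mono) auto
  then show "q \<le> 1 / 2" by (simp add: q_def)
qed

lemma \<beta>_bounds: "0 < \<beta>" "\<beta> < 1"
proof -
  have "q * q < q * 1" using q_bounds by (intro mult_strict_left_mono) auto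
  then show "\<beta> < 1" by (simp add: \<beta>_def power2_eq_square)
  show "0 < \<beta>" using q_bounds by (simp add: \<beta>_def add_pos_pos)
qed

text \<open>A zero bit says that the letters of the window recur one period later. Since
  \<open>v\<close> is one period longer than \<open>j\<close> blocks, this determines the letters of
  \<open>y\<close> one after another.\<close>

lemma unique_extension:
  assumes v: "v \<in> level m (j * width + period)"
    and y: "y \<in> level m width" "\<not> bits ((!) (v @ y)) j"
    and y': "y' \<in> level m width" "\<not> bits ((!) (v @ y')) j"
  shows "y = y'"
proof (rule nth_equalityI)
  show "length y = length y'" using y y' by (simp add: level_length)
next
  have shift: "z ! i = (v @ z) ! (j * width + i)"
    if z: "\<not> bits ((!) (v @ z)) j" and i: "i < width" for i z
  proof -
    have "j * width + i \<in> {j * width..<Suc j * width}" using i by simp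
    then have "(v @ z) ! (j * width + i) = (v @ z) ! (j * width + i + period)"
      using z unfolding bits_def by blast
    also have "j * width + i + period = length v + i" using v by (simp add: level_length)
    finally show ?thesis by (simp only: nth_append_length_plus)
  qed
  have "i < width \<longrightarrow> y ! i = y' ! i" for i
  proof (induction i rule: less_induct)
    case (less i)
    show ?case
    proof
      assume i: "i < width"
      show "y ! i = y' ! i"
        unfolding shift[OF y(2) i] shift[OF y'(2) i]
        using less[of "j * width + i - length v"] i v period_pos
        by (auto simp: nth_append level_length)
    qed
  qed
  then show "y ! i = y' ! i" if "i < length y" for i
    using that y by (simp add: level_length)
qed

lemma extension_sum:
  assumes v: "v \<in> level m (j * width + period)"
  shows "(\<Sum>y\<in>level m width. (if bits ((!) (v @ y)) j then q else 1 - q)\<^sup>2) \<le> \<beta>"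
proof -
  let ?Z = "{y \<in> level m width. \<not> bits ((!) (v @ y)) j}"
  have "card ?Z \<le> 1"
    by (subst One_nat_def, subst card_le_Suc0_iff_eq) (auto intro: unique_extension[OF v])
  have "(\<Sum>y\<in>level m width. (if bits ((!) (v @ y)) j then q else 1 - q)\<^sup>2)
      \<le> (\<Sum>y\<in>level m width. q\<^sup>2 + (if y \<in> ?Z then (1 - q)\<^sup>2 - q\<^sup>2 else 0))"
    by (intro sum_mono) auto
  also have "\<dots> = real m ^ width * q\<^sup>2 + real (card ?Z) * ((1 - q)\<^sup>2 - q\<^sup>2)"
    by (simp add: sum.distrib card_level flip: sum.inter_filter)
  also have "\<dots> \<le> q + 1 * ((1 - q)\<^sup>2 - q\<^sup>2)"
  proof (intro add_mono mult_right_mono)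
    show "real m ^ width * q\<^sup>2 \<le> q" using m2 by (simp add: q_def power2_eq_square)
    show "real (card ?Z) \<le> 1" using \<open>card ?Z \<le> 1\<close> by linarith
    show "0 \<le> (1 - q)\<^sup>2 - q\<^sup>2" using q_bounds by (simp add: power2_eq_square algebra_simps)
  qed
  also have "\<dots> \<le> \<beta>" by (simp add: \<beta>_def power2_eq_square algebra_simps)
  finally show ?thesis .
qed

lemma bits_cong_below:
  assumes "\<And>x. x < Suc j * width + period \<Longrightarrow> c x = c' x"
  shows "bits c j = bits c' j"
  unfolding bits_def using assms by (intro bex_cong) auto

lemma weight_cong:
  assumes "\<And>x. x < l * width + period \<Longrightarrow> c x = c' x"
  shows "weight q (bits c) k l = weight q (bits c') k l"
proof -
  have "bits c j = bits c' j" if "j < l" for j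
  proof (rule bits_cong_below)
    fix x assume "x < Suc j * width + period"
    moreover have "Suc j * width \<le> l * width" using that by (intro mult_le_mono1) simp
    ultimately show "c x = c' x" using assms by simp
  qed
  then show ?thesis unfolding weight_def by (intro prod.cong) auto
qed

text \<open>Appending one block multiplies the sum over the extensions of a word by at most
  \<open>\<beta>\<close>.\<close>

lemma weighted_count:
  assumes "V \<subseteq> level m (k * width + period)" and "k \<le> l"
  shows "(\<Sum>v | v \<in> level m (l * width + period) \<and> take (k * width + period) v \<in> V.
            (weight q (bits ((!) v)) k l)\<^sup>2) \<le> real (card V) * \<beta> ^ (l - k)"
  using assms(2)
proof (induction l rule: dec_induct)
  case base
  have "{v. v \<in> level m (k * width + period) \<and> take (k * width + period) v \<in> V} = V"
    using assms(1) by (auto simp: level_length)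
  then show ?case by simp
next
  case (step l)
  let ?U = "{v. v \<in> level m (l * width + period) \<and> take (k * width + period) v \<in> V}"
  let ?f = "\<lambda>l v. (weight q (bits ((!) v)) k l)\<^sup>2"
  let ?\<theta> = "\<lambda>v. (if bits ((!) v) l then q else 1 - q)\<^sup>2"
  have kl: "k * width \<le> l * width" using step(1) by (intro mult_le_mono1)
  have "{v. v \<in> level m (Suc l * width + period) \<and> take (k * width + period) v \<in> V}
      = (\<lambda>(v, y). v @ y) ` (?U \<times> level m width)"
  proof (intro equalityI subsetI)
    fix v assume v: "v \<in> {v. v \<in> level m (Suc l * width + period) \<and> take (k * width + period) v \<in> V}"
    then have "take (l * width + period) v \<in> ?U" "drop (l * width + period) v \<in> level m width"
      using kl by (auto simp: level_def take_in_words drop_in_words min_def)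
    then show "v \<in> (\<lambda>(v, y). v @ y) ` (?U \<times> level m width)"
      by (intro image_eqI[of _ _ "(take (l * width + period) v, drop (l * width + period) v)"]) auto
  next
    fix v assume "v \<in> (\<lambda>(v, y). v @ y) ` (?U \<times> level m width)"
    then show "v \<in> {v. v \<in> level m (Suc l * width + period) \<and> take (k * width + period) v \<in> V}"
      using kl by (auto simp: level_def)
  qed
  moreover have "inj_on (\<lambda>(v, y). v @ y) (?U \<times> level m width)"
    by (auto simp: inj_on_def level_def)
  ultimately have "(\<Sum>v | v \<in> level m (Suc l * width + period) \<and> take (k * width + period) v \<in> V. ?f (Suc l) v)
      = (\<Sum>v\<in>?U. \<Sum>y\<in>level m width. ?f (Suc l) (v @ y))"
    by (simp add: sum.reindex sum.cartesian_product case_prod_unfold o_def)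
  also have "\<dots> = (\<Sum>v\<in>?U. ?f l v * (\<Sum>y\<in>level m width. ?\<theta> (v @ y)))"
  proof (intro sum.cong refl)
    fix v assume v: "v \<in> ?U"
    have "weight q (bits ((!) (v @ y))) k l = weight q (bits ((!) v)) k l" for y
      using v by (intro weight_cong) (auto simp: nth_append level_length)
    then show "(\<Sum>y\<in>level m width. ?f (Suc l) (v @ y)) = ?f l v * (\<Sum>y\<in>level m width. ?\<theta> (v @ y))"
      using step(1) by (simp add: weight_Suc power_mult_distrib sum_distrib_left)
  qed
  also have "\<dots> \<le> (\<Sum>v\<in>?U. ?f l v * \<beta>)"
    by (intro sum_mono mult_left_mono extension_sum) auto
  also have "\<dots> = (\<Sum>v\<in>?U. ?f l v) * \<beta>" by (simp add: sum_distrib_right)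
  also have "\<dots> \<le> (real (card V) * \<beta> ^ (l - k)) * \<beta>"
    using step.IH \<beta>_bounds by (intro mult_right_mono) auto
  also have "\<dots> = real (card V) * \<beta> ^ (Suc l - k)"
    using step(1) by (simp add: Suc_diff_le)
  finally show ?case .
qed

section \<open>From words to eventually periodic rays\<close>

text \<open>After the last bit the letters recur with the common period, so the end of the prefix
  determines all later letters. Thus such rays can be counted by prefixes.\<close>

lemma ray_determined:
  assumes w: "w \<in> rays m" "\<forall>j\<ge>l. \<not> bits (letter w) j"
    and w': "w' \<in> rays m" "\<forall>j\<ge>l. \<not> bits (letter w') j"
    and eq: "w (l * width + period) = w' (l * width + period)"
  shows "w = w'"
proof (rule ray_eqI[OF w(1) w'(1)])
  fix i show "letter w i = letter w' i"
  proof (induction i rule: less_induct)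
    case (less i)
    show ?case
    proof (cases "i < l * width + period")
      case True
      then show ?thesis
        using ray_nth[OF w(1) True] ray_nth[OF w'(1) True] eq by simp
    next
      case False
      then have "\<not> jump w (i - period)" "\<not> jump w' (i - period)"
        using w(2) w'(2) unfolding no_bits_iff by auto
      then show ?thesis using less[of "i - period"] False period_pos by (simp add: jump_def)
    qed
  qed
qed

lemma finite_no_bits: "finite {w \<in> rays m. \<forall>j\<ge>l. \<not> bits (letter w) j}"
proof (rule inj_on_finite[of "\<lambda>w. w (l * width + period)"])
  show "inj_on (\<lambda>w. w (l * width + period)) {w \<in> rays m. \<forall>j\<ge>l. \<not> bits (letter w) j}"
    by (intro inj_onI ray_determined) auto
  show "(\<lambda>w. w (l * width + period)) ` {w \<in> rays m. \<forall>j\<ge>l. \<not> bits (letter w) j} \<subseteq> level m (l * width + period)"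
    by (auto simp: level_def ray_words ray_length)
qed simp

lemma weighted_ray_count:
  assumes V: "V \<subseteq> level m (k * width + period)" and kl: "k \<le> l"
    and X: "\<And>w. w \<in> X \<Longrightarrow> w \<in> rays m \<and> (\<forall>j\<ge>l. \<not> bits (letter w) j) \<and> w (k * width + period) \<in> V"
  shows "(\<Sum>w\<in>X. (weight q (bits (letter w)) k l)\<^sup>2) \<le> real (card V) * \<beta> ^ (l - k)"
proof -
  let ?p = "\<lambda>w. w (l * width + period)"
  have inj: "inj_on ?p X"
    using X by (intro inj_onI ray_determined) auto
  have kl': "k * width + period \<le> l * width + period" using kl by simp
  have "(\<Sum>w\<in>X. (weight q (bits (letter w)) k l)\<^sup>2) = (\<Sum>w\<in>X. (weight q (bits ((!) (?p w))) k l)\<^sup>2)"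
  proof (intro sum.cong refl arg_cong2[of _ _ _ _ "(^)"] weight_cong)
    fix w x assume "w \<in> X" "x < l * width + period"
    then show "letter w x = ?p w ! x" using X ray_nth[of w m x] by simp
  qed
  also have "\<dots> = (\<Sum>v\<in>?p ` X. (weight q (bits ((!) v)) k l)\<^sup>2)"
    by (simp add: sum.reindex[OF inj])
  also have "\<dots> \<le> (\<Sum>v | v \<in> level m (l * width + period) \<and> take (k * width + period) v \<in> V.
            (weight q (bits ((!) v)) k l)\<^sup>2)"
  proof (intro sum_mono2)
    show "?p ` X \<subseteq> {v. v \<in> level m (l * width + period) \<and> take (k * width + period) v \<in> V}"
    proof (intro image_subsetI CollectI conjI)
      fix w assume w: "w \<in> X"
      then have r: "w \<in> rays m" using X by blast
      show "?p w \<in> level m (l * width + period)"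
        using ray_words[OF r] ray_length[OF r] by (simp add: level_def)
      show "take (k * width + period) (?p w) \<in> V"
        unfolding ray_take[OF r kl'] using X w by blast
    qed
  qed auto
  also have "\<dots> \<le> real (card V) * \<beta> ^ (l - k)" by (rule weighted_count[OF V kl])
  finally show ?thesis .
qed

definition wide_heads :: "(nat list \<Rightarrow> nat list) \<Rightarrow> nat \<Rightarrow> nat list set" where
  "wide_heads g k = {v \<in> level m (k * width + period). k \<ge> 2 \<longrightarrow> wide (sec g (take ((k - 2) * width) v))}"

text \<open>A wide prefix of \<open>k - 2\<close> blocks is followed by
  \<open>2 * width + period\<close> free letters, for which there are \<open>A\<close> choices; the
  summand 1 in \<open>B\<close> covers \<open>k < 2\<close>.\<close>

lemma card_wide_heads:
  assumes g: "g \<in> S"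
  shows "\<exists>C\<ge>0. \<forall>k. real (card (wide_heads g k)) \<le> C * (real k + 1)"
proof -
  obtain C where C: "C \<ge> 0" "\<And>k. real (card {v \<in> level m k. wide (sec g v)}) \<le> C * (real k + 1)"
    using wide_count[OF g] by blast
  define A where "A = real m ^ (2 * width + period)"
  have A: "A \<ge> 1" unfolding A_def using m2 by (intro one_le_power) auto
  define B where "B = (C * (real width + 1) + 1) * A"
  have "real (card (wide_heads g k)) \<le> B * (real k + 1)" for k
  proof (cases "k \<ge> 2")
    case True
    let ?h = "(k - 2) * width"
    have len: "k * width + period = ?h + (2 * width + period)"
      using True by (simp add: diff_mult_distrib mult_le_mono1)
    let ?W = "{v \<in> level m ?h. wide (sec g v)}"
    have "wide_heads g k \<subseteq> (\<lambda>(v, y). v @ y) ` (?W \<times> level m (2 * width + period))"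
    proof
      fix v assume "v \<in> wide_heads g k"
      then have v: "v \<in> words m" "length v = ?h + (2 * width + period)" "wide (sec g (take ?h v))"
        using True len by (auto simp: wide_heads_def level_def)
      then have "take ?h v \<in> ?W" "drop ?h v \<in> level m (2 * width + period)"
        by (auto simp: level_def take_in_words drop_in_words)
      then show "v \<in> (\<lambda>(v, y). v @ y) ` (?W \<times> level m (2 * width + period))"
        by (intro image_eqI[of _ _ "(take ?h v, drop ?h v)"]) auto
    qed
    then have "card (wide_heads g k) \<le> card (?W \<times> level m (2 * width + period))"
      by (intro surj_card_le) auto
    then have "real (card (wide_heads g k)) \<le> real (card ?W * m ^ (2 * width + period))"
      unfolding card_cartesian_product card_level of_nat_le_iff .
    also have "\<dots> = real (card ?W) * A" by (simp add: A_def)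
    also have "\<dots> \<le> (C * (real ?h + 1)) * A" using C(2)[of ?h] A by (intro mult_right_mono) auto
    also have "\<dots> \<le> ((C * (real width + 1) + 1) * (real k + 1)) * A"
    proof (intro mult_right_mono)
      have "?h + 1 \<le> (width + 1) * (k + 1)"
        using mult_le_mono1[of "k - 2" k width] by (simp add: algebra_simps)
      then have "real (?h + 1) \<le> real ((width + 1) * (k + 1))" by (simp only: of_nat_le_iff)
      then have h: "real ?h + 1 \<le> (real width + 1) * (real k + 1)" 
        unfolding of_nat_mult of_nat_add of_nat_1 .
      have "C * (real ?h + 1) \<le> C * ((real width + 1) * (real k + 1))"
        by (rule mult_left_mono[OF h C(1)])
      also have "\<dots> \<le> (C * (real width + 1) + 1) * (real k + 1)"
        by (simp add: algebra_simps)
      finally show "C * (real ?h + 1) \<le> (C * (real width + 1) + 1) * (real k + 1)" .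
    qed (use A in auto)
    finally show ?thesis by (simp add: B_def mult_ac)
  next
    case False
    have "card (wide_heads g k) \<le> card (level m (k * width + period))"
      by (intro card_mono) (auto simp: wide_heads_def)
    then have "real (card (wide_heads g k)) \<le> real m ^ (k * width + period)"
      unfolding card_level by (metis of_nat_le_iff of_nat_power)
    also have "\<dots> \<le> A"
      unfolding A_def using False m2 by (intro power_increasing add_mono mult_le_mono1) auto
    also have "\<dots> \<le> 1 * A * 1" by simp
    also have "\<dots> \<le> (C * (real width + 1) + 1) * A * (real k + 1)"
      using A C(1) by (intro mult_mono) auto
    finally show ?thesis by (simp add: B_def)
  qed
  moreover have "B \<ge> 0" using A C(1) by (simp add: B_def)
  ultimately show ?thesis by blast
qed

end

lemma sum_mult_geometric_le:
  fixes x :: real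
  assumes "0 < x" "x < 1"
  shows "(\<Sum>k\<le>l. (real k + 1) * x ^ (l - k)) \<le> (real l + 1) / (1 - x)"
proof -
  have "(\<Sum>k\<le>l. (real k + 1) * x ^ (l - k)) \<le> (\<Sum>k\<le>l. (real l + 1) * x ^ (l - k))"
    using assms by (intro sum_mono mult_right_mono) auto
  also have "\<dots> = (real l + 1) * (\<Sum>i\<le>l. x ^ i)"
    unfolding sum_distrib_left
    by (rule sum.reindex_bij_witness[of _ "\<lambda>i. l - i" "\<lambda>i. l - i"]) auto
  also have "\<dots> \<le> (real l + 1) * (1 / (1 - x))"
  proof (intro mult_left_mono)
    have "(\<Sum>i<Suc l. x ^ i) = (1 - x ^ Suc l) / (1 - x)"
      using sum_gp_strict[of x "Suc l"] assms by simp
    also have "\<dots> \<le> 1 / (1 - x)" using assms by (intro divide_right_mono) auto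
    finally show "(\<Sum>i\<le>l. x ^ i) \<le> 1 / (1 - x)" by (simp only: lessThan_Suc_atMost)
  qed simp
  finally show ?thesis by simp
qed

definition harmonic :: "nat \<Rightarrow> real" where
  "harmonic N = (\<Sum>n\<le>N. 1 / (real n + 1))"

lemma harmonic_ge_1: "harmonic N \<ge> 1"
proof -
  have "(\<Sum>n\<in>{0}. 1 / (real n + 1)) \<le> harmonic N"
    unfolding harmonic_def by (intro sum_mono2) auto
  then show ?thesis by simp
qed

lemma harmonic_at_top: "filterlim harmonic at_top sequentially"
proof -
  have "harmonic N = harm (Suc N)" for N
    unfolding harmonic_def harm_def
    by (rule sum.reindex_bij_witness[of _ "\<lambda>n. n - 1" Suc]) (auto simp: field_simps)
  then have "harmonic = (\<lambda>N. harm (Suc N))" by (rule ext)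
  then show ?thesis using filterlim_compose[OF harm_at_top filterlim_Suc] by simp
qed

context quadratic_automaton
begin

section \<open>The energy along one generator\<close>

definition energy_const :: real where
  "energy_const = (2 + 1 / q) / q ^ 3"

text \<open>The change is charged to a pair: \<open>l\<close> is the end of the bits of
  \<open>w\<close>, and \<open>k\<close> is where the damping of the code starts, right after the
  first block that begins in a state which is not wide, or \<open>l\<close> if there is none early
  enough.\<close>

lemma potential_change:
  assumes g: "g \<in> S" and w: "w \<in> rays m"
    and neq: "potential q N (bits (letter w)) \<noteq> potential q N (bits (letter (ray_act w g)))"
  shows "\<exists>l k. l \<le> N + 1 \<and> k \<le> l \<and> (\<forall>j\<ge>l. \<not> bits (letter w) j) \<and> w (k * width + period) \<in> wide_heads g k
     \<and> \<bar>potential q N (bits (letter w)) - potential q N (bits (letter (ray_act w g)))\<bar>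
        \<le> energy_const * weight q (bits (letter w)) k l / (real l + 1)"
proof -
  let ?b = "bits (letter w)" and ?b' = "bits (letter (ray_act w g))"
  obtain n where n: "cutoff q ?b n \<noteq> cutoff q ?b' n"
    using neq unfolding potential_def by (metis (no_types, lifting) sum.cong)
  \<comment> \<open>If \<open>w\<close> has a bit from \<open>n\<close> on, its cutoff is 1; that of
    the image is not, so the image has none, and this passes back to \<open>w\<close> with a delay
    of one block.\<close>
  have "\<forall>j\<ge>n+1. \<not> ?b j"
  proof (cases "\<exists>j\<ge>n. ?b j")
    case True
    then have "\<forall>j\<ge>n. \<not> ?b' j" using n by (auto simp: cutoff_def split: if_splits)
    then show ?thesis by (rule no_bits_transfer(2)[OF g w])
  qed auto
  define l where "l = (LEAST l. \<forall>j\<ge>l. \<not> ?b j)"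
  have l: "\<forall>j\<ge>l. \<not> ?b j"
    unfolding l_def by (rule LeastI[where P = "\<lambda>l. \<forall>j\<ge>l. \<not> ?b j"]) fact
  have top: "?b (l - 1)" if "l > 0"
  proof (rule ccontr)
    assume "\<not> ?b (l - 1)"
    then have "\<forall>j\<ge>l-1. \<not> ?b j" using l that by (metis Suc_pred' le_antisym not_less_eq_eq)
    then have "l \<le> l - 1" unfolding l_def by (rule Least_le)
    then show False using that by simp
  qed
  \<comment> \<open>The condition \<open>K + 1 < l\<close> leaves at least one block for damping; if
    it fails for every narrow \<open>K\<close>, then \<open>k = l\<close> and the weight is
    1.\<close>
  define k where "k = (if \<exists>K. K + 1 < l \<and> \<not> wide (state g w (K * width))
      then (LEAST K. K + 1 < l \<and> \<not> wide (state g w (K * width))) + 1 else l)"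
  have k: "k \<le> l" "k = l \<or> (\<exists>K. k = K + 1 \<and> k < l \<and> \<not> wide (state g w (K * width)))"
    "k \<ge> 2 \<longrightarrow> wide (state g w ((k - 2) * width))"
  proof -
    have "k \<le> l \<and> (k = l \<or> (\<exists>K. k = K + 1 \<and> k < l \<and> \<not> wide (state g w (K * width))))
      \<and> (k \<ge> 2 \<longrightarrow> wide (state g w ((k - 2) * width)))"
    proof (cases "\<exists>K. K + 1 < l \<and> \<not> wide (state g w (K * width))")
      case True
      let ?P = "\<lambda>K. K + 1 < l \<and> \<not> wide (state g w (K * width))"
      define K where "K = (LEAST K. ?P K)"
      have kK: "k = K + 1" using True by (simp add: k_def K_def)
      have K: "?P K" unfolding K_def by (rule LeastI_ex[OF True])
      have "wide (state g w ((k - 2) * width))" if "k \<ge> 2"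
      proof -
        have "k - 2 < K" using that kK by simp
        then have "\<not> ?P (k - 2)" unfolding K_def by (rule not_less_Least)
        then show ?thesis using K \<open>k - 2 < K\<close> by simp
      qed
      then show ?thesis using kK K by auto
    next
      case False
      then have kl: "k = l" unfolding k_def by (rule if_not_P)
      have "wide (state g w ((l - 2) * width))" if "l \<ge> 2"
      proof -
        have "(l - 2) + 1 < l" using that by simp
        then show ?thesis using False by blast
      qed
      then show ?thesis using kl by simp
    qed
    then show "k \<le> l" "k = l \<or> (\<exists>K. k = K + 1 \<and> k < l \<and> \<not> wide (state g w (K * width)))"
      "k \<ge> 2 \<longrightarrow> wide (state g w ((k - 2) * width))" by blast+
  qed
  have ctl: "controlled k l ?b ?b'"
    unfolding controlled_def
  proof (intro conjI)
    show "l > 0 \<longrightarrow> ?b (l - 1)" using top by blast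
    show "\<forall>j\<ge>l+1. \<not> ?b' j" by (rule no_bits_transfer(1)[OF g w l])
    show "\<forall>n. (\<forall>i\<ge>n. \<not> ?b' i) \<longrightarrow> (\<forall>j\<ge>n+1. \<not> ?b j)"
      using no_bits_transfer(2)[OF g w] by blast
    show "k = l \<or> (\<exists>K. k = K + 1 \<and> k < l \<and> narrow_change K ?b ?b')"
      using k(2) narrow_bits[OF g w] by blast
  qed (rule l)
  have lN: "l \<le> N + 1"
    using potential_diff(1)[OF q_bounds ctl, of N] neq by (metis not_le)
  have "w (k * width + period) \<in> wide_heads g k"
  proof -
    have "take ((k - 2) * width) (w (k * width + period)) = w ((k - 2) * width)"
      by (rule ray_take[OF w]) (simp add: mult_le_mono1 trans_le_add1)
    then show ?thesis
      using k(3) ray_words[OF w] ray_length[OF w]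
      by (simp add: wide_heads_def level_def state_def[OF g w])
  qed
  then show ?thesis
    using lN k(1) l potential_diff(2)[OF q_bounds ctl, of N]
    unfolding energy_const_def by blast
qed

text \<open>For a fixed pair the squared weights of the admissible rays sum to
  \<open>O((k + 1) * \<beta> ^ (l - k))\<close>. With the squared factor \<open>1 / (l + 1)\<close>,
  the sum over \<open>k\<close> is \<open>O(1 / (l + 1))\<close>.\<close>

lemma energy_bound:
  assumes g: "g \<in> S"
  shows "\<exists>C\<ge>0. \<forall>N X. finite X \<longrightarrow> X \<subseteq> rays m \<longrightarrow>
     (\<Sum>w\<in>X. (potential q N (bits (letter w)) - potential q N (bits (letter (ray_act w g))))\<^sup>2)
        \<le> C * (\<Sum>l\<le>N+1. 1 / (real l + 1))"
proof -
  let ?D = "\<lambda>N w. (potential q N (bits (letter w)) - potential q N (bits (letter (ray_act w g))))\<^sup>2"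
  obtain Ch where Ch: "Ch \<ge> 0" "\<And>k. real (card (wide_heads g k)) \<le> Ch * (real k + 1)"
    using card_wide_heads[OF g] by blast
  define C where "C = energy_const\<^sup>2 * Ch / (1 - \<beta>)"
  have "(\<Sum>w\<in>X. ?D N w) \<le> C * (\<Sum>l\<le>N+1. 1 / (real l + 1))" if X: "finite X" "X \<subseteq> rays m" for N X
  proof -
    let ?P = "\<lambda>l k w. (\<forall>j\<ge>l. \<not> bits (letter w) j) \<and> w (k * width + period) \<in> wide_heads g k"
    let ?e = "\<lambda>l k w. (energy_const * weight q (bits (letter w)) k l / (real l + 1))\<^sup>2"
    let ?t = "\<lambda>l k w. if ?P l k w then ?e l k w else 0"
    \<comment> \<open>The pair depends on \<open>w\<close>; summing over all admissible pairs allows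
      the order of summation to be exchanged.\<close>
    have "?D N w \<le> (\<Sum>l\<le>N+1. \<Sum>k\<le>l. ?t l k w)" if w: "w \<in> X" for w
    proof (cases "?D N w = 0")
      case True
      show ?thesis unfolding True by (intro sum_nonneg) simp
    next
      case False
      then obtain l k where lk: "l \<le> N + 1" "k \<le> l" "?P l k w"
        "\<bar>potential q N (bits (letter w)) - potential q N (bits (letter (ray_act w g)))\<bar>
          \<le> energy_const * weight q (bits (letter w)) k l / (real l + 1)"
        using potential_change[OF g, of w N] X w by auto
      have "?D N w \<le> ?e l k w"
        using power_mono[OF lk(4) abs_ge_zero, of 2] by simp
      also have "\<dots> = ?t l k w" using lk(3) by simp
      also have "\<dots> \<le> (\<Sum>k\<le>l. ?t l k w)"
        using lk(2) by (intro member_le_sum) auto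
      also have "\<dots> \<le> (\<Sum>l\<le>N+1. \<Sum>k\<le>l. ?t l k w)"
        using lk(1) by (intro member_le_sum sum_nonneg) simp_all
      finally show ?thesis .
    qed
    then have "(\<Sum>w\<in>X. ?D N w) \<le> (\<Sum>w\<in>X. \<Sum>l\<le>N+1. \<Sum>k\<le>l. ?t l k w)"
      by (rule sum_mono)
    also have "\<dots> = (\<Sum>l\<le>N+1. \<Sum>k\<le>l. \<Sum>w\<in>X. ?t l k w)"
      by (subst sum.swap) (intro sum.cong refl sum.swap)
    also have "\<dots> \<le> (\<Sum>l\<le>N+1. C * (1 / (real l + 1)))"
    proof (intro sum_mono)
      fix l
      have "(\<Sum>w\<in>X. ?t l k w) \<le> (energy_const / (real l + 1))\<^sup>2 * (Ch * (real k + 1) * \<beta> ^ (l - k))"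
        if kl: "k \<le> l" for k
      proof -
        have "(\<Sum>w\<in>X. ?t l k w) = (\<Sum>w | w \<in> X \<and> ?P l k w. ?e l k w)"
          using X(1) by (simp add: sum.inter_filter)
        also have "\<dots> = (energy_const / (real l + 1))\<^sup>2 *
            (\<Sum>w | w \<in> X \<and> ?P l k w. (weight q (bits (letter w)) k l)\<^sup>2)"
          by (simp add: sum_distrib_left power_mult_distrib power_divide mult_ac)
        also have "\<dots> \<le> (energy_const / (real l + 1))\<^sup>2 * (real (card (wide_heads g k)) * \<beta> ^ (l - k))"
          using X(2) kl by (intro mult_left_mono weighted_ray_count) (auto simp: wide_heads_def)
        also have "\<dots> \<le> (energy_const / (real l + 1))\<^sup>2 * (Ch * (real k + 1) * \<beta> ^ (l - k))"
          using Ch(2)[of k] \<beta>_bounds by (intro mult_left_mono mult_right_mono) auto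
        finally show ?thesis .
      qed
      then have "(\<Sum>k\<le>l. \<Sum>w\<in>X. ?t l k w)
          \<le> (\<Sum>k\<le>l. (energy_const / (real l + 1))\<^sup>2 * (Ch * (real k + 1) * \<beta> ^ (l - k)))"
        by (intro sum_mono) auto
      also have "\<dots> = (energy_const / (real l + 1))\<^sup>2 * Ch * (\<Sum>k\<le>l. (real k + 1) * \<beta> ^ (l - k))"
        by (simp add: sum_distrib_left mult_ac)
      also have "\<dots> \<le> (energy_const / (real l + 1))\<^sup>2 * Ch * ((real l + 1) / (1 - \<beta>))"
        using Ch(1) \<beta>_bounds by (intro mult_left_mono sum_mult_geometric_le) auto
      also have "\<dots> = C * (1 / (real l + 1))"
        by (simp add: C_def power_divide power2_eq_square)
      finally show "(\<Sum>k\<le>l. \<Sum>w\<in>X. ?t l k w) \<le> C * (1 / (real l + 1))" .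
    qed
    finally show ?thesis by (simp only: sum_distrib_left)
  qed
  moreover have "C \<ge> 0" using Ch(1) \<beta>_bounds by (simp add: C_def)
  ultimately show ?thesis by blast
qed

section \<open>Test functions on rays\<close>

text \<open>Finite sets \<open>X\<close> stand for the sum over the uncountably many rays; the
  threshold for \<open>N\<close> is uniform in \<open>X\<close>.\<close>

definition vanishing_energy :: "(nat \<Rightarrow> (nat \<Rightarrow> nat list) \<Rightarrow> real) \<Rightarrow> (nat list \<Rightarrow> nat list) \<Rightarrow> bool" where
  "vanishing_energy \<phi> g \<longleftrightarrow> (\<forall>\<epsilon>>0. \<forall>\<^sub>F N in sequentially. \<forall>X. finite X \<longrightarrow> X \<subseteq> rays m \<longrightarrow>
     (\<Sum>w\<in>X. (\<phi> N w - \<phi> N (ray_act w g))\<^sup>2) \<le> \<epsilon>)"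

definition test_fun :: "nat \<Rightarrow> (nat \<Rightarrow> nat list) \<Rightarrow> real" where
  "test_fun N w = 1 - potential q N (bits (letter w)) / harmonic N"

lemma test_fun_vanishing:
  assumes g: "g \<in> S"
  shows "vanishing_energy test_fun g"
  unfolding vanishing_energy_def
proof (intro allI impI)
  fix \<epsilon> :: real assume \<epsilon>: "\<epsilon> > 0"
  obtain C where C: "C \<ge> 0" "\<And>N X. finite X \<Longrightarrow> X \<subseteq> rays m \<Longrightarrow>
     (\<Sum>w\<in>X. (potential q N (bits (letter w)) - potential q N (bits (letter (ray_act w g))))\<^sup>2)
        \<le> C * harmonic (N + 1)"
    using energy_bound[OF g] unfolding harmonic_def by blast
  have "eventually (\<lambda>N. harmonic N \<ge> 2 * C / \<epsilon>) sequentially"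
    using harmonic_at_top by (simp add: filterlim_at_top)
  then show "\<forall>\<^sub>F N in sequentially. \<forall>X. finite X \<longrightarrow> X \<subseteq> rays m \<longrightarrow>
     (\<Sum>w\<in>X. (test_fun N w - test_fun N (ray_act w g))\<^sup>2) \<le> \<epsilon>"
  proof eventually_elim
    case (elim N)
    show ?case
    proof (intro allI impI)
      fix X assume X: "finite X" "X \<subseteq> rays m"
      let ?h = "harmonic N"
      have h: "?h \<ge> 1" by (rule harmonic_ge_1)
      have "harmonic (N + 1) = ?h + 1 / (real N + 2)" by (simp add: harmonic_def add.commute)
      moreover have "1 / (real N + 2) \<le> 1" by simp
      ultimately have h2: "harmonic (N + 1) \<le> 2 * ?h" using h by linarith
      have "(\<Sum>w\<in>X. (test_fun N w - test_fun N (ray_act w g))\<^sup>2)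
        = (\<Sum>w\<in>X. (potential q N (bits (letter w)) - potential q N (bits (letter (ray_act w g))))\<^sup>2) / ?h\<^sup>2"
        unfolding sum_divide_distrib
      proof (intro sum.cong refl)
        fix w
        let ?x = "potential q N (bits (letter w))" and ?y = "potential q N (bits (letter (ray_act w g)))"
        have "test_fun N w - test_fun N (ray_act w g) = (?y - ?x) / ?h"
          by (simp add: test_fun_def diff_divide_distrib)
        then show "(test_fun N w - test_fun N (ray_act w g))\<^sup>2 = (?x - ?y)\<^sup>2 / ?h\<^sup>2"
          by (simp add: power_divide power2_commute)
      qed
      also have "\<dots> \<le> (C * (2 * ?h)) / ?h\<^sup>2"
        using C(2)[OF X, of N] mult_left_mono[OF h2 C(1)] by (intro divide_right_mono) auto
      also have "\<dots> = 2 * C / ?h" using h by (simp add: power2_eq_square)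
      also have "\<dots> \<le> \<epsilon>" using elim \<epsilon> h by (simp add: field_simps)
      finally show "(\<Sum>w\<in>X. (test_fun N w - test_fun N (ray_act w g))\<^sup>2) \<le> \<epsilon>" .
    qed
  qed
qed

lemma test_fun_finite_support: "finite {w \<in> rays m. test_fun N w \<noteq> 0}"
proof (rule finite_subset[OF _ finite_no_bits[of N]], safe)
  fix w j assume "test_fun N w \<noteq> 0" and j: "j \<ge> N" "bits (letter w) j"
  have "cutoff q (bits (letter w)) n = 1" if "n \<le> N" for n
    using j that unfolding cutoff_def by (meson le_trans)
  then have "potential q N (bits (letter w)) = harmonic N"
    by (simp add: potential_def harmonic_def)
  then have "test_fun N w = 0" using harmonic_ge_1[of N] by (simp add: test_fun_def)
  then show False using \<open>test_fun N w \<noteq> 0\<close> by simp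
qed

lemma constant_ray: "(\<lambda>n. replicate n 0) \<in> rays m"
  using m2 by (auto simp: rays_def replicate_append_same intro!: exI[of _ 0])

lemma test_fun_constant_ray: "test_fun N (\<lambda>n. replicate n 0) = 1"
proof -
  have nb: "\<not> bits (letter (\<lambda>n. replicate n 0)) j" for j
    by (auto simp: bits_def letter_def simp del: replicate_Suc)
  have "gray q (bits (letter (\<lambda>n. replicate n 0))) n = 0" for n
    by (induction n) (simp_all add: nb)
  then have "potential q N (bits (letter (\<lambda>n. replicate n 0))) = 0"
    by (simp add: potential_def cutoff_def nb)
  then show ?thesis by (simp add: test_fun_def)
qed

end

section \<open>Recurrence from test functions of small energy\<close>

text \<open>The transition operator killed on arrival at \<open>x\<close>, so that the walk may
  start at \<open>x\<close>. Its \<open>k\<close>-th iterate applied to 1 is the probability of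
  avoiding \<open>x\<close> at the times 1 to \<open>k\<close>.\<close>

definition avoid_op :: "('v, 'e) multigraph \<Rightarrow> 'v \<Rightarrow> ('v \<Rightarrow> ennreal) \<Rightarrow> 'v \<Rightarrow> ennreal" where
  "avoid_op G x F y = (\<integral>\<^sup>+ z. (if z = x then 0 else F z) \<partial>srw_step G y)"

text \<open>Integrating out the last coordinate replaces \<open>F\<close> by
  \<open>avoid_op G x F\<close>, so the induction needs arbitrary \<open>F\<close>. The measure at
  \<open>Suc k\<close> governs the coordinates 0 to \<open>k\<close>, as the initial vertex is
  itself drawn by the kernel.\<close>

lemma nn_integral_avoiding:
  fixes G :: "('v, 'e) multigraph" and F :: "'v \<Rightarrow> ennreal"
  shows "(\<integral>\<^sup>+ \<omega>. (if \<forall>n\<in>{1..k}. \<omega> n \<noteq> x then F (\<omega> k) else 0)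
       \<partial>Ionescu_Tulcea.C (srw_kernel G x) (\<lambda>_. count_space UNIV) 0 (Suc k) (\<lambda>_. undefined))
     = (avoid_op G x ^^ k) F x"
proof (induction k arbitrary: F)
  interpret Ionescu_Tulcea "srw_kernel G x" "\<lambda>_. count_space UNIV"
    by (rule Ionescu_Tulcea_srw_kernel)
  have comp: "(\<lambda>\<omega>. f (\<omega> i)) \<in> measurable (PiM {0..<n} (\<lambda>_. count_space UNIV)) N"
    if "i < n" "f \<in> UNIV \<rightarrow> space N" for f :: "'v \<Rightarrow> 'c" and N and i n :: nat
    using that by (intro measurable_compose[OF measurable_component_singleton]) auto
  have meas: "(\<lambda>\<omega>. if \<forall>n\<in>{1..k}. \<omega> n \<noteq> x then F (\<omega> k) else 0)
      \<in> borel_measurable (PiM {0..<Suc k} (\<lambda>_. count_space UNIV))" for k and F :: "'v \<Rightarrow> ennreal"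
    by (intro measurable_If pred_intros_finite comp) (auto intro!: comp)
  have u: "(\<lambda>_. undefined) \<in> space (PiM {0..<0::nat} (\<lambda>_. count_space (UNIV :: 'v set)))"
    by (simp add: space_PiM)
  {
    case 0
    have "C 0 (Suc 0) (\<lambda>_. undefined) = eP 0 (\<lambda>_. undefined)"
      using bind_return[OF measurable_eP[of 0] u] by simp
    then have "(\<integral>\<^sup>+ \<omega>. F (\<omega> 0) \<partial>C 0 (Suc 0) (\<lambda>_. undefined)) = (\<integral>\<^sup>+ \<omega>'. F (\<omega>' 0) \<partial>eP 0 (\<lambda>_. undefined))"
      by (simp only:)
    also have "\<dots> = (\<integral>\<^sup>+ z. F z \<partial>srw_kernel G x 0 (\<lambda>_. undefined))"
      using meas[of 0 F] by (subst nn_integral_eP[OF u]) auto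
    also have "\<dots> = F x" by (simp add: srw_kernel_def)
    finally show ?case by simp
  next
    case (Suc k)
    let ?f = "\<lambda>\<omega>. if \<forall>n\<in>{1..Suc k}. \<omega> n \<noteq> x then F (\<omega> (Suc k)) else 0"
    have "sets (C 0 (Suc k) (\<lambda>_. undefined)) = sets (PiM {0..<Suc k} (\<lambda>_. count_space (UNIV :: 'v set)))"
      using sets_C[OF u, of "Suc k"] by (simp only: add_0)
    from measurable_cong_sets[OF this refl] have N: "eP (Suc k) \<in> measurable (C 0 (Suc k) (\<lambda>_. undefined))
        (subprob_algebra (PiM {0..<Suc (Suc k)} (\<lambda>_. count_space UNIV)))"
      using measurable_eP[of "Suc k"] by blast
    have "(\<integral>\<^sup>+ \<omega>. ?f \<omega> \<partial>C 0 (Suc (Suc k)) (\<lambda>_. undefined))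
        = (\<integral>\<^sup>+ \<omega>. \<integral>\<^sup>+ \<omega>'. ?f \<omega>' \<partial>eP (Suc k) \<omega> \<partial>C 0 (Suc k) (\<lambda>_. undefined))"
      unfolding C.simps(2)[of 0 "Suc k"] add_0 by (rule nn_integral_bind[OF meas N])
    also have "\<dots> = (\<integral>\<^sup>+ \<omega>. (if \<forall>n\<in>{1..k}. \<omega> n \<noteq> x then avoid_op G x F (\<omega> k) else 0) \<partial>C 0 (Suc k) (\<lambda>_. undefined))"
    proof (rule nn_integral_cong)
      fix \<omega> assume "\<omega> \<in> space (C 0 (Suc k) (\<lambda>_. undefined))"
      then have \<omega>: "\<omega> \<in> space (PiM {0..<Suc k} (\<lambda>_. count_space UNIV))"
        unfolding space_C[OF u] by simp
      have "(\<integral>\<^sup>+ \<omega>'. ?f \<omega>' \<partial>eP (Suc k) \<omega>) = (\<integral>\<^sup>+ z. ?f (fun_upd \<omega> (Suc k) z) \<partial>srw_kernel G x (Suc k) \<omega>)"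
        by (rule nn_integral_eP[OF \<omega> meas])
      also have "\<dots> = (\<integral>\<^sup>+ z. (if \<forall>n\<in>{1..k}. \<omega> n \<noteq> x then (if z = x then 0 else F z) else 0) \<partial>srw_step G (\<omega> k))"
        unfolding srw_kernel_def
        by (simp only: nat.case) (auto intro!: nn_integral_cong simp: atLeastAtMostSuc_conv)
      also have "\<dots> = (if \<forall>n\<in>{1..k}. \<omega> n \<noteq> x then avoid_op G x F (\<omega> k) else 0)"
      proof -
        define P where "P \<longleftrightarrow> (\<forall>n\<in>{1..k}. \<omega> n \<noteq> x)"
        show ?thesis unfolding P_def[symmetric] by (cases P) (simp_all add: avoid_op_def)
      qed
      finally show "(\<integral>\<^sup>+ \<omega>'. ?f \<omega>' \<partial>eP (Suc k) \<omega>)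
          = (if \<forall>n\<in>{1..k}. \<omega> n \<noteq> x then avoid_op G x F (\<omega> k) else 0)" .
    qed
    also have "\<dots> = (avoid_op G x ^^ k) (avoid_op G x F) x" by (rule Suc.IH)
    finally show ?case by (simp only: funpow_Suc_right o_apply)
  }
qed

lemma sets_srw: "sets (srw G x) = sets (PiM UNIV (\<lambda>_. count_space UNIV))"
proof -
  interpret Ionescu_Tulcea "srw_kernel G x" "\<lambda>_. count_space UNIV"
    by (rule Ionescu_Tulcea_srw_kernel)
  show ?thesis unfolding srw_def by (rule PF.sets_lim)
qed

lemma space_srw: "space (srw G x) = UNIV"
  using sets_eq_imp_space_eq[OF sets_srw[of G x]] by (simp add: space_PiM)

lemma emeasure_srw_avoid:
  "emeasure (srw G x) {\<omega>. \<forall>n\<in>{1..k}. \<omega> n \<noteq> x} = (avoid_op G x ^^ k) (\<lambda>_. 1) x"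
proof -
  interpret Ionescu_Tulcea "srw_kernel G x" "\<lambda>_. count_space UNIV"
    by (rule Ionescu_Tulcea_srw_kernel)
  let ?P = "PiM {0..<Suc k} (\<lambda>_. count_space UNIV)"
  let ?X = "{\<omega> \<in> space ?P. \<forall>n\<in>{1..k}. \<omega> n \<noteq> x}"
  have X: "?X \<in> sets ?P"
  proof (intro sets.sets_Collect_finite_All)
    fix n assume "n \<in> {1..k}"
    then have "(\<lambda>\<omega>. \<omega> n) \<in> measurable ?P (count_space UNIV)"
      by (intro measurable_component_singleton) auto
    from measurable_sets[OF this, of "- {x}"] show "{\<omega> \<in> space ?P. \<omega> n \<noteq> x} \<in> sets ?P"
      by (simp add: vimage_def Int_def conj_commute)
  qed simp
  have u: "(\<lambda>_. undefined) \<in> space (PiM {0..<0::nat} (\<lambda>_. count_space UNIV))"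
    by (simp add: space_PiM)
  have "{\<omega>. \<forall>n\<in>{1..k}. \<omega> n \<noteq> x} = PF.emb UNIV {0..<Suc k} ?X"
    by (auto simp: prod_emb_def space_PiM)
  then have "emeasure (srw G x) {\<omega>. \<forall>n\<in>{1..k}. \<omega> n \<noteq> x} = emeasure (CI {0..<Suc k}) ?X"
    unfolding srw_def using lim[OF _ X] by simp
  also have "\<dots> = emeasure (C 0 (Suc k) (\<lambda>_. undefined)) ?X"
  proof -
    have "PF.emb {0..<Suc k} {0..<Suc k} ?X = ?X"
      by (rule prod_emb_id) (auto simp: space_PiM)
    then show ?thesis by (simp only: emeasure_CI[OF order_refl X])
  qed
  also have "\<dots> = (\<integral>\<^sup>+ \<omega>. indicator ?X \<omega> \<partial>C 0 (Suc k) (\<lambda>_. undefined))"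
    using X sets_C[OF u, of "Suc k"] by (intro nn_integral_indicator[symmetric]) simp
  also have "\<dots> = (\<integral>\<^sup>+ \<omega>. (if \<forall>n\<in>{1..k}. \<omega> n \<noteq> x then 1 else 0) \<partial>C 0 (Suc k) (\<lambda>_. undefined))"
    using space_C[OF u, of "Suc k"] by (intro nn_integral_cong) (auto simp: indicator_def)
  also have "\<dots> = (avoid_op G x ^^ k) (\<lambda>_. 1) x" by (rule nn_integral_avoiding)
  finally show ?thesis .
qed

lemma srw_returns:
  assumes "(\<lambda>k. (avoid_op G x ^^ k) (\<lambda>_. 1) x) \<longlonglongrightarrow> 0"
  shows "AE \<omega> in srw G x. \<exists>n>0. \<omega> n = x"
proof -
  let ?N = "{\<omega> :: nat \<Rightarrow> _. \<forall>n>0. \<omega> n \<noteq> x}"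
  have meas: "{\<omega>. \<omega> n \<noteq> x} \<in> sets (srw G x)" for n
  proof -
    have "(\<lambda>\<omega>. \<omega> n) \<in> measurable (PiM UNIV (\<lambda>_. count_space UNIV)) (count_space UNIV)"
      by (rule measurable_component_singleton) simp
    from measurable_sets[OF this, of "- {x}"] show ?thesis
      by (simp add: sets_srw space_PiM vimage_def)
  qed
  have N_eq: "?N = (\<Inter>n\<in>{0<..}. {\<omega>. \<omega> n \<noteq> x})" by auto
  have N: "?N \<in> sets (srw G x)"
    unfolding N_eq by (rule sets.countable_INT') (use meas in auto)
  have meask: "{\<omega>. \<forall>n\<in>{1..k}. \<omega> n \<noteq> x} \<in> sets (srw G x)" for k :: nat
  proof (cases "k = 0")
    case False
    have eq: "{\<omega>. \<forall>n\<in>{1..k}. \<omega> n \<noteq> x} = (\<Inter>n\<in>{1..k}. {\<omega>. \<omega> n \<noteq> x})" by auto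
    show ?thesis
      unfolding eq by (rule sets.finite_INT) (use meas False in auto)
  next
    case True
    then show ?thesis using sets.top[of "srw G x"] by (simp add: space_srw)
  qed
  have "emeasure (srw G x) ?N \<le> (avoid_op G x ^^ k) (\<lambda>_. 1) x" for k
    unfolding emeasure_srw_avoid[symmetric]
  proof (intro emeasure_mono meask subsetI CollectI ballI)
    fix \<omega> n assume "\<omega> \<in> ?N" "n \<in> {1..k}"
    then show "\<omega> n \<noteq> x" by simp
  qed
  then have "emeasure (srw G x) ?N \<le> 0"
    by (intro LIMSEQ_le_const[OF assms]) auto
  then have "emeasure (srw G x) ?N = 0" by simp
  then show ?thesis
    using N by (intro AE_I'[of ?N] null_setsI) blast+
qed

text \<open>A discrete Picone inequality: the difference of the two sides is a square divided by
  \<open>p * p'\<close>.\<close>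

lemma dirichlet_ineq:
  fixes p p' s t :: real
  assumes "p > 0" "p' > 0"
  shows "(s\<^sup>2 / p - t\<^sup>2 / p') * (p - p') \<le> (s - t)\<^sup>2"
proof -
  have "(s - t)\<^sup>2 - (s\<^sup>2 / p - t\<^sup>2 / p') * (p - p') = (s * p' - t * p)\<^sup>2 / (p * p')"
    using assms by (simp add: field_simps power2_eq_square)
  also have "\<dots> \<ge> 0" using assms by simp
  finally show ?thesis by simp
qed

section \<open>Escape probability and Dirichlet energy on Schreier graphs\<close>

locale schreier_action =
  fixes act :: "'v \<Rightarrow> 'g \<Rightarrow> 'v" and S :: "'g set" and A :: "'v set"
  assumes finite_S: "finite S" and act_bij: "\<sigma> \<in> S \<Longrightarrow> bij_betw (\<lambda>y. act y \<sigma>) A A"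
begin

abbreviation graph :: "('v, 'v \<times> 'g) multigraph" where
  "graph \<equiv> schreier_graph act S A"

definition iact :: "'v \<Rightarrow> 'g \<Rightarrow> 'v" where
  "iact y \<sigma> = inv_into A (\<lambda>y. act y \<sigma>) y"

lemma act_closed: "\<sigma> \<in> S \<Longrightarrow> y \<in> A \<Longrightarrow> act y \<sigma> \<in> A"
  using act_bij bij_betwE by fast

lemma iact_closed: "\<sigma> \<in> S \<Longrightarrow> y \<in> A \<Longrightarrow> iact y \<sigma> \<in> A"
  unfolding iact_def using bij_betwE[OF bij_betw_inv_into[OF act_bij]] by fast

lemma act_iact: "\<sigma> \<in> S \<Longrightarrow> y \<in> A \<Longrightarrow> act (iact y \<sigma>) \<sigma> = y"
  unfolding iact_def using bij_betw_inv_into_right[OF act_bij] by fast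

lemma iact_act: "\<sigma> \<in> S \<Longrightarrow> y \<in> A \<Longrightarrow> iact (act y \<sigma>) \<sigma> = y"
  unfolding iact_def using bij_betw_inv_into_left[OF act_bij] by fast

text \<open>Generators index both the edges leaving \<open>y\<close> and, through their inverses,
  the edges arriving there. So a step is uniform over \<open>2 * card S\<close> moves, counted with
  multiplicity.\<close>

lemma half_edges_graph:
  assumes "y \<in> A"
  shows "half_edges graph y = ({y} \<times> S) <+> ((\<lambda>\<sigma>. (iact y \<sigma>, \<sigma>)) ` S)"
proof -
  have "{e \<in> A \<times> S. fst e = y} = {y} \<times> S" using assms by auto
  moreover have "{e \<in> A \<times> S. (case e of (x, \<sigma>) \<Rightarrow> act x \<sigma>) = y} = (\<lambda>\<sigma>. (iact y \<sigma>, \<sigma>)) ` S"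
    using assms by (auto simp: act_iact iact_act iact_closed image_iff)
  ultimately show ?thesis by (simp add: half_edges_def schreier_graph_def)
qed

lemma inj_iact: "inj_on (\<lambda>\<sigma>. (iact y \<sigma>, \<sigma>)) S"
  by (auto simp: inj_on_def)

lemma locally_finite_graph: "locally_finite graph"
  unfolding locally_finite_def using finite_S
  by (auto simp: half_edges_graph schreier_graph_def[of act S A, THEN arg_cong, of verts])

lemma nn_integral_srw_step:
  assumes "y \<in> A" "S \<noteq> {}"
  shows "(\<integral>\<^sup>+ z. ennreal (f z) \<partial>srw_step graph y)
    = (\<Sum>\<sigma>\<in>S. ennreal (f (act y \<sigma>)) + ennreal (f (iact y \<sigma>))) / ennreal (2 * real (card S))"
proof -
  let ?H = "half_edges graph y"
  let ?t = "case_sum (end2 graph) (end1 graph)"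
  have H: "?H = ({y} \<times> S) <+> ((\<lambda>\<sigma>. (iact y \<sigma>, \<sigma>)) ` S)"
    by (rule half_edges_graph[OF assms(1)])
  have fin: "finite ?H" "?H \<noteq> {}" unfolding H using finite_S assms(2) by auto
  have card: "card ?H = 2 * card S"
    unfolding H using finite_S by (simp add: card_Plus card_image[OF inj_iact] card_cartesian_product)
  have "(\<integral>\<^sup>+ z. ennreal (f z) \<partial>srw_step graph y)
      = (\<integral>\<^sup>+ h. ennreal (f (?t h)) \<partial>pmf_of_set ?H)"
    using fin by (simp add: srw_step_def)
  also have "\<dots> = (\<Sum>h\<in>?H. ennreal (f (?t h))) / ennreal (real (card ?H))"
    using fin by (simp add: nn_integral_pmf_of_set ennreal_of_nat_eq_real_of_nat)
  also have "(\<Sum>h\<in>?H. ennreal (f (?t h)))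
      = (\<Sum>e\<in>{y} \<times> S. ennreal (f (end2 graph e))) + (\<Sum>e\<in>(\<lambda>\<sigma>. (iact y \<sigma>, \<sigma>)) ` S. ennreal (f (end1 graph e)))"
    unfolding H using finite_S by (subst sum.Plus) auto
  also have "\<dots> = (\<Sum>\<sigma>\<in>S. ennreal (f (act y \<sigma>))) + (\<Sum>\<sigma>\<in>S. ennreal (f (iact y \<sigma>)))"
  proof -
    have "{y} \<times> S = Pair y ` S" by auto
    moreover have "inj_on (Pair y) S" by (simp add: inj_on_def)
    ultimately have "(\<Sum>e\<in>{y} \<times> S. ennreal (f (end2 graph e))) = (\<Sum>\<sigma>\<in>S. ennreal (f (act y \<sigma>)))"
      by (simp add: sum.reindex schreier_graph_def)
    then show ?thesis by (simp add: sum.reindex[OF inj_iact] schreier_graph_def)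
  qed
  finally show ?thesis by (simp add: card sum.distrib)
qed

primrec avoid :: "'v \<Rightarrow> nat \<Rightarrow> 'v \<Rightarrow> real" where
  "avoid x 0 y = 1"
| "avoid x (Suc k) y = (\<Sum>\<sigma>\<in>S. (if act y \<sigma> = x then 0 else avoid x k (act y \<sigma>)) +
      (if iact y \<sigma> = x then 0 else avoid x k (iact y \<sigma>))) / (2 * real (card S))"

lemma avoid_nonneg: "0 \<le> avoid x k y"
  by (induction k arbitrary: y) (auto intro!: divide_nonneg_nonneg sum_nonneg)

lemma avoid_op_eq:
  assumes "S \<noteq> {}" "y \<in> A"
  shows "(avoid_op graph x ^^ k) (\<lambda>_. 1) y = ennreal (avoid x k y)"
  using assms(2)
proof (induction k arbitrary: y)
  case (Suc k)
  let ?f = "\<lambda>z. if z = x then 0 else avoid x k z"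
  have c: "real (card S) > 0" using assms(1) finite_S by (simp add: card_gt_0_iff)
  have "(avoid_op graph x ^^ Suc k) (\<lambda>_. 1) y
      = (\<integral>\<^sup>+ z. (if z = x then 0 else (avoid_op graph x ^^ k) (\<lambda>_. 1) z) \<partial>srw_step graph y)"
    by (simp add: avoid_op_def)
  also have "\<dots> = (\<integral>\<^sup>+ z. ennreal (?f z) \<partial>srw_step graph y)"
  proof (rule nn_integral_cong_AE, rule AE_pmfI)
    fix z assume "z \<in> set_pmf (srw_step graph y)"
    moreover have "finite (half_edges graph y)"
      unfolding half_edges_graph[OF Suc.prems] using finite_S by simp
    ultimately have "z = y \<or> z \<in> case_sum (end2 graph) (end1 graph) ` half_edges graph y"
      by (auto simp: srw_step_def split: if_splits)
    then have "z \<in> A"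
      unfolding half_edges_graph[OF Suc.prems] using Suc.prems act_closed iact_closed
      by (auto simp: schreier_graph_def)
    then show "(if z = x then 0 else (avoid_op graph x ^^ k) (\<lambda>_. 1) z) = ennreal (?f z)"
      by (simp add: Suc.IH)
  qed
  also have "\<dots> = (\<Sum>\<sigma>\<in>S. ennreal (?f (act y \<sigma>)) + ennreal (?f (iact y \<sigma>))) / ennreal (2 * real (card S))"
    by (rule nn_integral_srw_step[OF Suc.prems assms(1)])
  also have "\<dots> = (\<Sum>\<sigma>\<in>S. ennreal (?f (act y \<sigma>) + ?f (iact y \<sigma>))) / ennreal (2 * real (card S))"
    by (intro arg_cong2[of _ _ _ _ "(/)"] sum.cong refl ennreal_plus[symmetric]) (auto simp: avoid_nonneg)
  also have "\<dots> = ennreal (\<Sum>\<sigma>\<in>S. ?f (act y \<sigma>) + ?f (iact y \<sigma>)) / ennreal (2 * real (card S))"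
    by (subst sum_ennreal) (auto simp: avoid_nonneg)
  also have "\<dots> = ennreal (avoid x (Suc k) y)"
    unfolding avoid.simps using c by (intro divide_ennreal sum_nonneg) (auto simp: avoid_nonneg)
  finally show ?case .
qed simp

lemma avoid_le_1: "avoid x k y \<le> 1"
proof (induction k arbitrary: y)
  case (Suc k)
  have "(\<Sum>\<sigma>\<in>S. (if act y \<sigma> = x then 0 else avoid x k (act y \<sigma>)) +
      (if iact y \<sigma> = x then 0 else avoid x k (iact y \<sigma>))) \<le> (\<Sum>\<sigma>\<in>S. 1 + 1)"
    using Suc by (intro sum_mono add_mono) auto
  then show ?case
    by (cases "card S = 0") (simp_all add: divide_simps)
qed simp

lemma avoid_decreasing: "avoid x (Suc k) y \<le> avoid x k y"
proof (induction k arbitrary: y)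
  case 0
  show ?case using avoid_le_1[of x "Suc 0" y] by simp
next
  case (Suc k)
  show ?case
    unfolding avoid.simps(2)[of x "Suc k" y] avoid.simps(2)[of x k y]
    using Suc by (intro divide_right_mono sum_mono add_mono) (auto simp del: avoid.simps)
qed

text \<open>\<open>p - 1\<close> is the probability of hitting \<open>x\<close>, a superharmonic function.\<close>

lemma escape_energy:
  assumes "S \<noteq> {}" and x: "x \<in> A"
  shows "\<exists>p \<epsilon>. (\<lambda>k. avoid x k x) \<longlonglongrightarrow> \<epsilon> \<and> (\<forall>y. 1 \<le> p y \<and> p y \<le> 2) \<and>
    (\<forall>y. (\<Sum>\<sigma>\<in>S. (p y - p (act y \<sigma>)) + (p y - p (iact y \<sigma>))) = (if y = x then 2 * real (card S) * \<epsilon> else 0))"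
proof -
  have "\<exists>l. (\<lambda>k. avoid x k y) \<longlonglongrightarrow> l" for y
  proof -
    have dec: "decseq (\<lambda>k. avoid x k y)" by (rule decseq_SucI) (rule avoid_decreasing)
    have pos: "\<forall>k. 0 \<le> avoid x k y" by (simp add: avoid_nonneg)
    show ?thesis by (rule decseq_convergent[OF dec pos]) (rule exI)
  qed
  then obtain v where v: "\<And>y. (\<lambda>k. avoid x k y) \<longlonglongrightarrow> v y" by metis
  have v01: "0 \<le> v y" "v y \<le> 1" for y
    using v[of y] by (auto intro!: LIMSEQ_le_const[OF v] LIMSEQ_le_const2[OF v] avoid_nonneg avoid_le_1)
  \<comment> \<open>\<open>v\<close> is the probability of avoiding \<open>x\<close> from time 1 on,
    \<open>h\<close> that of avoiding it from time 0 on.\<close>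
  define h where "h y = (if y = x then 0 else v y)" for y
  have c: "real (card S) > 0" using assms(1) finite_S by (simp add: card_gt_0_iff)
  have hl: "(\<lambda>k. if y = x then 0 else avoid x k y) \<longlonglongrightarrow> h y" for y
    using v by (auto simp: h_def)
  have "(\<lambda>k. avoid x (Suc k) y) \<longlonglongrightarrow> (\<Sum>\<sigma>\<in>S. h (act y \<sigma>) + h (iact y \<sigma>)) / (2 * real (card S))" for y
    unfolding avoid.simps using c by (intro tendsto_intros hl) auto
  moreover have "(\<lambda>k. avoid x (Suc k) y) \<longlonglongrightarrow> v y" for y
    using v by (rule LIMSEQ_Suc)
  ultimately have "v y = (\<Sum>\<sigma>\<in>S. h (act y \<sigma>) + h (iact y \<sigma>)) / (2 * real (card S))" for y
    by (rule LIMSEQ_unique[rotated])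
  then have vs: "(\<Sum>\<sigma>\<in>S. h (act y \<sigma>) + h (iact y \<sigma>)) = 2 * real (card S) * v y" for y
    using c by (simp add: field_simps)
  \<comment> \<open>The shift by 2 keeps \<open>p\<close> between 1 and 2, so that it can serve as a
    denominator.\<close>
  define p where "p y = 2 - h y" for y
  have "(\<Sum>\<sigma>\<in>S. (p y - p (act y \<sigma>)) + (p y - p (iact y \<sigma>)))
      = (if y = x then 2 * real (card S) * v x else 0)" for y
  proof -
    have "(\<Sum>\<sigma>\<in>S. (p y - p (act y \<sigma>)) + (p y - p (iact y \<sigma>)))
        = (\<Sum>\<sigma>\<in>S. h (act y \<sigma>) + h (iact y \<sigma>)) - (\<Sum>\<sigma>\<in>S. 2 * h y)"
      unfolding sum_subtractf[symmetric] p_def by (intro sum.cong) auto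
    then show ?thesis unfolding vs by (simp add: h_def)
  qed
  moreover have "1 \<le> p y \<and> p y \<le> 2" for y using v01[of y] by (simp add: p_def h_def)
  ultimately show ?thesis using v by blast
qed

text \<open>The equation for \<open>p\<close> is tested against \<open>\<phi>\<^sup>2 / p\<close>.
  After summation by parts \<open>dirichlet_ineq\<close> bounds each edge by its share of the energy
  of \<open>\<phi>\<close>. Up to constants, the escape probability is bounded by the capacity of
  \<open>x\<close>.\<close>

lemma escape_le_energy:
  assumes p: "\<And>y. 1 \<le> p y \<and> p y \<le> (2::real)"
    "\<And>y. (\<Sum>\<sigma>\<in>S. (p y - p (act y \<sigma>)) + (p y - p (iact y \<sigma>))) = (if y = x then 2 * real (card S) * \<epsilon> else 0)"
    and \<phi>: "finite {y \<in> A. \<phi> y \<noteq> 0}"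
    and energy: "\<And>\<sigma> Y. \<sigma> \<in> S \<Longrightarrow> finite Y \<Longrightarrow> Y \<subseteq> A \<Longrightarrow> (\<Sum>y\<in>Y. (\<phi> y - \<phi> (act y \<sigma>))\<^sup>2) \<le> e"
    and x: "x \<in> A"
  shows "2 * real (card S) * \<epsilon> * ((\<phi> x)\<^sup>2 / p x) \<le> real (card S) * e"
proof -
  define F where "F = {y \<in> A. \<phi> y \<noteq> 0}"
  define \<psi> where "\<psi> y = (\<phi> y)\<^sup>2 / p y" for y
  have F: "finite F" "F \<subseteq> A" using \<phi> by (auto simp: F_def)
  have \<psi>0: "\<psi> y = 0" if "y \<in> A" "y \<notin> F" for y using that by (simp add: F_def \<psi>_def)
  have "2 * real (card S) * \<epsilon> * \<psi> x
      = (\<Sum>y\<in>F. \<psi> y * (\<Sum>\<sigma>\<in>S. (p y - p (act y \<sigma>)) + (p y - p (iact y \<sigma>))))"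
  proof -
    have "(\<Sum>y\<in>F. \<psi> y * (\<Sum>\<sigma>\<in>S. (p y - p (act y \<sigma>)) + (p y - p (iact y \<sigma>))))
        = (\<Sum>y\<in>F. if y = x then \<psi> x * (2 * real (card S) * \<epsilon>) else 0)"
      unfolding p(2) by (intro sum.cong) auto
    also have "\<dots> = \<psi> x * (2 * real (card S) * \<epsilon>)"
      using F \<psi>0[OF x] by (cases "x \<in> F") auto
    finally show ?thesis by simp
  qed
  also have "\<dots> = (\<Sum>\<sigma>\<in>S. \<Sum>y\<in>F. \<psi> y * (p y - p (act y \<sigma>)) + \<psi> y * (p y - p (iact y \<sigma>)))"
    unfolding sum_distrib_left distrib_left by (rule sum.swap)
  also have "\<dots> \<le> (\<Sum>\<sigma>\<in>S. e)"
  proof (rule sum_mono)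
    fix \<sigma> assume \<sigma>: "\<sigma> \<in> S"
    \<comment> \<open>Edges are indexed by their initial vertex: those with an endpoint in
      \<open>F\<close> start in \<open>F\<close> or in its preimage under
      \<open>\<sigma>\<close>.\<close>
    let ?Y = "F \<union> (\<lambda>y. iact y \<sigma>) ` F"
    have Y: "finite ?Y" "?Y \<subseteq> A" using F iact_closed[OF \<sigma>] by auto
    have inj: "inj_on (\<lambda>y. iact y \<sigma>) F"
      using F(2) by (intro inj_on_inverseI[of _ "\<lambda>y. act y \<sigma>"]) (auto simp: act_iact \<sigma>)
    have 1: "(\<Sum>y\<in>F. \<psi> y * (p y - p (act y \<sigma>))) = (\<Sum>y\<in>?Y. \<psi> y * (p y - p (act y \<sigma>)))"
      using Y \<psi>0 by (intro sum.mono_neutral_left) auto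
    have "(\<Sum>y\<in>F. \<psi> y * (p y - p (iact y \<sigma>)))
        = (\<Sum>z\<in>(\<lambda>y. iact y \<sigma>) ` F. \<psi> (act z \<sigma>) * (p (act z \<sigma>) - p z))"
      using F(2) by (subst sum.reindex[OF inj]) (auto intro!: sum.cong simp: act_iact \<sigma> subset_iff)
    also have "\<dots> = (\<Sum>z\<in>?Y. \<psi> (act z \<sigma>) * (p (act z \<sigma>) - p z))"
    proof (rule sum.mono_neutral_left)
      show "\<forall>z\<in>?Y - (\<lambda>y. iact y \<sigma>) ` F. \<psi> (act z \<sigma>) * (p (act z \<sigma>) - p z) = 0"
      proof
        fix z assume z: "z \<in> ?Y - (\<lambda>y. iact y \<sigma>) ` F"
        then have zA: "z \<in> A" using Y by blast
        have "act z \<sigma> \<notin> F"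
        proof
          assume "act z \<sigma> \<in> F"
          then have "iact (act z \<sigma>) \<sigma> \<in> (\<lambda>y. iact y \<sigma>) ` F" by (rule imageI)
          then show False using z iact_act[OF \<sigma> zA] by simp
        qed
        then show "\<psi> (act z \<sigma>) * (p (act z \<sigma>) - p z) = 0"
          using \<psi>0 act_closed[OF \<sigma> zA] by simp
      qed
    qed (use Y in auto)
    finally have 2: "(\<Sum>y\<in>F. \<psi> y * (p y - p (iact y \<sigma>))) = (\<Sum>y\<in>?Y. \<psi> (act y \<sigma>) * (p (act y \<sigma>) - p y))" .
    have "(\<Sum>y\<in>F. \<psi> y * (p y - p (act y \<sigma>)) + \<psi> y * (p y - p (iact y \<sigma>)))
        = (\<Sum>y\<in>?Y. (\<psi> y - \<psi> (act y \<sigma>)) * (p y - p (act y \<sigma>)))"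
      unfolding sum.distrib 1 2 by (simp add: sum.distrib[symmetric] algebra_simps)
    also have "\<dots> \<le> (\<Sum>y\<in>?Y. (\<phi> y - \<phi> (act y \<sigma>))\<^sup>2)"
    proof (rule sum_mono)
      fix y
      have "p y > 0" "p (act y \<sigma>) > 0" using p(1)[of y] p(1)[of "act y \<sigma>"] by linarith+
      then show "(\<psi> y - \<psi> (act y \<sigma>)) * (p y - p (act y \<sigma>)) \<le> (\<phi> y - \<phi> (act y \<sigma>))\<^sup>2"
        unfolding \<psi>_def by (rule dirichlet_ineq)
    qed
    also have "\<dots> \<le> e" by (rule energy[OF \<sigma> Y])
    finally show "(\<Sum>y\<in>F. \<psi> y * (p y - p (act y \<sigma>)) + \<psi> y * (p y - p (iact y \<sigma>))) \<le> e" .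
  qed
  finally show ?thesis by (simp add: \<psi>_def)
qed

lemma returns_if_small_energy:
  assumes x: "x \<in> A"
    and test: "\<And>e. e > 0 \<Longrightarrow> \<exists>\<phi>. finite {y \<in> A. \<phi> y \<noteq> 0} \<and> \<phi> x \<ge> (1/2 :: real) \<and>
      (\<forall>\<sigma>\<in>S. \<forall>Y. finite Y \<longrightarrow> Y \<subseteq> A \<longrightarrow> (\<Sum>y\<in>Y. (\<phi> y - \<phi> (act y \<sigma>))\<^sup>2) \<le> e)"
  shows "AE \<omega> in srw graph x. \<exists>n>0. \<omega> n = x"
proof (rule srw_returns, cases "S = {}")
  \<comment> \<open>Without generators every vertex is isolated and the walk stays put, so the first
    step is a return.\<close>
  case True
  then have "srw_step graph x = return_pmf x"
    by (auto simp: srw_step_def half_edges_def schreier_graph_def)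
  then have "avoid_op graph x F x = 0" for F by (simp add: avoid_op_def)
  then have "(avoid_op graph x ^^ Suc k) (\<lambda>_. 1) x = 0" for k by simp
  then have "(\<lambda>k. (avoid_op graph x ^^ Suc k) (\<lambda>_. 1) x) \<longlonglongrightarrow> 0" by (simp only: tendsto_const)
  then show "(\<lambda>k. (avoid_op graph x ^^ k) (\<lambda>_. 1) x) \<longlonglongrightarrow> 0" by (rule LIMSEQ_imp_Suc)
next
  case False
  have c: "real (card S) > 0" using False finite_S by (simp add: card_gt_0_iff)
  obtain p \<epsilon> where lim: "(\<lambda>k. avoid x k x) \<longlonglongrightarrow> \<epsilon>" and p: "\<And>y. 1 \<le> p y \<and> p y \<le> 2"
    "\<And>y. (\<Sum>\<sigma>\<in>S. (p y - p (act y \<sigma>)) + (p y - p (iact y \<sigma>))) = (if y = x then 2 * real (card S) * \<epsilon> else 0)"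
    using escape_energy[OF False x] by blast
  have \<epsilon>0: "\<epsilon> \<ge> 0" by (rule LIMSEQ_le_const[OF lim]) (auto simp: avoid_nonneg)
  have "\<epsilon> \<le> 4 * e" if e: "e > 0" for e
  proof -
    obtain \<phi> where \<phi>: "finite {y \<in> A. \<phi> y \<noteq> 0}" "\<phi> x \<ge> 1/2"
      "\<And>\<sigma> Y. \<sigma> \<in> S \<Longrightarrow> finite Y \<Longrightarrow> Y \<subseteq> A \<Longrightarrow> (\<Sum>y\<in>Y. (\<phi> y - \<phi> (act y \<sigma>))\<^sup>2) \<le> e"
      using test[OF e] by blast
    have "real (card S) * (2 * \<epsilon> * ((\<phi> x)\<^sup>2 / p x)) \<le> real (card S) * e"
      using escape_le_energy[OF p \<phi>(1,3) x] by (simp add: mult_ac)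
    then have "2 * \<epsilon> * ((\<phi> x)\<^sup>2 / p x) \<le> e"
      using c by (simp only: mult_le_cancel_left_pos)
    moreover have "1 / 8 \<le> (\<phi> x)\<^sup>2 / p x"
    proof -
      have "(1/2)\<^sup>2 \<le> (\<phi> x)\<^sup>2" using \<phi>(2) by (intro power_mono) auto
      then have "(1/4) / 2 \<le> (\<phi> x)\<^sup>2 / p x"
        using p(1)[of x] by (intro frac_le) (auto simp: power2_eq_square)
      then show ?thesis by simp
    qed
    then have "2 * \<epsilon> * (1 / 8) \<le> 2 * \<epsilon> * ((\<phi> x)\<^sup>2 / p x)"
      using \<epsilon>0 by (intro mult_left_mono) auto
    ultimately show ?thesis by simp
  qed
  \<comment> \<open>With this choice the bound reads
    \<open>\<epsilon> \<le> \<epsilon> / 2\<close>.\<close>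
  from this[of "\<epsilon> / 8"] have "\<epsilon> = 0" using \<epsilon>0 by (cases "\<epsilon> = 0") auto
  then have "(\<lambda>k. ennreal (avoid x k x)) \<longlonglongrightarrow> ennreal 0"
    using lim by (intro tendsto_ennrealI) simp
  then show "(\<lambda>k. (avoid_op graph x ^^ k) (\<lambda>_. 1) x) \<longlonglongrightarrow> 0"
    using avoid_op_eq[OF False x] by simp
qed

end

section \<open>From the automaton to the group it generates\<close>

context quadratic_automaton
begin

abbreviation \<Gamma> :: "(nat list \<Rightarrow> nat list) set" where
  "\<Gamma> \<equiv> generate (Aut_tree m) S"

lemma \<Gamma>_carrier: "\<Gamma> \<subseteq> carrier (Aut_tree m)"
  by (rule group.generate_incl[OF group_Aut_tree S_carrier])

lemma \<Gamma>_subgroup: "subgroup \<Gamma> (Aut_tree m)"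
  by (rule group.generate_is_subgroup[OF group_Aut_tree S_carrier])

lemma vanishing_energyD:
  assumes "vanishing_energy \<phi> g" "\<epsilon> > 0"
  shows "\<forall>\<^sub>F N in sequentially. \<forall>X. finite X \<longrightarrow> X \<subseteq> rays m \<longrightarrow>
     (\<Sum>w\<in>X. (\<phi> N w - \<phi> N (ray_act w g))\<^sup>2) \<le> \<epsilon>"
  using assms unfolding vanishing_energy_def by blast

lemma vanishing_energy_inv:
  assumes g: "g \<in> carrier (Aut_tree m)" and van: "vanishing_energy \<phi> g"
  shows "vanishing_energy \<phi> (inv\<^bsub>Aut_tree m\<^esub> g)"
  unfolding vanishing_energy_def
proof (intro allI impI)
  let ?h = "inv\<^bsub>Aut_tree m\<^esub> g"
  have h: "?h \<in> carrier (Aut_tree m)"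
    by (rule group.inv_closed[OF group_Aut_tree g])
  fix \<epsilon> :: real assume "\<epsilon> > 0"
  from vanishing_energyD[OF van this]
  show "\<forall>\<^sub>F N in sequentially. \<forall>X. finite X \<longrightarrow> X \<subseteq> rays m \<longrightarrow>
     (\<Sum>w\<in>X. (\<phi> N w - \<phi> N (ray_act w ?h))\<^sup>2) \<le> \<epsilon>"
  proof eventually_elim
    case (elim N)
    show ?case
    proof (intro allI impI)
      fix X assume X: "finite X" "X \<subseteq> rays m"
      let ?Y = "(\<lambda>w. ray_act w ?h) ` X"
      have inj: "inj_on (\<lambda>w. ray_act w ?h) X"
        by (rule inj_on_subset[OF ray_act_inj[OF h] X(2)])
      have "(\<Sum>w\<in>X. (\<phi> N w - \<phi> N (ray_act w ?h))\<^sup>2) = (\<Sum>z\<in>?Y. (\<phi> N z - \<phi> N (ray_act z g))\<^sup>2)"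
        unfolding sum.reindex[OF inj] o_def
      proof (intro sum.cong refl)
        fix w assume "w \<in> X"
        then have "ray_act (ray_act w ?h) g = w" using X(2) by (intro ray_act_inv(2)[OF g]) auto
        then show "(\<phi> N w - \<phi> N (ray_act w ?h))\<^sup>2
            = (\<phi> N (ray_act w ?h) - \<phi> N (ray_act (ray_act w ?h) g))\<^sup>2"
          by (simp add: power2_commute)
      qed
      also have "\<dots> \<le> \<epsilon>"
      proof -
        have "finite ?Y" "?Y \<subseteq> rays m" using X ray_act_in_rays[OF h] by auto
        then show ?thesis using elim by blast
      qed
      finally show "(\<Sum>w\<in>X. (\<phi> N w - \<phi> N (ray_act w ?h))\<^sup>2) \<le> \<epsilon>" .
    qed
  qed
qed

lemma vanishing_energy_mult:
  assumes g: "g \<in> carrier (Aut_tree m)" "vanishing_energy \<phi> g"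
    and h: "h \<in> carrier (Aut_tree m)" "vanishing_energy \<phi> h"
  shows "vanishing_energy \<phi> (g \<otimes>\<^bsub>Aut_tree m\<^esub> h)"
  unfolding vanishing_energy_def
proof (intro allI impI)
  fix \<epsilon> :: real assume "\<epsilon> > 0"
  then have "\<epsilon> / 4 > 0" by simp
  from vanishing_energyD[OF g(2) this] vanishing_energyD[OF h(2) this]
  show "\<forall>\<^sub>F N in sequentially. \<forall>X. finite X \<longrightarrow> X \<subseteq> rays m \<longrightarrow>
     (\<Sum>w\<in>X. (\<phi> N w - \<phi> N (ray_act w (g \<otimes>\<^bsub>Aut_tree m\<^esub> h)))\<^sup>2) \<le> \<epsilon>"
  proof eventually_elim
    case (elim N)
    show ?case
    proof (intro allI impI)
      fix X assume X: "finite X" "X \<subseteq> rays m"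
      let ?Y = "(\<lambda>w. ray_act w h) ` X"
      have inj: "inj_on (\<lambda>w. ray_act w h) X"
        by (rule inj_on_subset[OF ray_act_inj[OF h(1)] X(2)])
      have Y: "finite ?Y" "?Y \<subseteq> rays m" using X ray_act_in_rays[OF h(1)] by auto
      have "(\<Sum>w\<in>X. (\<phi> N w - \<phi> N (ray_act w (g \<otimes>\<^bsub>Aut_tree m\<^esub> h)))\<^sup>2)
         \<le> (\<Sum>w\<in>X. 2 * (\<phi> N w - \<phi> N (ray_act w h))\<^sup>2
              + 2 * (\<phi> N (ray_act w h) - \<phi> N (ray_act (ray_act w h) g))\<^sup>2)"
      proof (rule sum_mono)
        fix w assume "w \<in> X"
        then have eq: "ray_act w (g \<otimes>\<^bsub>Aut_tree m\<^esub> h) = ray_act (ray_act w h) g"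
          using X(2) by (intro ray_act_mult g h) auto
        have "(a - c)\<^sup>2 \<le> 2 * (a - b)\<^sup>2 + 2 * (b - c)\<^sup>2" for a b c :: real
        proof -
          have "2 * (a - b)\<^sup>2 + 2 * (b - c)\<^sup>2 - (a - c)\<^sup>2 = (a - 2 * b + c)\<^sup>2"
            by (simp add: power2_eq_square algebra_simps)
          then show ?thesis using zero_le_power2[of "a - 2 * b + c"] by linarith
        qed
        then show "(\<phi> N w - \<phi> N (ray_act w (g \<otimes>\<^bsub>Aut_tree m\<^esub> h)))\<^sup>2
            \<le> 2 * (\<phi> N w - \<phi> N (ray_act w h))\<^sup>2
              + 2 * (\<phi> N (ray_act w h) - \<phi> N (ray_act (ray_act w h) g))\<^sup>2"
          unfolding eq .
      qed
      also have "\<dots> = 2 * (\<Sum>w\<in>X. (\<phi> N w - \<phi> N (ray_act w h))\<^sup>2)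
          + 2 * (\<Sum>z\<in>?Y. (\<phi> N z - \<phi> N (ray_act z g))\<^sup>2)"
        unfolding sum.reindex[OF inj] o_def by (simp add: sum.distrib sum_distrib_left)
      also have "\<dots> \<le> 2 * (\<epsilon> / 4) + 2 * (\<epsilon> / 4)"
        using elim X Y by (intro add_mono mult_left_mono) auto
      finally show "(\<Sum>w\<in>X. (\<phi> N w - \<phi> N (ray_act w (g \<otimes>\<^bsub>Aut_tree m\<^esub> h)))\<^sup>2) \<le> \<epsilon>" by simp
    qed
  qed
qed

lemma vanishing_energy_one: "vanishing_energy \<phi> \<one>\<^bsub>Aut_tree m\<^esub>"
  unfolding vanishing_energy_def
proof (intro allI impI always_eventually)
  fix \<epsilon> :: real and N X assume "\<epsilon> > 0" "finite X" "X \<subseteq> rays m"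
  then have "(\<Sum>w\<in>X. (\<phi> N w - \<phi> N (ray_act w \<one>\<^bsub>Aut_tree m\<^esub>))\<^sup>2) = 0"
    by (intro sum.neutral ballI) (simp add: ray_act_one subset_iff)
  then show "(\<Sum>w\<in>X. (\<phi> N w - \<phi> N (ray_act w \<one>\<^bsub>Aut_tree m\<^esub>))\<^sup>2) \<le> \<epsilon>"
    using \<open>\<epsilon> > 0\<close> by simp
qed

text \<open>Passing to the whole group serves two ends: Schreier graphs for other generating sets
  are covered, and the values of a test function at two points of an orbit can be compared.\<close>

lemma test_fun_vanishing_\<Gamma>: "g \<in> \<Gamma> \<Longrightarrow> vanishing_energy test_fun g"
proof (induction rule: generate.induct)
  case one
  show ?case by (rule vanishing_energy_one)
next
  case (incl h)
  then show ?case by (rule test_fun_vanishing)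
next
  case (inv h)
  then show ?case by (intro vanishing_energy_inv S_Aut test_fun_vanishing)
next
  case (eng h1 h2)
  then show ?case using \<Gamma>_carrier by (intro vanishing_energy_mult) auto
qed

end

section \<open>Schreier graphs of orbits of rays\<close>

locale ray_orbit_graph =
  fixes m :: nat and \<Gamma> :: "(nat list \<Rightarrow> nat list) set" and \<xi> :: "nat \<Rightarrow> nat list"
    and S :: "(nat list \<Rightarrow> nat list) set"
  assumes \<Gamma>_sub: "subgroup \<Gamma> (Aut_tree m)" and \<xi>: "\<xi> \<in> rays m"
    and finite_S: "finite S" and gen: "generate (Aut_tree m) S = \<Gamma>"
begin

abbreviation A :: "(nat \<Rightarrow> nat list) set" where
  "A \<equiv> ray_orbit \<Gamma> \<xi>"

lemma \<Gamma>_Aut: "g \<in> \<Gamma> \<Longrightarrow> g \<in> carrier (Aut_tree m)"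
  using subgroup.subset[OF \<Gamma>_sub] by blast

lemma S_\<Gamma>: "\<sigma> \<in> S \<Longrightarrow> \<sigma> \<in> \<Gamma>"
  using gen generate.incl[of \<sigma> S "Aut_tree m"] by blast

lemma A_rays: "A \<subseteq> rays m"
  using \<xi> by (auto simp: ray_orbit_def intro: ray_act_in_rays \<Gamma>_Aut)

lemma \<xi>_A: "\<xi> \<in> A"
  using ray_act_one[OF \<xi>] subgroup.one_closed[OF \<Gamma>_sub] unfolding ray_orbit_def by force

lemma act_A: "g \<in> \<Gamma> \<Longrightarrow> w \<in> A \<Longrightarrow> ray_act w g \<in> A"
proof -
  assume g: "g \<in> \<Gamma>" and "w \<in> A"
  then obtain h where h: "h \<in> \<Gamma>" "w = ray_act \<xi> h" by (auto simp: ray_orbit_def)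
  then have "ray_act w g = ray_act \<xi> (g \<otimes>\<^bsub>Aut_tree m\<^esub> h)"
    using g \<Gamma>_Aut \<xi> by (simp add: ray_act_mult)
  then show ?thesis
    using subgroup.m_closed[OF \<Gamma>_sub g h(1)] by (auto simp: ray_orbit_def)
qed

lemma inv_\<Gamma>: "g \<in> \<Gamma> \<Longrightarrow> inv\<^bsub>Aut_tree m\<^esub> g \<in> \<Gamma>"
  by (rule subgroup.m_inv_closed[OF \<Gamma>_sub])

sublocale schreier_action ray_act S A
proof
  fix \<sigma> assume \<sigma>: "\<sigma> \<in> S"
  show "bij_betw (\<lambda>y. ray_act y \<sigma>) A A"
  proof (rule bij_betwI[where g = "\<lambda>y. ray_act y (inv\<^bsub>Aut_tree m\<^esub> \<sigma>)"])
    show "(\<lambda>y. ray_act y \<sigma>) \<in> A \<rightarrow> A" "(\<lambda>y. ray_act y (inv\<^bsub>Aut_tree m\<^esub> \<sigma>)) \<in> A \<rightarrow> A"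
      using act_A S_\<Gamma>[OF \<sigma>] inv_\<Gamma> by auto
  qed (use A_rays \<Gamma>_Aut[OF S_\<Gamma>[OF \<sigma>]] in \<open>auto intro: ray_act_inv\<close>)
qed (rule finite_S)

lemma adj_act: "\<sigma> \<in> S \<Longrightarrow> w \<in> A \<Longrightarrow> adj graph w (ray_act w \<sigma>)"
  unfolding adj_def schreier_graph_def by (intro bexI[of _ "(w, \<sigma>)"]) auto

lemma adj_sym: "adj G x y \<Longrightarrow> adj G y x"
  unfolding adj_def by blast

lemma connected_act:
  assumes "g \<in> generate (Aut_tree m) S" "w \<in> A"
  shows "(adj graph)\<^sup>*\<^sup>* w (ray_act w g)"
  using assms
proof (induction arbitrary: w rule: generate.induct)
  case one
  then show ?case using A_rays by (simp add: ray_act_one subset_iff)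
next
  case (incl h)
  then show ?case using adj_act by blast
next
  case (inv h)
  let ?w = "ray_act w (inv\<^bsub>Aut_tree m\<^esub> h)"
  have "?w \<in> A" by (rule act_A[OF inv_\<Gamma>[OF S_\<Gamma>[OF inv(1)]] inv(2)])
  then have "adj graph (ray_act ?w h) ?w" by (rule adj_sym[OF adj_act[OF inv(1)]])
  moreover have "ray_act ?w h = w"
    using inv(2) A_rays by (intro ray_act_inv(2)[OF \<Gamma>_Aut[OF S_\<Gamma>[OF inv(1)]]]) auto
  ultimately show ?case by simp
next
  case (eng h1 h2)
  have h: "h1 \<in> \<Gamma>" "h2 \<in> \<Gamma>" using eng.hyps by (simp_all add: gen)
  have "ray_act w (h1 \<otimes>\<^bsub>Aut_tree m\<^esub> h2) = ray_act (ray_act w h2) h1"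
    using eng.prems A_rays h \<Gamma>_Aut by (intro ray_act_mult) auto
  moreover have "(adj graph)\<^sup>*\<^sup>* w (ray_act w h2)"
    by (rule eng.IH(2)[OF eng.prems])
  moreover have "(adj graph)\<^sup>*\<^sup>* (ray_act w h2) (ray_act (ray_act w h2) h1)"
    by (rule eng.IH(1)[OF act_A[OF h(2) eng.prems]])
  ultimately show ?case by simp
qed

lemma connected_to_\<xi>:
  assumes "x \<in> A"
  shows "(adj graph)\<^sup>*\<^sup>* \<xi> x"
proof -
  obtain g where "g \<in> \<Gamma>" "x = ray_act \<xi> g" using assms by (auto simp: ray_orbit_def)
  then show ?thesis using connected_act[OF _ \<xi>_A] gen by simp
qed

lemma connected: "connected_graph graph"
  unfolding connected_graph_def
proof (intro ballI)
  fix x y assume "x \<in> verts graph" "y \<in> verts graph"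
  then have xy: "x \<in> A" "y \<in> A" by (auto simp: schreier_graph_def)
  have "(adj graph)\<^sup>*\<^sup>* x \<xi>"
    using connected_to_\<xi>[OF xy(1)]
    by (induction rule: rtranclp_induct) (auto intro: converse_rtranclp_into_rtranclp adj_sym)
  then show "(adj graph)\<^sup>*\<^sup>* x y" using connected_to_\<xi>[OF xy(2)] by (rule rtranclp_trans)
qed

lemma induced_orbit: "induced (schreier_graph ray_act S (rays m)) A = graph"
proof -
  have "{e \<in> rays m \<times> S. fst e \<in> A \<and> (case e of (x, \<sigma>) \<Rightarrow> ray_act x \<sigma>) \<in> A} = A \<times> S"
    using A_rays act_A S_\<Gamma> by auto
  then show ?thesis by (simp add: induced_def schreier_graph_def)
qed

text \<open>An edge may be crossed against its generator; the orbit is still not left, because the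
  group contains inverses.\<close>

lemma orbit_component: "A \<in> components (schreier_graph ray_act S (rays m))"
proof -
  let ?G = "schreier_graph ray_act S (rays m)"
  have "adj graph \<le> adj ?G"
    using A_rays by (auto simp: adj_def schreier_graph_def) blast+
  then have sub: "(adj ?G)\<^sup>*\<^sup>* \<xi> y" if "y \<in> A" for y
    using connected_to_\<xi>[OF that] by (metis predicate2D rtranclp_mono)
  have step: "y \<in> A" if x: "x \<in> A" and xy: "adj ?G x y" for x y
  proof -
    obtain z \<sigma> where z: "z \<in> rays m" "\<sigma> \<in> S"
      "z = x \<and> ray_act z \<sigma> = y \<or> z = y \<and> ray_act z \<sigma> = x"
      using xy by (auto simp: adj_def schreier_graph_def)
    then show ?thesis
    proof (elim disjE conjE)
      assume "z = x" "ray_act z \<sigma> = y"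
      then show ?thesis using act_A[OF S_\<Gamma>[OF z(2)] x] by simp
    next
      assume "z = y" "ray_act z \<sigma> = x"
      then have "ray_act x (inv\<^bsub>Aut_tree m\<^esub> \<sigma>) = y"
        using ray_act_inv(1)[OF \<Gamma>_Aut[OF S_\<Gamma>[OF z(2)]] z(1)] by simp
      then show ?thesis using act_A[OF inv_\<Gamma>[OF S_\<Gamma>[OF z(2)]] x] by simp
    qed
  qed
  have "y \<in> A" if "(adj ?G)\<^sup>*\<^sup>* \<xi> y" for y
    using that by (induction rule: rtranclp_induct) (auto intro: \<xi>_A step)
  then have "A = {y \<in> verts ?G. (adj ?G)\<^sup>*\<^sup>* \<xi> y}"
    using sub A_rays by (auto simp: schreier_graph_def)
  moreover have "\<xi> \<in> verts ?G" using \<xi> by (simp add: schreier_graph_def)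
  ultimately show ?thesis unfolding components_def by blast
qed

end

text \<open>The test functions equal 1 at the constant ray, but a return is needed from every
  \<open>x\<close> of its orbit. As their energy along \<open>g\<close> tends to 0, even the single
  summand at the constant ray forces the value at its image \<open>x\<close> to be at least 1/2
  eventually.\<close>

lemma (in quadratic_automaton) recurrent_orbit:
  assumes "finite S'" "generate (Aut_tree m) S' = \<Gamma>"
  shows "ray_orbit_graph m \<Gamma> (\<lambda>n. replicate n 0) S'"
    and "recurrent (schreier_graph ray_act S' (ray_orbit \<Gamma> (\<lambda>n. replicate n 0)))"
proof -
  let ?\<xi> = "\<lambda>n. replicate n (0 :: nat)"
  show "ray_orbit_graph m \<Gamma> ?\<xi> S'"
    by (rule ray_orbit_graph.intro[OF \<Gamma>_subgroup constant_ray assms])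
  then interpret O: ray_orbit_graph m \<Gamma> ?\<xi> S' .
  have "AE \<omega> in srw O.graph x. \<exists>n>0. \<omega> n = x" if x: "x \<in> O.A" for x
  proof (rule O.returns_if_small_energy[OF x])
    fix \<epsilon> :: real assume \<epsilon>: "\<epsilon> > 0"
    obtain g where g: "g \<in> \<Gamma>" "x = ray_act ?\<xi> g" using x by (auto simp: ray_orbit_def)
    have "\<forall>\<^sub>F N in sequentially. \<forall>\<sigma>\<in>S'. \<forall>X. finite X \<longrightarrow> X \<subseteq> rays m \<longrightarrow>
     (\<Sum>w\<in>X. (test_fun N w - test_fun N (ray_act w \<sigma>))\<^sup>2) \<le> \<epsilon>"
      using assms(1) vanishing_energyD[OF test_fun_vanishing_\<Gamma>[OF O.S_\<Gamma>] \<epsilon>]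
      by (intro eventually_ball_finite) auto
    moreover have "\<forall>\<^sub>F N in sequentially. \<forall>X. finite X \<longrightarrow> X \<subseteq> rays m \<longrightarrow>
     (\<Sum>w\<in>X. (test_fun N w - test_fun N (ray_act w g))\<^sup>2) \<le> 1 / 4"
      by (rule vanishing_energyD[OF test_fun_vanishing_\<Gamma>[OF g(1)]]) simp
    ultimately have "\<forall>\<^sub>F N in sequentially. (\<forall>\<sigma>\<in>S'. \<forall>X. finite X \<longrightarrow> X \<subseteq> rays m \<longrightarrow>
       (\<Sum>w\<in>X. (test_fun N w - test_fun N (ray_act w \<sigma>))\<^sup>2) \<le> \<epsilon>) \<and> test_fun N x \<ge> 1 / 2"
    proof eventually_elim
      case (elim N)
      have "(\<Sum>w\<in>{?\<xi>}. (test_fun N w - test_fun N (ray_act w g))\<^sup>2) \<le> 1 / 4"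
        using elim(2) constant_ray by blast
      then have "(1 - test_fun N x)\<^sup>2 \<le> (1 / 2)\<^sup>2"
        by (simp add: test_fun_constant_ray g(2) power2_eq_square)
      then have "1 - test_fun N x \<le> 1 / 2"
        by (rule power2_le_imp_le) simp
      then show ?case using elim(1) by simp
    qed
    from eventually_happens'[OF _ this] obtain N where N: "\<And>\<sigma> X. \<sigma> \<in> S' \<Longrightarrow> finite X \<Longrightarrow> X \<subseteq> rays m \<Longrightarrow>
       (\<Sum>w\<in>X. (test_fun N w - test_fun N (ray_act w \<sigma>))\<^sup>2) \<le> \<epsilon>" "test_fun N x \<ge> 1 / 2"
      using sequentially_bot by blast
    have "finite {y \<in> O.A. test_fun N y \<noteq> 0}"
      by (rule finite_subset[OF _ test_fun_finite_support[of N]]) (use O.A_rays in auto)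
    then show "\<exists>\<phi>. finite {y \<in> O.A. \<phi> y \<noteq> 0} \<and> \<phi> x \<ge> (1/2 :: real) \<and>
      (\<forall>\<sigma>\<in>S'. \<forall>Y. finite Y \<longrightarrow> Y \<subseteq> O.A \<longrightarrow> (\<Sum>y\<in>Y. (\<phi> y - \<phi> (ray_act y \<sigma>))\<^sup>2) \<le> \<epsilon>)"
      using N O.A_rays by (intro exI[of _ "test_fun N"]) auto
  qed
  then show "recurrent O.graph"
    unfolding recurrent_def using O.connected O.locally_finite_graph
    by (simp add: schreier_graph_def[of ray_act S' O.A])
qed

theorem theorem1p4:
  fixes m :: nat and \<Gamma> :: "(nat list \<Rightarrow> nat list) set"
  assumes "m \<ge> 2"
    and "automaton_group m \<Gamma>"
    and "has_degree m 2 \<Gamma>"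
  shows "(\<exists>\<xi>\<in>rays m. \<forall>S. finite S \<and> generate (Aut_tree m) S = \<Gamma> \<longrightarrow>
            recurrent (schreier_graph ray_act S (ray_orbit \<Gamma> \<xi>)))
       \<and> (\<exists>C. \<forall>S. finite S \<and> generate (Aut_tree m) S = \<Gamma> \<longrightarrow>
            C \<in> components (schreier_graph ray_act S (rays m)) \<and>
            recurrent (induced (schreier_graph ray_act S (rays m)) C))"
proof -
  obtain S where S: "finite S" "S \<subseteq> carrier (Aut_tree m)"
      "\<forall>g\<in>S. \<forall>v\<in>words m. tree_section m g v \<in> S" and \<Gamma>: "\<Gamma> = generate (Aut_tree m) S"
    using assms(2) unfolding automaton_group_def by blast
  have "(\<lambda>n. real (activity m g n)) \<in> O(\<lambda>n. real n ^ 2)" if "g \<in> S" for g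
    using assms(3) generate.incl[OF that] unfolding has_degree_def \<Gamma> by blast
  then interpret quadratic_automaton m S
    using S assms(1) by unfold_locales auto
  let ?\<xi> = "\<lambda>n. replicate n (0 :: nat)"
  show ?thesis
  \<comment> \<open>The orbit as a set of rays depends on the group alone, so one witness serves all
    generating sets.\<close>
  proof (intro conjI bexI[of _ ?\<xi>] exI[of _ "ray_orbit \<Gamma> ?\<xi>"] allI impI)
    fix S' assume "finite S' \<and> generate (Aut_tree m) S' = \<Gamma>"
    then have S': "finite S'" "generate (Aut_tree m) S' = generate (Aut_tree m) S"
      unfolding \<Gamma> by auto
    interpret O: ray_orbit_graph m "generate (Aut_tree m) S" ?\<xi> S'
      by (rule recurrent_orbit(1)[OF S'])
    show rec: "recurrent (schreier_graph ray_act S' (ray_orbit \<Gamma> ?\<xi>))"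
      unfolding \<Gamma> by (rule recurrent_orbit(2)[OF S'])
    show "ray_orbit \<Gamma> ?\<xi> \<in> components (schreier_graph ray_act S' (rays m))"
      unfolding \<Gamma> by (rule O.orbit_component)
    show "recurrent (induced (schreier_graph ray_act S' (rays m)) (ray_orbit \<Gamma> ?\<xi>))"
      unfolding \<Gamma> O.induced_orbit by (rule rec[unfolded \<Gamma>])
  qed (rule constant_ray)
qed

end
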